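(* Let $N$ be a positive integer. Let $A$ and $B$ be finite sets of nonzero complex numbers such that $A$, $B$, $1/A=\{a^{-1}:a\in A\}$, and $1/B=\{b^{-1}:b\in B\}$ are pairwise disjoint. Suppose that $\lambda=(\lambda_1,\lambda_2,\dots,\lambda_N)$ is a dominant weight of length $N$ (i.e. integers with $\lambda_1\geq\lambda_2\geq\dots\geq\lambda_N$). Define the twisted moment $$\mathcal{M}_N(A,B;\lambda) := \int_{U(N)} \prod_{\alpha \in A} \det(I-\alpha g^* ) \prod_{\beta \in B} \det(I-\beta g)\, s_{\lambda} (t_1,t_2,\dots,t_N) \,dg,$$ where the integral is over the unitary group $U(N)$ with Haar measure $dg$ normalized to total volume $1$, $I$ is the $N\times N$ identity matrix, $g^*$ is the conjugate transpose of $g$, $t_1,\dots,t_N$ are the eigenvalues of $g$ (with multiplicity), and $s_\lambda$ is the generalized Schur function $$s_{\lambda}(x_1,\dots,x_n):= \frac{\det\big(x_j^{n-k+\lambda_k} \big)_{1\leq j,k\leq n} }{ \det\big(x_j^{n-k} \big)_{1\leq j,k\leq n} }.$$ Then $$\mathcal{M}_N(A,B;\lambda) = \sum_{ \substack{U\subseteq A \\ V\subseteq B \\ |U|=|V| } } (UV)^N Z_{\lambda}\big(A\smallsetminus U \cup \tfrac{1}{V}, B\smallsetminus V \cup \tfrac{1}{U}\big),$$ where the sum is over all pairs of subsets $U\subseteq A$, $V\subseteq B$ of equal cardinality, $(UV)^N:=\prod_{u\in U}u^N\prod_{v\in V}v^N$, $\tfrac{1}{U}:=\{u^{-1}:u\in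 U\}$, and for finite multisets $C,D$, $$Z_{\lambda}(C,D) := s_{\mu'}(-C)\,s_{\nu'}(-D)\,\prod_{c\in C}\prod_{d\in D}\frac{1}{1-cd},$$ where $\mu = (\max\{\lambda_1,0\}, \dots, \max\{\lambda_N,0\})$ and $\nu = (\max\{-\lambda_N,0\}, \max\{-\lambda_{N-1},0\}, \dots, \max\{-\lambda_1,0\})$ are partitions, $\mu'$ and $\nu'$ are their conjugate partitions, $-E:=\{-e:e\in E\}$, and for a multiset $E=\{e_1,\dots,e_k\}$ and a partition $\rho$, $s_\rho(E):=s_\rho(e_1,\dots,e_k)$ is the Schur polynomial (with $s_\rho(e_1,\dots,e_k)=0$ if $\rho$ has more than $k$ nonzero parts, $s_\rho(\emptyset)=0$ for $\rho\neq 0$, and $s_0(\emptyset)=1$). More generally, this identity holds for any finite multisets $A$ and $B$ of complex numbers, without any restrictions, provided that the right-hand side is interpreted as its analytic continuation.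
   Context: Products over multisets count multiplicity. A dominant weight of length $n$ is an $n$-tuple of integers $\lambda_1\geq\dots\geq\lambda_n$; when $\lambda_n\ge 0$ the generalized Schur function is the usual Schur polynomial. The untwisted case $\lambda=0$ recovers the known formula for moments of characteristic polynomials of unitary matrices. *)

theory Defs
  imports
    "HOL-Analysis.Analysis"
    "HOL-Computational_Algebra.Fundamental_Theorem_Algebra"
    "Jordan_Normal_Form.Determinant"
begin

text \<open>
  \<open>HOL-Analysis\<close> matrices (dimension given by a type) are used for the unitary group,
  \<open>Jordan_Normal_Form\<close> matrices (dimension given by a number) only for the determinants in
  the Schur functions.
\<close>

no_notation vec_index (infixl \<open>$\<close> 100)
hide_const (open) Determinant.det Matrix.mat

section \<open>The unitary group and its Haar measure\<close>

definition conj_transpose :: "complex^'n^'n \<Rightarrow> complex^'n^'n"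
  where "conj_transpose g = (\<chi> i j. cnj (g $ j $ i))"

definition unitary_group :: "(complex^'n^'n) set"
  where "unitary_group = {g. conj_transpose g ** g = mat 1 \<and> g ** conj_transpose g = mat 1}"

definition normalized_haar_measure :: "(complex^'n^'n) measure \<Rightarrow> bool"
  where "normalized_haar_measure M \<longleftrightarrow>
    space M = unitary_group \<and>
    sets M = sets (restrict_space borel unitary_group) \<and>
    emeasure M unitary_group = 1 \<and>
    (\<forall>h\<in>unitary_group. \<forall>S\<in>sets M. emeasure M ((\<lambda>g. h ** g) ` S) = emeasure M S)"

text \<open>The roots, with multiplicity, of the characteristic polynomial \<open>det (X I - g)\<close>.\<close>

definition eigenvalues_mset :: "complex^'n^'n \<Rightarrow> complex multiset"
  where "eigenvalues_mset g =
    proots (det (\<chi> i j. (if i = j then [:0, 1:] else 0) - [:g $ i $ j:]))"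

section \<open>Generalized Schur functions\<close>

text \<open>
  Weights, partitions and tuples are indexed from \<open>0\<close>: \<open>l k\<close> is the part usually written
  \<open>\<lambda>\<^sub>k\<^sub>+\<^sub>1\<close>, so the exponent \<open>n - k + \<lambda>\<^sub>k\<close> becomes \<open>n - 1 - k + l k\<close>.
\<close>

definition dominant_weight :: "nat \<Rightarrow> (nat \<Rightarrow> int) \<Rightarrow> bool"
  where "dominant_weight n l \<longleftrightarrow> antimono_on {..<n} l"

definition alternant :: "nat \<Rightarrow> (nat \<Rightarrow> int) \<Rightarrow> (nat \<Rightarrow> complex) \<Rightarrow> complex"
  where "alternant n l x =
    Determinant.det (Matrix.mat n n (\<lambda>(j, k). x j powi (int n - 1 - int k + l k)))"

text \<open>
  Where two arguments coincide the quotient of determinants is \<open>0/0\<close>. There the function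
  takes the value of its continuous extension: the quotient is a (Laurent) polynomial in
  \<open>x\<^sub>0, \<dots>, x\<^sub>n\<^sub>-\<^sub>1\<close>, and the limit below is for pointwise convergence of tuples.
\<close>

definition gen_schur :: "nat \<Rightarrow> (nat \<Rightarrow> int) \<Rightarrow> (nat \<Rightarrow> complex) \<Rightarrow> complex"
  where "gen_schur n l x =
    (if inj_on x {..<n} then alternant n l x / alternant n (\<lambda>_. 0) x
     else Lim (at x within {y. inj_on y {..<n}})
            (\<lambda>y. alternant n l y / alternant n (\<lambda>_. 0) y))"

text \<open>The enumeration of the multiset is immaterial because \<^const>\<open>gen_schur\<close> is symmetric.\<close>

definition gen_schur_mset :: "(nat \<Rightarrow> int) \<Rightarrow> complex multiset \<Rightarrow> complex"
  where "gen_schur_mset l E = gen_schur (size E) l ((!) (SOME xs. mset xs = E))"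

text \<open>Here a partition is an infinite sequence with finitely many nonzero parts.\<close>

definition schur_poly :: "(nat \<Rightarrow> int) \<Rightarrow> complex multiset \<Rightarrow> complex"
  where "schur_poly r E = (if \<exists>i\<ge>size E. r i \<noteq> 0 then 0 else gen_schur_mset r E)"

definition positive_part :: "(nat \<Rightarrow> int) \<Rightarrow> nat \<Rightarrow> int"
  where "positive_part l i = max (l i) 0"

definition negative_part :: "nat \<Rightarrow> (nat \<Rightarrow> int) \<Rightarrow> nat \<Rightarrow> int"
  where "negative_part n l i = max (- l (n - 1 - i)) 0"

text \<open>The conjugate of the partition \<open>(r 0, \<dots>, r (n - 1))\<close>.\<close>

definition conjugate_partition :: "nat \<Rightarrow> (nat \<Rightarrow> int) \<Rightarrow> nat \<Rightarrow> int"
  where "conjugate_partition n r j = int (card {i. i < n \<and> r i > int j})"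

section \<open>The two sides of the identity\<close>

definition twisted_moment ::
    "(complex^'n^'n) measure \<Rightarrow> complex multiset \<Rightarrow> complex multiset \<Rightarrow> (nat \<Rightarrow> int) \<Rightarrow> complex"
  where "twisted_moment M A B l =
    (LINT g|M.
       (\<Prod>\<alpha>\<in>#A. det (mat 1 - map_matrix ((*) \<alpha>) (conj_transpose g))) *
       (\<Prod>\<beta>\<in>#B. det (mat 1 - map_matrix ((*) \<beta>) g)) *
       gen_schur_mset l (eigenvalues_mset g))"

definition Z_factor ::
    "nat \<Rightarrow> (nat \<Rightarrow> int) \<Rightarrow> complex multiset \<Rightarrow> complex multiset \<Rightarrow> complex"
  where "Z_factor n l C D =
    schur_poly (conjugate_partition n (positive_part l)) (image_mset uminus C) *
    schur_poly (conjugate_partition n (negative_part n l)) (image_mset uminus D) *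
    (\<Prod>c\<in>#C. \<Prod>d\<in>#D. 1 / (1 - c * d))"

definition recipe_sum ::
    "nat \<Rightarrow> (nat \<Rightarrow> int) \<Rightarrow> complex set \<Rightarrow> complex set \<Rightarrow> complex"
  where "recipe_sum n l A B =
    (\<Sum>(U, V) \<in> {(U, V). U \<subseteq> A \<and> V \<subseteq> B \<and> card U = card V}.
       ((\<Prod>u\<in>U. u ^ n) * (\<Prod>v\<in>V. v ^ n)) *
       Z_factor n l
         (mset_set (A - U) + image_mset inverse (mset_set V))
         (mset_set (B - V) + image_mset inverse (mset_set U)))"

definition admissible_pair :: "complex set \<Rightarrow> complex set \<Rightarrow> bool"
  where "admissible_pair A B \<longleftrightarrow>
    finite A \<and> finite B \<and> 0 \<notin> A \<and> 0 \<notin> B \<and>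
    A \<inter> B = {} \<and> A \<inter> inverse ` A = {} \<and> A \<inter> inverse ` B = {} \<and>
    B \<inter> inverse ` A = {} \<and> B \<inter> inverse ` B = {} \<and> inverse ` A \<inter> inverse ` B = {}"

section \<open>Analytic continuation in several complex variables\<close>

definition entire_function :: "(complex^'d \<Rightarrow> complex) \<Rightarrow> bool"
  where "entire_function F \<longleftrightarrow>
    (\<forall>z. \<exists>L. (F has_derivative L) (at z) \<and> (\<forall>c v. L (c *s v) = c * L v))"

definition entire_continuation ::
    "(complex^'d) set \<Rightarrow> (complex^'d \<Rightarrow> complex) \<Rightarrow> (complex^'d \<Rightarrow> complex) \<Rightarrow> bool"
  where "entire_continuation G f F \<longleftrightarrow> entire_function F \<and> (\<forall>z\<in>G. F z = f z)"

text \<open>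
  A pair of multisets with \<open>m\<close> and \<open>k\<close> elements is given by a point \<open>z\<close> of complex
  coordinate space and disjoint sets \<open>I\<close>, \<open>J\<close> of \<open>m\<close> and \<open>k\<close> coordinates; this way
  \<open>m = 0\<close> and \<open>k = 0\<close> are included although index types are nonempty.
\<close>

definition coords_mset :: "'d set \<Rightarrow> complex^'d \<Rightarrow> complex multiset"
  where "coords_mset I z = image_mset (($) z) (mset_set I)"

definition generic_points :: "'d set \<Rightarrow> 'd set \<Rightarrow> (complex^'d) set"
  where "generic_points I J =
    {z. inj_on (($) z) I \<and> inj_on (($) z) J \<and> admissible_pair (($) z ` I) (($) z ` J)}"

end

theory Submission
  imports Defs "Jordan_Normal_Form.Schur_Decomposition" "HOL-Combinatorics.Multiset_Permutations"
begin

text \<open>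
  Let \<open>q\<close> be the product of the factors \<open>x - \<alpha>\<close> and \<open>1 - \<beta> x\<close>, and \<open>m\<close> the number of \<open>\<alpha>\<close>'s.
  In the eigenvalues \<open>t\<^sub>j\<close> of \<open>g\<close> the integrand is \<open>s\<^sub>\<lambda>\<close> times the product of the
  \<open>q(t\<^sub>j) / t\<^sub>j\<^sup>m\<close>; multiplying the alternant of \<open>s\<^sub>\<lambda>\<close> by the latter column by column expands
  the integrand into generalized Schur functions. A Schur function is an eigenfunction of the
  Casimir operator of the unitary group, whose image has Haar integral \<open>0\<close> by invariance; as
  the eigenvalue vanishes only for constants, all other Schur functions integrate to \<open>0\<close>.
  Hence the moment is the determinant of coefficients of \<open>q\<close> with index \<open>m - \<lambda>\<^sub>k + k - j\<close>,
  for arbitrary multisets, and it is a polynomial in the \<open>\<alpha>\<close>'s and \<open>\<beta>\<close>'s.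

  By the dual Jacobi--Trudi identity this determinant is, up to an explicit factor, a Schur
  polynomial in the roots \<open>Z = A \<union> 1/B\<close> of \<open>q\<close>. Written as a sum over all orderings of \<open>Z\<close>
  of monomials divided by Vandermonde products, it splits along the subsets of \<open>Z\<close> of size
  \<open>|B|\<close>, which correspond to the pairs \<open>(U, V)\<close> of the recipe.
\<close>

text \<open>The measure is known only through left invariance and total mass 1, so no integral is
  computed in eigenvalue coordinates. Functions are differentiated along unitary curves instead,
  with a quadratic error that is uniform in g and survives integration. The operator of total degree
  would not separate a Schur function of degree 0 from the constants; the quadratic Casimir
  eigenvalue does. Class functions are kept as pairs of a function on matrices, which can be
  integrated, and a Laurent polynomial in the eigenvalues, which can be compared with alternants.
  Where eigenvalues coincide the alternants degenerate, so identities are proved at tuples of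
  distinct nonzero numbers and extended by continuity; the limit in the generalized Schur function
  is treated in the same way.

  The coefficient determinant makes the continuation visible: single terms of the recipe have poles,
  for instance where the product of some \<alpha> and \<beta> is 1, while the determinant is a
  polynomial. It splits into the recipe when the parts of \<lambda> lie between -|B| and |A|; for
  other weights both sides vanish.\<close>

no_notation vec_index (infixl \<open>$\<close> 100)
hide_const (open) Determinant.det Matrix.mat

section \<open>Determinants of matrices with numbered rows and columns\<close>

abbreviation matdet :: "nat \<Rightarrow> (nat \<Rightarrow> nat \<Rightarrow> 'a :: comm_ring_1) \<Rightarrow> 'a"
  where "matdet n f \<equiv> Determinant.det (Matrix.mat n n (\<lambda>(i, j). f i j))"

lemma det_mat_leibniz:
  "matdet n f =
     (\<Sum>p | p permutes {..<n}. of_int (sign p) * (\<Prod>i<n. f i (p i)))"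
proof -
  have "matdet n f =
     (\<Sum>p | p permutes {0..<n}. signof p * (\<Prod>i = 0..<n. Matrix.mat n n (\<lambda>(i, j). f i j) $$ (i, p i)))"
    by (rule det_def') auto
  also have "\<dots> = (\<Sum>p | p permutes {..<n}. of_int (sign p) * (\<Prod>i<n. f i (p i)))"
    unfolding lessThan_atLeast0 
  proof (rule sum.cong [OF refl])
    fix p assume "p \<in> {p. p permutes {0..<n}}"
    then have p: "p permutes {0..<n}" by simp
    have "(\<Prod>i = 0..<n. Matrix.mat n n (\<lambda>(i, j). f i j) $$ (i, p i)) = (\<Prod>i = 0..<n. f i (p i))"
      using permutes_in_image[OF p] by (intro prod.cong) auto
    then show "signof p * (\<Prod>i = 0..<n. Matrix.mat n n (\<lambda>(i, j). f i j) $$ (i, p i)) =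
       of_int (sign p) * (\<Prod>i = 0..<n. f i (p i))"
      by (simp add: sign_def)
  qed
  finally show ?thesis .
qed

lemma det_mat_cong:
  assumes "\<And>i j. i < n \<Longrightarrow> j < n \<Longrightarrow> f i j = g i j"
  shows "matdet n f = matdet n g"
  using assms by (intro arg_cong[of _ _ Determinant.det] eq_matI) auto

lemma det_mat_permute_rows:
  fixes f :: "nat \<Rightarrow> nat \<Rightarrow> 'a :: comm_ring_1"
  assumes p: "p permutes {..<n}"
  shows "matdet n (\<lambda>i j. f (p i) j) =
    of_int (sign p) * matdet n f"
proof -
  have "p permutes {0..<n}" using p by (simp add: lessThan_atLeast0)
  from det_permute_rows[OF _ this, of "Matrix.mat n n (\<lambda>(i, j). f i j)"]
  have "matdet n (\<lambda>i j. Matrix.mat n n (\<lambda>(i, j). f i j) $$ (p i, j)) =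
    signof p * matdet n f" by simp
  also have "matdet n (\<lambda>i j. Matrix.mat n n (\<lambda>(i, j). f i j) $$ (p i, j)) =
    matdet n (\<lambda>i j. f (p i) j)"
    using permutes_in_image[OF p] by (intro det_mat_cong) auto
  finally show ?thesis by (simp add: sign_def)
qed

lemma det_mat_transpose:
  fixes f :: "nat \<Rightarrow> nat \<Rightarrow> 'a :: comm_ring_1"
  shows "matdet n (\<lambda>i j. f j i) = matdet n f"
proof -
  have "transpose_mat (Matrix.mat n n (\<lambda>(i, j). f i j)) = Matrix.mat n n (\<lambda>(i, j). f j i)"
    by (intro eq_matI) auto
  then show ?thesis using det_transpose[of "Matrix.mat n n (\<lambda>(i, j). f i j)" n] by simp
qed

lemma det_mat_permute_cols:
  fixes f :: "nat \<Rightarrow> nat \<Rightarrow> 'a :: comm_ring_1"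
  assumes p: "p permutes {..<n}"
  shows "matdet n (\<lambda>i j. f i (p j)) =
    of_int (sign p) * matdet n f"
  using det_mat_permute_rows[OF p, of "\<lambda>i j. f j i"]
  by (simp add: det_mat_transpose[of n "\<lambda>i j. f i (p j)"] det_mat_transpose[of n f])

text \<open>Being the identity outside \<open>{..<n}\<close>, this is a permutation in the sense of
  \<open>permutes\<close>. It mediates between the decreasing exponents of Schur functions and the
  increasing powers of a Vandermonde matrix.\<close>

definition rev_index :: "nat \<Rightarrow> nat \<Rightarrow> nat"
  where "rev_index n i = (if i < n then n - 1 - i else i)"

lemma rev_index_permutes: "rev_index n permutes {..<n}"
  by (rule bij_imp_permutes, rule bij_betw_byWitness[where f' = "rev_index n"]) (auto simp: rev_index_def)

lemma det_mat_mult: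
  fixes f g :: "nat \<Rightarrow> nat \<Rightarrow> 'a :: comm_ring_1"
  shows "matdet n (\<lambda>i j. \<Sum>k<n. f i k * g k j) =
    matdet n f * matdet n g"
proof -
  have "Matrix.mat n n (\<lambda>(i, j). \<Sum>k<n. f i k * g k j) =
     Matrix.mat n n (\<lambda>(i, j). f i j) * Matrix.mat n n (\<lambda>(i, j). g i j)"
    by (intro eq_matI) (auto simp: scalar_prod_def lessThan_atLeast0)
  then show ?thesis by (simp add: det_mult[of _ n])
qed

lemma det_mat_upper_triangular:
  fixes f :: "nat \<Rightarrow> nat \<Rightarrow> 'a :: comm_ring_1"
  assumes "\<And>i j. j < i \<Longrightarrow> i < n \<Longrightarrow> f i j = 0"
  shows "matdet n f = (\<Prod>i<n. f i i)"
proof -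
  have "matdet n f = prod_list (diag_mat (Matrix.mat n n (\<lambda>(i, j). f i j)))"
    by (rule det_upper_triangular[of _ n]) (auto simp: assms upper_triangular_def)
  also have "\<dots> = (\<Prod>i<n. f i i)"
    unfolding prod_list_diag_prod by (simp add: lessThan_atLeast0)
  finally show ?thesis .
qed

lemma det_mat_upper_right_zero:
  fixes f :: "nat \<Rightarrow> nat \<Rightarrow> 'a :: idom"
  assumes "\<And>i j. i < r \<Longrightarrow> r \<le> j \<Longrightarrow> j < r + n \<Longrightarrow> f i j = 0"
  shows "matdet (r + n) f =
    matdet r f * matdet n (\<lambda>i j. f (r + i) (r + j))"
proof -
  have "Matrix.mat (r + n) (r + n) (\<lambda>(i, j). f i j) =
    four_block_mat (Matrix.mat r r (\<lambda>(i, j). f i j)) (0\<^sub>m r n)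
       (Matrix.mat n r (\<lambda>(i, j). f (r + i) j)) (Matrix.mat n n (\<lambda>(i, j). f (r + i) (r + j)))"
    using assms by (intro eq_matI) (auto simp: four_block_mat_def)
  then show ?thesis
    by (simp add: det_four_block_mat_upper_right_zero[of _ r _ n])
qed

text \<open>
  Column operations replace the monomial \<open>x^(r+j)\<close> by \<open>x^j * P(x)\<close> for the monic
  polynomial \<open>P\<close> with roots \<open>z i\<close>, which kills the upper right block.
\<close>

lemma det_powers_border:
  fixes r n :: nat and z :: "nat \<Rightarrow> 'a :: idom" and w :: "nat \<Rightarrow> nat \<Rightarrow> 'a"
  defines "P \<equiv> (\<Prod>i<r. [:- z i, 1:])"
  shows "matdet (r + n) (\<lambda>i a. if i < r then z i ^ a else w (i - r) a) =
    matdet r (\<lambda>i a. z i ^ a) *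
    matdet n (\<lambda>k j. \<Sum>a<r + n. w k a * coeff (monom 1 j * P) a)"
proof -
  let ?d = "\<lambda>f. matdet (r + n) f"
  define W where "W i a = (if i < r then z i ^ a else w (i - r) a)" for i a
  define T where "T a j = (if j < r then (if a = j then 1 else 0) else coeff (monom 1 (j - r) * P) a)" for a j
  have deg: "degree P = r" "coeff P r = 1"
  proof -
    show *: "degree P = r" unfolding P_def by (simp add: degree_prod_eq_sum_degree)
    have "lead_coeff P = 1" unfolding P_def lead_coeff_prod by simp
    with * show "coeff P r = 1" by simp
  qed
  have T0: "T a j = 0" if "j < a" for a j
  proof (cases "j < r")
    case False
    have "degree (monom 1 (j - r) * P) \<le> (j - r) + r"
      using degree_mult_le[of "monom 1 (j - r)" P] degree_monom_le[of "1::'a" "j - r"] deg by linarith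
    then show ?thesis using False that by (auto simp: T_def intro!: coeff_eq_0)
  qed (use that in \<open>auto simp: T_def\<close>)
  have Tdiag: "T a a = 1" for a
    using deg by (auto simp: T_def coeff_monom_mult)
  have "?d T = (\<Prod>i<r + n. T i i)" by (rule det_mat_upper_triangular) (auto simp: T0)
  then have dT: "?d T = 1" by (simp add: Tdiag)
  define Y where "Y i j = (\<Sum>a<r + n. W i a * T a j)" for i j
  have "?d Y = ?d W * ?d T" unfolding Y_def by (rule det_mat_mult)
  then have 1: "?d W = ?d Y" using dT by simp
  have Yl: "Y i j = W i j" if "j < r" for i j
  proof -
    have "Y i j = (\<Sum>a<r + n. if a = j then W i j else 0)"
      unfolding Y_def using that by (intro sum.cong) (auto simp: T_def)
    then show ?thesis using that by simp
  qed
  have Yr: "Y i j = 0" if "i < r" "r \<le> j" "j < r + n" for i j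
  proof -
    have "Y i j = (\<Sum>a<r + n. coeff (monom 1 (j - r) * P) a * z i ^ a)"
      unfolding Y_def using that by (intro sum.cong) (auto simp: T_def W_def)
    also have "\<dots> = (\<Sum>a\<le>degree (monom 1 (j - r) * P). coeff (monom 1 (j - r) * P) a * z i ^ a)"
    proof (rule sum.mono_neutral_right)
      have "degree (monom 1 (j - r) * P) \<le> (j - r) + r"
        using degree_mult_le[of "monom 1 (j - r)" P] degree_monom_le[of "1::'a" "j - r"] deg by linarith
      then show "{..degree (monom 1 (j - r) * P)} \<subseteq> {..<r + n}" using that by auto
    qed (auto simp: coeff_eq_0)
    also have "\<dots> = poly (monom 1 (j - r) * P) (z i)" by (rule poly_altdef[symmetric])
    also have "\<dots> = 0" using that by (auto simp: P_def poly_prod poly_monom)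
    finally show ?thesis .
  qed
  have "?d Y = matdet r Y *
     matdet n (\<lambda>i j. Y (r + i) (r + j))"
    by (rule det_mat_upper_right_zero) (auto simp: Yr)
  also have "matdet r Y = matdet r (\<lambda>i a. z i ^ a)"
    by (rule det_mat_cong) (auto simp: Yl W_def)
  also have "matdet n (\<lambda>i j. Y (r + i) (r + j)) =
    matdet n (\<lambda>k j. \<Sum>a<r + n. w k a * coeff (monom 1 j * P) a)"
    by (rule det_mat_cong) (auto simp: Y_def W_def T_def)
  finally show ?thesis using 1 unfolding W_def by simp
qed

text \<open>Induction by bordering with a single row: the block that is left over has size 1 and
  contains the value at \<open>z n\<close> of the monic polynomial with roots \<open>z 0\<close>,
  ..., \<open>z (n - 1)\<close>.\<close>

lemma det_vandermonde:
  fixes z :: "nat \<Rightarrow> 'a :: idom"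
  shows "matdet n (\<lambda>i a. z i ^ a) = (\<Prod>j<n. \<Prod>i<j. z j - z i)"
proof (induction n)
  case 0
  then show ?case by (simp add: det_dim_zero)
next
  case (Suc n)
  let ?P = "\<Prod>i<n. [:- z i, 1:]"
  have deg: "degree ?P = n" by (simp add: degree_prod_eq_sum_degree)
  have "matdet (n + 1) (\<lambda>i a. if i < n then z i ^ a else z n ^ a) =
    matdet n (\<lambda>i a. z i ^ a) *
    matdet 1 (\<lambda>k j. \<Sum>a<n + 1. z n ^ a * coeff (monom 1 j * ?P) a)"
    using det_powers_border[of n 1 z "\<lambda>_ a. z n ^ a"] by simp
  also have "matdet 1 (\<lambda>k j. \<Sum>a<n + 1. z n ^ a * coeff (monom 1 j * ?P) a) =
     (\<Sum>a\<le>n. coeff ?P a * z n ^ a)"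
    by (subst det_single) (auto simp: lessThan_Suc_atMost mult.commute intro!: sum.cong)
  also have "\<dots> = poly ?P (z n)"
    using deg by (simp add: poly_altdef)
  also have "\<dots> = (\<Prod>i<n. z n - z i)" by (simp add: poly_prod)
  also have "matdet (n + 1) (\<lambda>i a. if i < n then z i ^ a else z n ^ a) =
     matdet (Suc n) (\<lambda>i a. z i ^ a)"
    by (simp, rule det_mat_cong) (auto simp: less_Suc_eq)
  finally show ?case using Suc by simp
qed

text \<open>Such an \<open>f\<close> maps \<open>{..<i}\<close> onto \<open>{..<f i}\<close>, and
  the two have the same cardinality. This settles the case without unit rows in the expansion
  below.\<close>

lemma strict_mono_on_lessThan_id:
  fixes f :: "nat \<Rightarrow> nat"
  assumes f: "strict_mono_on {..<r} f" and im: "f ` {..<r} = {..<r}" and i: "i < r"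
  shows "f i = i"
proof -
  have "{..<f i} = f ` {..<i}"
  proof (intro equalityI subsetI)
    fix y assume y: "y \<in> {..<f i}"
    have "f i \<in> {..<r}" using im i by blast
    then have "y \<in> f ` {..<r}" using im y by auto
    then obtain k where k: "k < r" "y = f k" by auto
    have "k < i"
    proof (rule ccontr)
      assume "\<not> k < i"
      then have "f i \<le> f k" using strict_mono_on_leD[OF f, of i k] k i by auto
      then show False using y k by simp
    qed
    then show "y \<in> f ` {..<i}" using k by auto
  next
    fix y assume "y \<in> f ` {..<i}"
    then show "y \<in> {..<f i}" using strict_mono_onD[OF f] i by auto
  qed
  then have "card {..<f i} = card (f ` {..<i})" by simp
  also have "\<dots> = card {..<i}"
    by (rule card_image, rule inj_on_subset[OF strict_mono_on_imp_inj_on[OF f]]) (use i in auto)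
  finally show ?thesis by simp
qed

text \<open>Laplace expansion along the last row deletes column \<open>p n\<close>. As this is the
  largest of the prescribed columns, the other \<open>p k\<close> keep their numbers; only the
  entries of \<open>\<kappa>\<close> beyond it move down by one. The columns that survive stay in
  increasing order, so the signs are exactly those of the successive expansions.\<close>

lemma det_unit_rows:
  fixes f :: "nat \<Rightarrow> nat \<Rightarrow> 'a :: comm_ring_1"
  assumes "strict_mono_on {..<n} p" "p ` {..<n} \<subseteq> {..<r + n}"
    and "strict_mono_on {..<r} \<kappa>" "\<kappa> ` {..<r} = {..<r + n} - p ` {..<n}"
  shows "matdet (r + n) (\<lambda>i j. if i < r then f i j else if j = p (i - r) then 1 else 0) =
     (\<Prod>k<n. (-1) ^ (r + k + p k)) * matdet r (\<lambda>i j. f i (\<kappa> j))"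
  using assms
proof (induction n arbitrary: f \<kappa>)
  case 0
  then have "\<kappa> i = i" if "i < r" for i
    using strict_mono_on_lessThan_id[of r \<kappa> i] that by auto
  then show ?case by (auto intro!: det_mat_cong)
next
  case (Suc n)
  define M where "M i j = (if i < r then f i j else if j = p (i - r) then 1 else 0)" for i j
  define A where "A = Matrix.mat (r + Suc n) (r + Suc n) (\<lambda>(i, j). M i j)"
  define c where "c = p n"
  have A: "A \<in> carrier_mat (r + Suc n) (r + Suc n)" by (simp add: A_def)
  have c: "c < r + Suc n" using Suc.prems(2) by (auto simp: c_def)
  have pc: "p k < c" if "k < n" for k
    using strict_mono_onD[OF Suc.prems(1), of k n] that by (auto simp: c_def)
  have \<kappa>c: "\<kappa> j \<noteq> c" "\<kappa> j < r + Suc n" "\<And>k. k < n \<Longrightarrow> \<kappa> j \<noteq> p k" if "j < r" for j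
  proof -
    have "\<kappa> j \<in> {..<r + Suc n} - p ` {..<Suc n}" using Suc.prems(4) that by blast
    then show "\<kappa> j \<noteq> c" "\<kappa> j < r + Suc n" "\<And>k. k < n \<Longrightarrow> \<kappa> j \<noteq> p k" by (auto simp: c_def)
  qed
  define f' where "f' i j = f i (if j < c then j else Suc j)" for i j
  define \<kappa>' where "\<kappa>' j = (if \<kappa> j < c then \<kappa> j else \<kappa> j - 1)" for j
  have "Determinant.det A = (\<Sum>j<r + Suc n. A $$ (r + n, j) * cofactor A (r + n) j)"
    by (rule laplace_expansion_row[OF A]) simp
  also have "\<dots> = (\<Sum>j<r + Suc n. if j = c then cofactor A (r + n) c else 0)"
    by (intro sum.cong) (auto simp: A_def M_def c_def)
  also have "\<dots> = cofactor A (r + n) c" using c by simp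
  also have "\<dots> = (-1) ^ (r + n + c) * Determinant.det (mat_delete A (r + n) c)"
    by (simp add: cofactor_def)
  also have "mat_delete A (r + n) c = Matrix.mat (r + n) (r + n)
     (\<lambda>(i, j). if i < r then f' i j else if j = p (i - r) then 1 else 0)"
  proof (rule eq_matI)
    fix i j assume "i < dim_row (Matrix.mat (r + n) (r + n)
       (\<lambda>(i, j). if i < r then f' i j else if j = p (i - r) then 1 else 0))"
      "j < dim_col (Matrix.mat (r + n) (r + n)
       (\<lambda>(i, j). if i < r then f' i j else if j = p (i - r) then 1 else 0))"
    then have ij: "i < r + n" "j < r + n" by auto
    consider "i < r" | "\<not> i < r" "p (i - r) < c" using pc ij by fastforce
    then show "mat_delete A (r + n) c $$ (i, j) = Matrix.mat (r + n) (r + n)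
       (\<lambda>(i, j). if i < r then f' i j else if j = p (i - r) then 1 else 0) $$ (i, j)"
      using ij by cases (auto simp: mat_delete_def A_def M_def f'_def)
  qed (auto simp: mat_delete_def A_def)
  also have "Determinant.det \<dots> =
     (\<Prod>k<n. (-1) ^ (r + k + p k)) * matdet r (\<lambda>i j. f' i (\<kappa>' j))"
  proof (rule Suc.IH)
    show "strict_mono_on {..<n} p" using Suc.prems(1) by (auto simp: monotone_on_def)
    show "p ` {..<n} \<subseteq> {..<r + n}" using pc c by fastforce
    show "strict_mono_on {..<r} \<kappa>'"
    proof (rule strict_mono_onI)
      fix i j assume ij: "i \<in> {..<r}" "j \<in> {..<r}" "i < j"
      then have "\<kappa> i < \<kappa> j" using strict_mono_onD[OF Suc.prems(3)] by auto
      moreover have "\<kappa> i \<noteq> c" "\<kappa> j \<noteq> c" using \<kappa>c ij by auto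
      ultimately show "\<kappa>' i < \<kappa>' j" by (auto simp: \<kappa>'_def)
    qed
    show "\<kappa>' ` {..<r} = {..<r + n} - p ` {..<n}"
    proof (intro equalityI subsetI)
      fix y assume "y \<in> \<kappa>' ` {..<r}"
      then obtain j where j: "j < r" "y = \<kappa>' j" by auto
      show "y \<in> {..<r + n} - p ` {..<n}"
      proof (cases "\<kappa> j < c")
        case True
        then show ?thesis using j \<kappa>c[of j] c by (auto simp: \<kappa>'_def)
      next
        case False
        then have "\<kappa> j > c" using \<kappa>c[of j] j by auto
        then have "y \<ge> c" "y < r + n" using \<kappa>c[of j] j by (auto simp: \<kappa>'_def)
        then show ?thesis using pc by fastforce
      qed
    next
      fix y assume y: "y \<in> {..<r + n} - p ` {..<n}"
      define y' where "y' = (if y < c then y else Suc y)"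
      have "y' \<in> {..<r + Suc n} - p ` {..<Suc n}"
      proof (cases "y < c")
        case True
        then have "y' = y" "y < r + Suc n" "y \<noteq> p n" using y by (auto simp: y'_def c_def)
        then show ?thesis using y by (auto simp: lessThan_Suc)
      next
        case False
        then have y': "y' = Suc y" by (simp add: y'_def)
        have "Suc y \<noteq> p k" if "k < Suc n" for k
        proof (cases "k = n")
          case True
          then show ?thesis using False by (simp add: c_def)
        next
          case k: False
          then have "p k < c" using pc that by auto
          then show ?thesis using False by simp
        qed
        then show ?thesis using y y' by auto
      qed
      then obtain j where j: "j < r" "y' = \<kappa> j" using Suc.prems(4) by (metis imageE lessThan_iff)
      then have "y = \<kappa>' j" by (auto simp: \<kappa>'_def y'_def split: if_splits)
      then show "y \<in> \<kappa>' ` {..<r}" using j by auto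
    qed
  qed
  also have "matdet r (\<lambda>i j. f' i (\<kappa>' j)) =
    matdet r (\<lambda>i j. f i (\<kappa> j))"
  proof (rule det_mat_cong)
    fix i j assume "j < r"
    then have "\<kappa> j \<noteq> c" using \<kappa>c by auto
    then show "f' i (\<kappa>' j) = f i (\<kappa> j)" by (auto simp: f'_def \<kappa>'_def)
  qed
  finally show ?case unfolding A_def M_def by (simp add: c_def mult_ac)
qed

text \<open>The dual Jacobi-Trudi identity. The powers of the \<open>z i\<close>, bordered by unit
  rows at the columns \<open>c k\<close>, form a matrix whose determinant is evaluated twice:
  clearing columns with the polynomial that has the roots \<open>z i\<close> gives the coefficient
  determinant, expanding along the unit rows gives the alternant with the complementary
  exponents.\<close>

theorem det_coeff_eq_alternant:
  fixes z :: "nat \<Rightarrow> 'a :: idom" and r n :: nat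
  assumes "strict_mono_on {..<n} c" "c ` {..<n} \<subseteq> {..<r + n}"
    and "strict_mono_on {..<r} \<kappa>" "\<kappa> ` {..<r} = {..<r + n} - c ` {..<n}"
  shows "matdet r (\<lambda>i j. z i ^ j) *
      matdet n (\<lambda>k j. coeff (monom 1 j * (\<Prod>i<r. [:- z i, 1:])) (c k)) =
    (\<Prod>k<n. (-1) ^ (r + k + c k)) * matdet r (\<lambda>i j. z i ^ \<kappa> j)"
proof -
  let ?P = "\<Prod>i<r. [:- z i, 1:]"
  have "(\<Prod>k<n. (-1) ^ (r + k + c k)) * matdet r (\<lambda>i j. z i ^ \<kappa> j) =
    matdet (r + n) (\<lambda>i j. if i < r then z i ^ j else if j = c (i - r) then 1 else 0)"
    by (rule det_unit_rows[symmetric, OF assms])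
  also have "\<dots> = matdet r (\<lambda>i a. z i ^ a) *
    matdet n (\<lambda>k j. \<Sum>a<r + n. (if a = c k then 1 else 0) * coeff (monom 1 j * ?P) a)"
    by (rule det_powers_border[of r n z "\<lambda>k a. if a = c k then 1 else 0"])
  also have "matdet n (\<lambda>k j. \<Sum>a<r + n. (if a = c k then 1 else 0) * coeff (monom 1 j * ?P) a) =
    matdet n (\<lambda>k j. coeff (monom 1 j * ?P) (c k))"
  proof (rule det_mat_cong)
    fix k j assume k: "k < n"
    have "(\<Sum>a<r + n. (if a = c k then 1 else 0) * coeff (monom 1 j * ?P) a) =
      (\<Sum>a<r + n. if a = c k then coeff (monom 1 j * ?P) (c k) else 0)"
      by (intro sum.cong) auto
    then show "(\<Sum>a<r + n. (if a = c k then 1 else 0) * coeff (monom 1 j * ?P) a) = coeff (monom 1 j * ?P) (c k)"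
      using k assms(2) by auto
  qed
  finally show ?thesis by simp
qed

text \<open>The factors are oriented as \<open>z i - z j\<close> for \<open>i < j\<close>, so that
  the product equals the alternant with decreasing exponents in the denominator of a Schur function
  without a sign.\<close>

definition vand :: "nat \<Rightarrow> (nat \<Rightarrow> 'a :: comm_ring_1) \<Rightarrow> 'a"
  where "vand n z = (\<Prod>j<n. \<Prod>i<j. z i - z j)"

lemma vand_eq_det: "vand n z = (\<Prod>j<n. (-1) ^ j) * matdet n (\<lambda>i a. z i ^ a)"
  for z :: "nat \<Rightarrow> 'a :: idom"
proof -
  have "(\<Prod>i<j. z i - z j) = (-1) ^ j * (\<Prod>i<j. z j - z i)" for j
  proof -
    have "(\<Prod>i<j. z i - z j) = (\<Prod>i<j. (-1) * (z j - z i))" by (intro prod.cong) auto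
    then show ?thesis by (simp only: prod.distrib prod_constant card_lessThan)
  qed
  then show ?thesis by (simp add: det_vandermonde vand_def prod.distrib)
qed

lemma vand_permute:
  fixes z :: "nat \<Rightarrow> 'a :: idom"
  assumes "p permutes {..<n}"
  shows "vand n (\<lambda>i. z (p i)) = of_int (sign p) * vand n z"
  using det_mat_permute_rows[OF assms, of "\<lambda>i a. z i ^ a"] by (simp add: vand_eq_det)

lemma vand_cong: "(\<And>i. i < n \<Longrightarrow> x i = y i) \<Longrightarrow> vand n x = vand n y"
  by (auto simp: vand_def intro!: prod.cong)

lemma prod_pairs_rev:
  fixes g :: "nat \<Rightarrow> nat \<Rightarrow> 'a :: comm_monoid_mult"
  shows "(\<Prod>j<n. \<Prod>i<j. g (n - 1 - i) (n - 1 - j)) = (\<Prod>j<n. \<Prod>i<j. g j i)"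
proof -
  have "(\<Prod>j<n. \<Prod>i<j. g (n - 1 - i) (n - 1 - j)) =
    (\<Prod>(j, i)\<in>(SIGMA j:{..<n}. {..<j}). g (n - 1 - i) (n - 1 - j))"
    by (subst prod.Sigma) auto
  also have "\<dots> = (\<Prod>(j, i)\<in>(SIGMA j:{..<n}. {..<j}). g j i)"
    by (rule prod.reindex_bij_witness[where i = "\<lambda>(j, i). (n - 1 - i, n - 1 - j)" and j = "\<lambda>(j, i). (n - 1 - i, n - 1 - j)"]) auto
  also have "\<dots> = (\<Prod>j<n. \<Prod>i<j. g j i)"
    by (subst prod.Sigma) auto
  finally show ?thesis .
qed

text \<open>Making the exponents increasing costs the sign of the reversal, and so does reversing
  the points. The reversal is therefore moved from the columns to the rows, where it turns the
  factors of the Vandermonde determinant into those of \<open>vand\<close>.\<close>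

lemma det_staircase:
  fixes z :: "nat \<Rightarrow> 'a :: field"
  shows "matdet n (\<lambda>i k. z i powi (int n - 1 - int k)) = vand n z"
proof -
  have "matdet n (\<lambda>i k. z i powi (int n - 1 - int k)) =
    matdet n (\<lambda>i k. z i ^ rev_index n k)"
  proof (rule det_mat_cong)
    fix i k assume "k < n"
    then have "int n - 1 - int k = int (rev_index n k)" by (auto simp: rev_index_def)
    then show "z i powi (int n - 1 - int k) = z i ^ rev_index n k" by (simp only: power_int_of_nat)
  qed
  also have "\<dots> = of_int (sign (rev_index n)) * matdet n (\<lambda>i k. z i ^ k)"
    by (rule det_mat_permute_cols[OF rev_index_permutes])
  also have "\<dots> = matdet n (\<lambda>i k. z (rev_index n i) ^ k)"
    by (rule det_mat_permute_rows[OF rev_index_permutes, symmetric])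
  also have "\<dots> = (\<Prod>j<n. \<Prod>i<j. z (rev_index n j) - z (rev_index n i))" by (rule det_vandermonde)
  also have "\<dots> = (\<Prod>j<n. \<Prod>i<j. z (n - 1 - j) - z (n - 1 - i))"
    by (intro prod.cong) (auto simp: rev_index_def)
  also have "\<dots> = vand n z" unfolding vand_def by (rule prod_pairs_rev[where g = "\<lambda>a b. z b - z a"])
  finally show ?thesis .
qed

section \<open>Ratios of alternants as symmetrized sums\<close>

text \<open>The ratio of the alternant with exponents \<open>ks\<close> to the Vandermonde product.
  Each ordering carries its own denominator, which absorbs the sign of the permutation. The value
  depends on the set only, and orderings can be cut at a fixed position.\<close>

definition asum :: "int list \<Rightarrow> complex set \<Rightarrow> complex"
  where "asum ks Z = (\<Sum>zs\<in>permutations_of_set Z.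
     (\<Prod>i<length ks. zs ! i powi (ks ! i)) / vand (length ks) ((!) zs))"

lemma prod_lessThan_add:
  fixes f :: "nat \<Rightarrow> 'a :: comm_monoid_mult"
  shows "(\<Prod>i<a + b. f i) = (\<Prod>i<a. f i) * (\<Prod>i<b. f (a + i))"
  by (induction b) (auto simp: mult_ac)

lemma bij_betw_permute_list:
  assumes "distinct zs"
  shows "bij_betw (\<lambda>p. permute_list p zs) {p. p permutes {..<length zs}} (permutations_of_set (set zs))"
proof -
  have inj: "inj_on (\<lambda>p. permute_list p zs) {p. p permutes {..<length zs}}"
  proof (rule inj_onI, clarify)
    fix p q assume pq: "p permutes {..<length zs}" "q permutes {..<length zs}"
      "permute_list p zs = permute_list q zs"
    show "p = q"
    proof
      fix i show "p i = q i"
      proof (cases "i < length zs")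
        case True
        then have "zs ! p i = zs ! q i" using pq permute_list_nth by metis
        moreover have "p i < length zs" "q i < length zs"
          using permutes_in_image[OF pq(1)] permutes_in_image[OF pq(2)] True by auto
        ultimately show ?thesis using assms nth_eq_iff_index_eq by blast
      next
        case False
        then show ?thesis using pq permutes_not_in by (metis lessThan_iff)
      qed
    qed
  qed
  moreover have "(\<lambda>p. permute_list p zs) ` {p. p permutes {..<length zs}} = permutations_of_set (set zs)"
  proof (rule card_subset_eq)
    show "(\<lambda>p. permute_list p zs) ` {p. p permutes {..<length zs}} \<subseteq> permutations_of_set (set zs)"
      using assms by (auto simp: permutations_of_set_def)
    show "card ((\<lambda>p. permute_list p zs) ` {p. p permutes {..<length zs}}) = card (permutations_of_set (set zs))"
      using assms by (simp add: card_image[OF inj] card_permutations distinct_card)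
  qed auto
  ultimately show ?thesis by (simp add: bij_betw_def)
qed

text \<open>Permuting the points multiplies the denominator by the sign of the permutation; over a
  common denominator the sum is the Leibniz expansion.\<close>

lemma asum_eq_det:
  assumes "distinct zs" "length zs = length ks"
  shows "asum ks (set zs) =
    matdet (length ks) (\<lambda>i j. zs ! i powi (ks ! j)) / vand (length ks) ((!) zs)"
proof -
  let ?n = "length ks"
  have "asum ks (set zs) = (\<Sum>p | p permutes {..<?n}.
     (\<Prod>i<?n. permute_list p zs ! i powi (ks ! i)) / vand ?n ((!) (permute_list p zs)))"
    unfolding asum_def
    using sum.reindex_bij_betw[OF bij_betw_permute_list[OF assms(1)],
        of "\<lambda>zs. (\<Prod>i<?n. zs ! i powi (ks ! i)) / vand ?n ((!) zs)"] assms(2) by simp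
  also have "\<dots> = (\<Sum>p | p permutes {..<?n}.
     of_int (sign p) * (\<Prod>i<?n. zs ! p i powi (ks ! i)) / vand ?n ((!) zs))"
  proof (rule sum.cong, goal_cases)
    case (2 p)
    then have p: "p permutes {..<length zs}" using assms by simp
    have nth: "permute_list p zs ! i = zs ! p i" if "i < ?n" for i
      using permute_list_nth[OF p, of i] that assms by simp
    have "vand ?n ((!) (permute_list p zs)) = vand ?n (\<lambda>i. zs ! p i)"
      by (rule vand_cong) (simp add: nth)
    also have "\<dots> = of_int (sign p) * vand ?n ((!) zs)" using p assms by (intro vand_permute) simp
    finally have v: "vand ?n ((!) (permute_list p zs)) = of_int (sign p) * vand ?n ((!) zs)" .
    have "(\<Prod>i<?n. permute_list p zs ! i powi (ks ! i)) = (\<Prod>i<?n. zs ! p i powi (ks ! i))"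
      by (intro prod.cong) (auto simp: nth)
    then show ?case unfolding v by (auto simp: sign_def)
  qed simp
  also have "\<dots> = (\<Sum>p | p permutes {..<?n}. of_int (sign p) * (\<Prod>i<?n. zs ! p i powi (ks ! i))) / vand ?n ((!) zs)"
    by (simp add: sum_divide_distrib)
  also have "(\<Sum>p | p permutes {..<?n}. of_int (sign p) * (\<Prod>i<?n. zs ! p i powi (ks ! i))) =
     matdet ?n (\<lambda>i j. zs ! j powi (ks ! i))"
    by (rule det_mat_leibniz[symmetric])
  finally show ?thesis by (simp add: det_mat_transpose[of ?n "\<lambda>i j. zs ! i powi (ks ! j)"])
qed

lemma vand_append:
  assumes "length xs = a" "length ys = b"
  shows "vand (a + b) ((!) (xs @ ys)) = vand a ((!) xs) * vand b ((!) ys) * (\<Prod>i<a. \<Prod>j<b. xs ! i - ys ! j)"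
proof -
  have "vand (a + b) ((!) (xs @ ys)) =
     (\<Prod>j<a. \<Prod>i<j. (xs @ ys) ! i - (xs @ ys) ! j) * (\<Prod>j<b. \<Prod>i<a + j. (xs @ ys) ! i - (xs @ ys) ! (a + j))"
    unfolding vand_def by (rule prod_lessThan_add)
  also have "(\<Prod>j<a. \<Prod>i<j. (xs @ ys) ! i - (xs @ ys) ! j) = vand a ((!) xs)"
    unfolding vand_def using assms by (intro prod.cong) (auto simp: nth_append)
  also have "(\<Prod>j<b. \<Prod>i<a + j. (xs @ ys) ! i - (xs @ ys) ! (a + j)) =
     (\<Prod>j<b. (\<Prod>i<a. xs ! i - ys ! j) * (\<Prod>i<j. ys ! i - ys ! j))"
    unfolding prod_lessThan_add using assms
    by (intro prod.cong arg_cong2[of _ _ _ _ "(*)"]) (auto simp: nth_append)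
  also have "\<dots> = (\<Prod>i<a. \<Prod>j<b. xs ! i - ys ! j) * vand b ((!) ys)"
    unfolding prod.distrib vand_def by (subst prod.swap) simp
  finally show ?thesis by (simp add: mult_ac)
qed

lemma prod_nth_distinct:
  fixes f :: "'b \<Rightarrow> 'a :: comm_monoid_mult"
  assumes "distinct xs" "length xs = a" shows "(\<Prod>i<a. f (xs ! i)) = (\<Prod>x\<in>set xs. f x)"
  using prod.reindex_bij_betw[OF bij_betw_nth[OF assms(1) refl refl], of f] assms(2) by simp

text \<open>An ordering of \<open>Z\<close> amounts to the set \<open>S\<close> of its first
  \<open>length ks1\<close> elements together with orderings of \<open>S\<close> and of
  \<open>Z - S\<close>, and the Vandermonde product splits off the cross factors
  \<open>s - z\<close>. It is Laplace expansion along a block of columns, and it produces the sum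
  over subsets in the recipe.\<close>

lemma asum_append:
  assumes "finite Z" "card Z = length ks1 + length ks2"
  shows "asum (ks1 @ ks2) Z = (\<Sum>S | S \<subseteq> Z \<and> card S = length ks1.
     asum ks1 S * asum ks2 (Z - S) * (\<Prod>s\<in>S. \<Prod>z\<in>Z - S. 1 / (s - z)))"
proof -
  let ?a = "length ks1" and ?b = "length ks2"
  define t :: "int list \<Rightarrow> complex list \<Rightarrow> complex" where "t ks zs = (\<Prod>i<length ks. zs ! i powi (ks ! i)) / vand (length ks) ((!) zs)" for ks zs
  let ?SS = "{S. S \<subseteq> Z \<and> card S = ?a}"
  have fin: "finite ?SS" using assms(1) by simp
  have "(\<Sum>S\<in>?SS. asum ks1 S * asum ks2 (Z - S) * (\<Prod>s\<in>S. \<Prod>z\<in>Z - S. 1 / (s - z))) =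
    (\<Sum>S\<in>?SS. \<Sum>xs\<in>permutations_of_set S. \<Sum>ys\<in>permutations_of_set (Z - S). t (ks1 @ ks2) (xs @ ys))"
  proof (rule sum.cong [OF refl])
    fix S assume S: "S \<in> ?SS"
    have finS: "finite S" using S assms(1) finite_subset by auto
    have cards: "card S = ?a" "card (Z - S) = ?b" using S assms finS by (auto simp: card_Diff_subset)
    have "asum ks1 S * asum ks2 (Z - S) * (\<Prod>s\<in>S. \<Prod>z\<in>Z - S. 1 / (s - z)) =
      (\<Sum>xs\<in>permutations_of_set S. \<Sum>ys\<in>permutations_of_set (Z - S). t ks1 xs * t ks2 ys * (\<Prod>s\<in>S. \<Prod>z\<in>Z - S. 1 / (s - z)))"
      unfolding asum_def t_def sum_product by (simp add: sum_distrib_right)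
    also have "\<dots> = (\<Sum>xs\<in>permutations_of_set S. \<Sum>ys\<in>permutations_of_set (Z - S). t (ks1 @ ks2) (xs @ ys))"
    proof (intro sum.cong refl)
      fix xs ys assume xy: "xs \<in> permutations_of_set S" "ys \<in> permutations_of_set (Z - S)"
      have d: "distinct xs" "distinct ys" "set xs = S" "set ys = Z - S"
        using xy by (auto simp: permutations_of_set_def)
      have l: "length xs = ?a" "length ys = ?b"
        using distinct_card[OF d(1)] distinct_card[OF d(2)] cards d by auto
      have "(\<Prod>i<?a + ?b. (xs @ ys) ! i powi ((ks1 @ ks2) ! i)) =
        (\<Prod>i<?a. xs ! i powi (ks1 ! i)) * (\<Prod>i<?b. ys ! i powi (ks2 ! i))"
        unfolding prod_lessThan_add using l by (intro arg_cong2[of _ _ _ _ "(*)"] prod.cong) (auto simp: nth_append)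
      moreover have "(\<Prod>i<?a. \<Prod>j<?b. xs ! i - ys ! j) = (\<Prod>s\<in>S. \<Prod>z\<in>Z - S. s - z)"
      proof -
        have "(\<Prod>i<?a. \<Prod>j<?b. xs ! i - ys ! j) = (\<Prod>i<?a. \<Prod>z\<in>Z - S. xs ! i - z)"
          using prod_nth_distinct[OF d(2) l(2)] d by (intro prod.cong) auto
        also have "\<dots> = (\<Prod>s\<in>S. \<Prod>z\<in>Z - S. s - z)"
          using prod_nth_distinct[OF d(1) l(1), of "\<lambda>s. \<Prod>z\<in>Z - S. s - z"] d by auto
        finally show ?thesis .
      qed
      moreover have "(\<Prod>s\<in>S. \<Prod>z\<in>Z - S. 1 / (s - z)) = 1 / (\<Prod>s\<in>S. \<Prod>z\<in>Z - S. s - z)"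
        by (simp add: prod_dividef)
      ultimately show "t ks1 xs * t ks2 ys * (\<Prod>s\<in>S. \<Prod>z\<in>Z - S. 1 / (s - z)) = t (ks1 @ ks2) (xs @ ys)"
        by (simp add: t_def vand_append[OF l])
    qed
    finally show "asum ks1 S * asum ks2 (Z - S) * (\<Prod>s\<in>S. \<Prod>z\<in>Z - S. 1 / (s - z)) = \<dots>" .
  qed
  also have "\<dots> = (\<Sum>(S, xs, ys)\<in>(SIGMA S:?SS. permutations_of_set S \<times> permutations_of_set (Z - S)). t (ks1 @ ks2) (xs @ ys))"
  proof -
    have "(\<Sum>S\<in>?SS. \<Sum>xs\<in>permutations_of_set S. \<Sum>ys\<in>permutations_of_set (Z - S). t (ks1 @ ks2) (xs @ ys)) =
      (\<Sum>S\<in>?SS. \<Sum>(xs, ys)\<in>permutations_of_set S \<times> permutations_of_set (Z - S). t (ks1 @ ks2) (xs @ ys))"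
      by (intro sum.cong refl) (rule sum.cartesian_product)
    also have "\<dots> = (\<Sum>(S, xs, ys)\<in>(SIGMA S:?SS. permutations_of_set S \<times> permutations_of_set (Z - S)). t (ks1 @ ks2) (xs @ ys))"
      by (rule sum.Sigma[OF fin]) auto
    finally show ?thesis .
  qed
  also have "\<dots> = (\<Sum>zs\<in>permutations_of_set Z. t (ks1 @ ks2) zs)"
  proof (rule sum.reindex_bij_witness[where j = "\<lambda>(S, xs, ys). xs @ ys" and
        i = "\<lambda>zs. (set (take ?a zs), take ?a zs, drop ?a zs)"], goal_cases)
    case (1 q)
    then obtain S xs ys where q: "q = (S, xs, ys)" "S \<subseteq> Z" "card S = ?a" "distinct xs" "set xs = S"
      by (auto simp: permutations_of_set_def)
    then show ?case using distinct_card[of xs] by auto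
  next
    case (2 q)
    then show ?case by (auto simp: permutations_of_set_def)
  next
    case (3 zs)
    then show ?case by auto
  next
    case (4 zs)
    then have zs: "distinct zs" "set zs = Z" by (auto simp: permutations_of_set_def)
    have l: "length zs = ?a + ?b" using distinct_card[OF zs(1)] zs assms by simp
    have "set (take ?a zs) \<inter> set (drop ?a zs) = {}" using zs(1) by (simp add: set_take_disj_set_drop_if_distinct)
    moreover have "set (take ?a zs) \<union> set (drop ?a zs) = Z"
      using zs(2) by (metis append_take_drop_id set_append)
    ultimately have "set (drop ?a zs) = Z - set (take ?a zs)" by auto
    moreover have "card (set (take ?a zs)) = ?a" using zs l by (subst distinct_card) auto
    moreover have "set (take ?a zs) \<subseteq> Z" using set_take_subset[of ?a zs] zs by simp
    moreover have "distinct (take ?a zs)" "distinct (drop ?a zs)" using zs by simp_all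
    ultimately show ?case by (simp only: mem_Sigma_iff mem_Collect_eq permutations_of_set_def)
  next
    case (5 q)
    show ?case by (simp add: case_prod_unfold)
  qed
  finally show ?thesis by (simp add: asum_def t_def)
qed

lemma sum_permutations_of_set_image:
  assumes "inj_on f D"
  shows "(\<Sum>zs\<in>permutations_of_set (f ` D). h zs) = (\<Sum>ds\<in>permutations_of_set D. h (map f ds))"
proof -
  have "inj_on (map f) (permutations_of_set D)"
    by (rule inj_onI, rule map_inj_on[of f]) (use assms in \<open>auto simp: permutations_of_set_def\<close>)
  then show ?thesis
    unfolding permutations_of_set_image_inj[OF assms] by (rule sum.reindex_cong) auto
qed

lemma sum_permutations_of_set_rev:
  "(\<Sum>zs\<in>permutations_of_set D. h zs) = (\<Sum>zs\<in>permutations_of_set D. h (rev zs))"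
  by (rule sum.reindex_bij_witness[where i = rev and j = rev]) (auto simp: permutations_of_set_def)

lemma length_permutation_of_set: "zs \<in> permutations_of_set D \<Longrightarrow> length zs = card D"
  by (auto simp: permutations_of_set_def distinct_card)

lemma nth_permutation_of_set: "zs \<in> permutations_of_set D \<Longrightarrow> i < card D \<Longrightarrow> zs ! i \<in> D"
  by (metis length_permutation_of_set nth_mem permutations_of_setD(1))

lemma prod_nth_permutation_of_set:
  assumes "zs \<in> permutations_of_set D"
  shows "(\<Prod>i<card D. f (zs ! i)) = (\<Prod>d\<in>D. f d)"
  using prod_nth_distinct[of zs "card D" f] length_permutation_of_set[OF assms] assms
  by (auto simp: permutations_of_set_def)

lemma prod_pairs_mult:
  fixes f :: "nat \<Rightarrow> 'a :: comm_monoid_mult"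
  shows "(\<Prod>j<n. \<Prod>i<j. f i * f j) = (\<Prod>i<n. f i ^ (n - 1))"
proof (induction n)
  case (Suc n)
  have "(\<Prod>i<n. f i ^ (n - 1)) * (\<Prod>i<n. f i) = (\<Prod>i<n. f i ^ n)"
    by (cases n) (simp_all add: prod.distrib[symmetric] mult_ac)
  then show ?case using Suc by (simp add: prod.distrib mult_ac)
qed simp

lemma vand_divide_prod:
  fixes f :: "nat \<Rightarrow> 'a :: field"
  assumes "\<And>i. i < n \<Longrightarrow> f i \<noteq> 0"
  shows "(\<Prod>j<n. \<Prod>i<j. inverse (f j) - inverse (f i)) = vand n f / (\<Prod>i<n. f i ^ (n - 1))"
proof -
  have "(\<Prod>j<n. \<Prod>i<j. inverse (f j) - inverse (f i)) = (\<Prod>j<n. \<Prod>i<j. (f i - f j) / (f i * f j))"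
    using assms by (intro prod.cong refl) (auto simp: field_simps)
  also have "\<dots> = vand n f / (\<Prod>i<n. f i ^ (n - 1))"
    by (simp only: prod_dividef prod_pairs_mult vand_def)
  finally show ?thesis .
qed

text \<open>Since \<open>1/b - 1/a = (a - b)/(a b)\<close> and every element occurs in
  \<open>length ks - 1\<close> pairs, inverting the points changes the Vandermonde product by a
  power of each of them. The orderings are reversed at the same time, which keeps the orientation of
  the factors and avoids a sign; for this reason \<open>ks\<close> appears reversed.\<close>

lemma asum_inverse:
  assumes "card D = length ks" "0 \<notin> D"
  shows "asum ks (inverse ` D) = (\<Prod>d\<in>D. d ^ (length ks - 1)) * asum (map uminus (rev ks)) D"
proof -
  let ?w = "length ks"
  have "asum ks (inverse ` D) = (\<Sum>ds\<in>permutations_of_set D.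
     (\<Prod>i<?w. map inverse ds ! i powi (ks ! i)) / vand ?w ((!) (map inverse ds)))"
    unfolding asum_def by (rule sum_permutations_of_set_image) (auto simp: inj_on_def)
  also have "\<dots> = (\<Sum>ds\<in>permutations_of_set D.
     (\<Prod>i<?w. map inverse (rev ds) ! i powi (ks ! i)) / vand ?w ((!) (map inverse (rev ds))))"
    by (rule sum_permutations_of_set_rev)
  also have "\<dots> = (\<Sum>ds\<in>permutations_of_set D. (\<Prod>d\<in>D. d ^ (?w - 1)) *
     ((\<Prod>i<?w. ds ! i powi (map uminus (rev ks) ! i)) / vand ?w ((!) ds)))"
  proof (rule sum.cong [OF refl])
    fix ds assume ds: "ds \<in> permutations_of_set D"
    have l: "length ds = ?w" using length_permutation_of_set[OF ds] assms by simp
    have nz: "ds ! i \<noteq> 0" if "i < ?w" for i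
      using nth_permutation_of_set[OF ds, of i] that assms by auto
    have nth: "map inverse (rev ds) ! i = inverse (ds ! (?w - 1 - i))" if "i < ?w" for i
      using that l by (simp add: rev_nth)
    have "(\<Prod>i<?w. map inverse (rev ds) ! i powi (ks ! i)) =
       (\<Prod>i<?w. (\<lambda>i. inverse (ds ! i) powi (ks ! (?w - Suc i))) (?w - Suc i))"
      using l by (intro prod.cong refl) (auto simp: rev_nth)
    also have "\<dots> = (\<Prod>i<?w. inverse (ds ! i) powi (ks ! (?w - Suc i)))"
      by (rule prod.nat_diff_reindex)
    also have "\<dots> = (\<Prod>i<?w. ds ! i powi (map uminus (rev ks) ! i))"
      by (intro prod.cong refl) (auto simp: rev_nth power_int_minus power_int_inverse)
    finally have 1: "(\<Prod>i<?w. map inverse (rev ds) ! i powi (ks ! i)) = \<dots>" .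
    have "vand ?w ((!) (map inverse (rev ds))) = vand ?w (\<lambda>i. inverse (ds ! (?w - 1 - i)))"
      by (rule vand_cong) (use nth in auto)
    also have "\<dots> = (\<Prod>j<?w. \<Prod>i<j. inverse (ds ! j) - inverse (ds ! i))"
      unfolding vand_def by (rule prod_pairs_rev[where g = "\<lambda>a b. inverse (ds ! a) - inverse (ds ! b)"])
    also have "\<dots> = vand ?w ((!) ds) / (\<Prod>i<?w. (ds ! i) ^ (?w - 1))"
      by (rule vand_divide_prod) (use nz in auto)
    also have "(\<Prod>i<?w. (ds ! i) ^ (?w - 1)) = (\<Prod>d\<in>D. d ^ (?w - 1))"
      using prod_nth_permutation_of_set[OF ds, of "\<lambda>d. d ^ (?w - 1)"] assms by simp
    finally show "(\<Prod>i<?w. map inverse (rev ds) ! i powi (ks ! i)) / vand ?w ((!) (map inverse (rev ds))) =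
       (\<Prod>d\<in>D. d ^ (?w - 1)) * ((\<Prod>i<?w. ds ! i powi (map uminus (rev ks) ! i)) / vand ?w ((!) ds))"
      unfolding 1 by simp
  qed
  also have "\<dots> = (\<Prod>d\<in>D. d ^ (?w - 1)) * asum (map uminus (rev ks)) D"
    unfolding asum_def by (simp add: sum_distrib_left)
  finally show ?thesis .
qed

lemma asum_shift:
  assumes "card D = length ks" "0 \<notin> D"
  shows "asum (map ((+) c) ks) D = (\<Prod>d\<in>D. d powi c) * asum ks D"
proof -
  let ?w = "length ks"
  have "asum (map ((+) c) ks) D = (\<Sum>ds\<in>permutations_of_set D. (\<Prod>d\<in>D. d powi c) *
      ((\<Prod>i<?w. ds ! i powi (ks ! i)) / vand ?w ((!) ds)))"
    unfolding asum_def length_map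
  proof (rule sum.cong [OF refl])
    fix ds assume ds: "ds \<in> permutations_of_set D"
    have nz: "ds ! i \<noteq> 0" if "i < ?w" for i
      using nth_permutation_of_set[OF ds, of i] that assms by auto
    have "(\<Prod>i<?w. ds ! i powi (map ((+) c) ks ! i)) = (\<Prod>i<?w. ds ! i powi c * ds ! i powi (ks ! i))"
      using nz by (intro prod.cong refl) (simp add: power_int_add)
    also have "\<dots> = (\<Prod>d\<in>D. d powi c) * (\<Prod>i<?w. ds ! i powi (ks ! i))"
      using prod_nth_permutation_of_set[OF ds, of "\<lambda>d. d powi c"] assms by (simp add: prod.distrib)
    finally show "(\<Prod>i<?w. ds ! i powi (map ((+) c) ks ! i)) / vand ?w ((!) ds) =
      (\<Prod>d\<in>D. d powi c) * ((\<Prod>i<?w. ds ! i powi (ks ! i)) / vand ?w ((!) ds))" by simp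
  qed
  then show ?thesis by (simp add: asum_def sum_distrib_left)
qed

text \<open>The exponents in the numerator of the Schur function of \<open>\<rho>\<close> in
  \<open>w\<close> variables: \<open>\<rho>\<close> plus the staircase.\<close>

definition part_exps :: "nat \<Rightarrow> (nat \<Rightarrow> int) \<Rightarrow> int list"
  where "part_exps w \<rho> = map (\<lambda>j. int w - 1 - int j + \<rho> j) [0..<w]"

lemma length_part_exps [simp]: "length (part_exps w \<rho>) = w"
  by (simp add: part_exps_def)

lemma nth_part_exps: "j < w \<Longrightarrow> part_exps w \<rho> ! j = int w - 1 - int j + \<rho> j"
  by (simp add: part_exps_def)

text \<open>Homogeneity of a Schur function: the signs from the staircase part of the exponents and
  those from the Vandermonde product both amount to \<open>w (w - 1) / 2\<close> factors -1 and
  cancel, leaving those from \<open>\<rho>\<close>.\<close>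

lemma asum_part_exps_uminus:
  assumes "card D = w"
  shows "asum (part_exps w \<rho>) (uminus ` D) = (\<Prod>j<w. (-1) powi \<rho> j) * asum (part_exps w \<rho>) D"
proof -
  let ?k = "part_exps w \<rho>"
  have "asum ?k (uminus ` D) = (\<Sum>ds\<in>permutations_of_set D.
     (\<Prod>i<w. map uminus ds ! i powi (?k ! i)) / vand w ((!) (map uminus ds)))"
    unfolding asum_def length_part_exps by (rule sum_permutations_of_set_image) (auto simp: inj_on_def)
  also have "\<dots> = (\<Sum>ds\<in>permutations_of_set D. (\<Prod>j<w. (-1) powi \<rho> j) *
      ((\<Prod>i<w. ds ! i powi (?k ! i)) / vand w ((!) ds)))"
  proof (rule sum.cong [OF refl])
    fix ds assume ds: "ds \<in> permutations_of_set D"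
    have l: "length ds = w" using length_permutation_of_set[OF ds] assms by simp
    have "(\<Prod>i<w. map uminus ds ! i powi (?k ! i)) =
       (\<Prod>i<w. ((-1) ^ (w - Suc i) * (-1) powi \<rho> i) * ds ! i powi (?k ! i))"
    proof (intro prod.cong refl)
      fix i assume "i \<in> {..<w}"
      then have i: "i < w" by simp
      have e: "?k ! i = int (w - Suc i) + \<rho> i" using i by (simp add: nth_part_exps)
      have "map uminus ds ! i = (-1) * ds ! i" using i l by simp
      then have "map uminus ds ! i powi (?k ! i) = (-1) powi (?k ! i) * ds ! i powi (?k ! i)"
        by (simp only: power_int_mult_distrib)
      also have "(-1 :: complex) powi (?k ! i) = (-1) ^ (w - Suc i) * (-1) powi \<rho> i"
        unfolding e by (simp add: power_int_add)
      finally show "map uminus ds ! i powi (?k ! i) = ((-1) ^ (w - Suc i) * (-1) powi \<rho> i) * ds ! i powi (?k ! i)" .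
    qed
    also have "\<dots> = (\<Prod>i<w. (-1) ^ (w - Suc i)) * (\<Prod>i<w. (-1) powi \<rho> i) * (\<Prod>i<w. ds ! i powi (?k ! i))"
      by (simp add: prod.distrib)
    also have "(\<Prod>i<w. (-1 :: complex) ^ (w - Suc i)) = (\<Prod>i<w. (-1) ^ i)"
      by (rule prod.nat_diff_reindex)
    finally have 1: "(\<Prod>i<w. map uminus ds ! i powi (?k ! i)) =
        (\<Prod>i<w. (-1) ^ i) * (\<Prod>i<w. (-1) powi \<rho> i) * (\<Prod>i<w. ds ! i powi (?k ! i))" .
    have "vand w ((!) (map uminus ds)) = (\<Prod>j<w. \<Prod>i<j. (-1) * (ds ! i - ds ! j))"
      unfolding vand_def using l by (intro prod.cong refl) auto
    also have "\<dots> = (\<Prod>j<w. (-1) ^ j) * vand w ((!) ds)"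
      unfolding vand_def by (simp only: prod.distrib prod_constant card_lessThan)
    finally have 2: "vand w ((!) (map uminus ds)) = (\<Prod>j<w. (-1) ^ j) * vand w ((!) ds)" .
    have "(\<Prod>j<w. (-1 :: complex) ^ j) \<noteq> 0" by simp
    then show "(\<Prod>i<w. map uminus ds ! i powi (?k ! i)) / vand w ((!) (map uminus ds)) =
       (\<Prod>j<w. (-1) powi \<rho> j) * ((\<Prod>i<w. ds ! i powi (?k ! i)) / vand w ((!) ds))"
      unfolding 1 2 by simp
  qed
  finally show ?thesis by (simp add: asum_def sum_distrib_left)
qed

lemma alternant_zero: "alternant n (\<lambda>_. 0) x = vand n x"
  unfolding alternant_def using det_staircase[of n x] by simp

text \<open>A multiset without repetitions is enumerated by a distinct list, so the quotient of
  alternants applies and no limit is taken; the choice of the list disappears in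
  \<open>asum\<close>.\<close>

lemma gen_schur_mset_set:
  assumes "finite E" "card E = w"
  shows "gen_schur_mset \<rho> (mset_set E) = asum (part_exps w \<rho>) E"
proof -
  define xs where "xs = (SOME xs. mset xs = mset_set E)"
  have xs: "mset xs = mset_set E" unfolding xs_def by (rule someI_ex) (rule ex_mset)
  have d: "distinct xs" "set xs = E"
  proof -
    show E: "set xs = E" using arg_cong[OF xs, of set_mset] assms by simp
    show "distinct xs" by (simp add: distinct_count_atmost_1 xs E assms)
  qed
  have l: "length xs = w" using distinct_card[OF d(1)] d assms by simp
  have inj: "inj_on ((!) xs) {..<w}" using d(1) l by (auto simp: inj_on_def nth_eq_iff_index_eq)
  have "gen_schur_mset \<rho> (mset_set E) = alternant w \<rho> ((!) xs) / alternant w (\<lambda>_. 0) ((!) xs)"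
    unfolding gen_schur_mset_def xs_def[symmetric] gen_schur_def using inj assms by simp
  also have "alternant w \<rho> ((!) xs) = matdet w (\<lambda>i j. xs ! i powi (part_exps w \<rho> ! j))"
    unfolding alternant_def by (rule det_mat_cong) (simp add: nth_part_exps)
  finally show ?thesis using asum_eq_det[OF d(1), of "part_exps w \<rho>"] l d(2) by (simp add: alternant_zero)
qed

lemma minus_one_powi_card:
  fixes n :: nat
  shows "(-1 :: complex) powi int (card {i. i < n \<and> P i}) = (\<Prod>i<n. if P i then -1 else 1)"
proof -
  have "(\<Prod>i<n. if P i then -1 else 1 :: complex) = (\<Prod>i\<in>{i. i < n \<and> P i}. -1)"
    by (rule prod.mono_neutral_cong_right) auto
  then show ?thesis by simp
qed

text \<open>Both sides are -1 to the number of boxes of the diagram, counted by columns and by rows.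
  The bound on \<open>r\<close> says that the diagram has at most \<open>m\<close> columns.\<close>

lemma conjugate_partition_sign:
  assumes "\<And>i. i < n \<Longrightarrow> 0 \<le> r i \<and> r i \<le> int m"
  shows "(\<Prod>j<m. (-1 :: complex) powi conjugate_partition n r j) = (\<Prod>i<n. (-1) powi r i)"
proof -
  have "(\<Prod>j<m. (-1 :: complex) powi conjugate_partition n r j) = (\<Prod>j<m. \<Prod>i<n. if r i > int j then -1 else 1)"
    unfolding conjugate_partition_def minus_one_powi_card ..
  also have "\<dots> = (\<Prod>i<n. \<Prod>j<m. if r i > int j then -1 else 1)" by (rule prod.swap)
  also have "\<dots> = (\<Prod>i<n. (-1) powi r i)"
  proof (intro prod.cong refl)
    fix i assume "i \<in> {..<n}"
    then have i: "0 \<le> r i" "r i \<le> int m" using assms by auto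
    have "{j. j < m \<and> r i > int j} = {..<nat (r i)}" using i by auto
    then have "(-1 :: complex) powi int (nat (r i)) = (\<Prod>j<m. if r i > int j then -1 else 1)"
      using minus_one_powi_card[of m "\<lambda>j. r i > int j"] by simp
    then show "(\<Prod>j<m. if r i > int j then -1 else 1 :: complex) = (-1) powi r i" using i by simp
  qed
  finally show ?thesis .
qed

lemma schur_poly_uminus_mset_set:
  assumes "finite E" "card E = w" "\<And>i. i \<ge> w \<Longrightarrow> \<rho> i = 0"
  shows "schur_poly \<rho> (image_mset uminus (mset_set E)) = (\<Prod>j<w. (-1) powi \<rho> j) * asum (part_exps w \<rho>) E"
proof -
  have "image_mset uminus (mset_set E) = mset_set (uminus ` E)"
    by (rule image_mset_mset_set) (auto simp: inj_on_def)
  moreover have "card (uminus ` E) = w" using assms by (simp add: card_image inj_on_def)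
  ultimately show ?thesis
    using assms gen_schur_mset_set[of "uminus ` E" w \<rho>] asum_part_exps_uminus[OF assms(2), of \<rho>]
    by (auto simp: schur_poly_def)
qed

section \<open>Determinantal form of the recipe sum\<close>

definition coeff_int :: "complex poly \<Rightarrow> int \<Rightarrow> complex"
  where "coeff_int q i = (if i < 0 then 0 else coeff q (nat i))"

text \<open>The Toeplitz determinant of the symbol \<open>q(x)/x^m\<close> with row \<open>k\<close>
  shifted by \<open>l k\<close>. For \<open>l = 0\<close> it is the determinant of the Heine-Szego
  identity.\<close>

definition moment_det :: "nat \<Rightarrow> nat \<Rightarrow> (nat \<Rightarrow> int) \<Rightarrow> complex poly \<Rightarrow> complex"
  where "moment_det n m l q =
    matdet n (\<lambda>k j. coeff_int q (int m - l k + int k - int j))"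

lemma coeff_int_diff: "coeff_int p (int a - int j) = coeff (monom 1 j * p) a"
  by (auto simp: coeff_int_def coeff_monom_mult nat_diff_distrib')

lemma det_mat_zero_row:
  fixes f :: "nat \<Rightarrow> nat \<Rightarrow> 'a :: comm_ring_1"
  assumes "i < n" "\<And>j. j < n \<Longrightarrow> f i j = 0"
  shows "matdet n f = 0"
  unfolding det_mat_leibniz
proof (rule sum.neutral, clarify)
  fix p assume "p permutes {..<n}"
  then have "p i < n" using permutes_in_image[of p "{..<n}" i] assms by auto
  then have "f i (p i) = 0" using assms by auto
  then have "(\<Prod>i<n. f i (p i)) = 0" using assms(1) by (intro prod_zero) auto
  then show "of_int (sign p) * (\<Prod>i<n. f i (p i)) = 0" by simp
qed

text \<open>\<open>asum\<close> is stated with decreasing exponents and the determinants with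
  increasing ones. Reversing the columns costs the same sign in numerator and denominator.\<close>

lemma alternant_ratio_powers:
  fixes \<kappa> :: "nat \<Rightarrow> nat"
  assumes "distinct zs" "length zs = r" "length ks = r"
    and "\<And>j. j < r \<Longrightarrow> ks ! j = int (\<kappa> (r - 1 - j))"
  shows "matdet r (\<lambda>i j. zs ! i ^ \<kappa> j) =
    asum ks (set zs) * matdet r (\<lambda>i j. zs ! i ^ j)"
    and "matdet r (\<lambda>i j. zs ! i ^ j) \<noteq> 0"
proof -
  let ?s = "of_int (sign (rev_index r)) :: complex"
  have s: "?s \<noteq> 0" by (simp add: sign_def)
  have "matdet r (\<lambda>i j. zs ! i powi (ks ! j)) =
    matdet r (\<lambda>i j. zs ! i ^ \<kappa> (rev_index r j))"
    by (rule det_mat_cong) (simp add: assms rev_index_def)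
  also have "\<dots> = ?s * matdet r (\<lambda>i j. zs ! i ^ \<kappa> j)"
    by (rule det_mat_permute_cols[OF rev_index_permutes, where f = "\<lambda>i j. zs ! i ^ \<kappa> j"])
  finally have 1: "matdet r (\<lambda>i j. zs ! i powi (ks ! j)) = \<dots>" .
  have "vand r ((!) zs) = matdet r (\<lambda>i k. zs ! i powi (int r - 1 - int k))"
    by (rule det_staircase[symmetric])
  also have "\<dots> = matdet r (\<lambda>i j. zs ! i ^ (rev_index r j))"
  proof (rule det_mat_cong)
    fix i k assume "k < r"
    then have "int r - 1 - int k = int (rev_index r k)" by (auto simp: rev_index_def)
    then show "zs ! i powi (int r - 1 - int k) = zs ! i ^ rev_index r k" by (simp only: power_int_of_nat)
  qed
  also have "\<dots> = ?s * matdet r (\<lambda>i j. zs ! i ^ j)"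
    by (rule det_mat_permute_cols[OF rev_index_permutes])
  finally have 2: "vand r ((!) zs) = \<dots>" .
  have "zs ! i \<noteq> zs ! j" if "i < j" "j < r" for i j
    using assms that by (simp add: nth_eq_iff_index_eq)
  then have "vand r ((!) zs) \<noteq> 0" unfolding vand_def by auto
  with 2 show nz: "matdet r (\<lambda>i j. zs ! i ^ j) \<noteq> 0" by auto
  have "asum ks (set zs) = matdet r (\<lambda>i j. zs ! i powi (ks ! j)) / vand r ((!) zs)"
    using asum_eq_det[OF assms(1), of ks] assms by simp
  also have "\<dots> = matdet r (\<lambda>i j. zs ! i ^ \<kappa> j) / matdet r (\<lambda>i j. zs ! i ^ j)"
    unfolding 1 2 using s by simp
  finally show "matdet r (\<lambda>i j. zs ! i ^ \<kappa> j) =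
    asum ks (set zs) * matdet r (\<lambda>i j. zs ! i ^ j)" using nz by simp
qed

section \<open>Conjugate partitions and the exponents of the dual Jacobi-Trudi identity\<close>

lemma card_filter_gt:
  fixes l :: "nat \<Rightarrow> int"
  assumes "antimono_on {..<n} l" "k < n"
  shows "l k > x \<Longrightarrow> card {i. i < n \<and> l i > x} \<ge> k + 1"
    and "\<not> l k > x \<Longrightarrow> card {i. i < n \<and> l i > x} \<le> k"
proof -
  have mono: "l j \<le> l i" if "i \<le> j" "j < n" for i j
    using assms(1) that by (auto simp: monotone_on_def)
  {
    assume "l k > x"
    then have "{..k} \<subseteq> {i. i < n \<and> l i > x}" using mono[OF _ assms(2)] assms by (force intro: less_le_trans)
    then have "card {..k} \<le> card {i. i < n \<and> l i > x}" by (intro card_mono) auto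
    then show "card {i. i < n \<and> l i > x} \<ge> k + 1" by simp
  next
    assume *: "\<not> l k > x"
    have "i < k" if "i < n" "l i > x" for i
    proof (rule ccontr)
      assume "\<not> i < k"
      then have "l i \<le> l k" using mono[of k i] that by auto
      then show False using * that by simp
    qed
    then have "{i. i < n \<and> l i > x} \<subseteq> {..<k}" by auto
    then have "card {i. i < n \<and> l i > x} \<le> card {..<k}" by (intro card_mono) auto
    then show "card {i. i < n \<and> l i > x} \<le> k" by simp
  }
qed

lemma card_filter_lt:
  fixes l :: "nat \<Rightarrow> int"
  shows "card {i. i < n \<and> l i \<le> x} + card {i. i < n \<and> l i > x} = n"
proof -
  have "card {i. i < n \<and> l i \<le> x} + card {i. i < n \<and> l i > x} =
     card ({i. i < n \<and> l i \<le> x} \<union> {i. i < n \<and> l i > x})"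
    by (rule card_Un_disjoint[symmetric]) auto
  also have "{i. i < n \<and> l i \<le> x} \<union> {i. i < n \<and> l i > x} = {..<n}" by auto
  finally show ?thesis by simp
qed

lemma conjugate_positive_part: "conjugate_partition n (positive_part l) j = int (card {i. i < n \<and> l i > int j})"
  unfolding conjugate_partition_def positive_part_def
  by (intro arg_cong[of _ _ "\<lambda>S. int (card S)"]) auto

text \<open>The point is to use the same counts of the \<open>l i > x\<close> as for the positive
  part, now with the negative threshold \<open>x = - j - 1\<close>. Both conjugate partitions then
  come from a single decreasing sequence.\<close>

lemma conjugate_negative_part:
  "conjugate_partition n (negative_part n l) j = int n - int (card {i. i < n \<and> l i > - int j - 1})"
proof -
  have "card {i. i < n \<and> negative_part n l i > int j} = card {i. i < n \<and> l i \<le> - int j - 1}"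
    by (rule bij_betw_same_card[of "\<lambda>i. n - 1 - i"], rule bij_betw_byWitness[where f' = "\<lambda>i. n - 1 - i"])
      (auto simp: negative_part_def)
  then show ?thesis unfolding conjugate_partition_def using card_filter_lt[of n l "- int j - 1"] by simp
qed

text \<open>
  The exponents, in increasing order, of the alternant to which dual Jacobi--Trudi relates
  \<open>moment_det\<close>.
\<close>

definition jt_exp :: "nat \<Rightarrow> nat \<Rightarrow> (nat \<Rightarrow> int) \<Rightarrow> nat \<Rightarrow> nat"
  where "jt_exp n m l j = j + card {i. i < n \<and> l i > int m - 1 - int j}"

lemma jt_exp_strict_mono: "strict_mono_on A (jt_exp n m l)"
proof (rule strict_mono_onI)
  fix i j :: nat assume "i < j"
  then have "card {k. k < n \<and> l k > int m - 1 - int i} \<le> card {k. k < n \<and> l k > int m - 1 - int j}"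
    by (intro card_mono) auto
  then show "jt_exp n m l i < jt_exp n m l j" using \<open>i < j\<close> by (simp add: jt_exp_def)
qed

text \<open>The classical statement that the shifted parts of a partition in a box and those of its
  conjugate, suitably reflected, fill an interval without overlap. Disjointness follows by comparing
  \<open>l k\<close> with the threshold \<open>m - 1 - j\<close>, because the indices counted in
  \<open>jt_exp\<close> form an initial segment; equality then follows by counting
  \<open>m + w\<close> elements on both sides.\<close>

lemma jt_exp_complement:
  assumes l: "antimono_on {..<n} l" and box: "\<And>i. i < n \<Longrightarrow> - int w \<le> l i \<and> l i \<le> int m"
  defines "c \<equiv> \<lambda>k. nat (int m - l k + int k)"
  shows "strict_mono_on {..<n} c" "c ` {..<n} \<subseteq> {..<(m + w) + n}"
    and "jt_exp n m l ` {..<m + w} = {..<(m + w) + n} - c ` {..<n}"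
proof -
  have mono: "l j \<le> l i" if "i \<le> j" "j < n" for i j
    using l that by (auto simp: monotone_on_def)
  have ic: "int (c k) = int m - l k + int k" if "k < n" for k
    using box[OF that] by (simp add: c_def)
  show sm: "strict_mono_on {..<n} c"
  proof (rule strict_mono_onI)
    fix i j assume ij: "i \<in> {..<n}" "j \<in> {..<n}" "i < j"
    then have "l j \<le> l i" using mono by auto
    then have "int (c i) < int (c j)" using ic ij by auto
    then show "c i < c j" by simp
  qed
  show cr: "c ` {..<n} \<subseteq> {..<(m + w) + n}"
  proof clarify
    fix k assume k: "k < n"
    then have "int (c k) < int ((m + w) + n)" using ic[OF k] box[OF k] by auto
    then show "c k < (m + w) + n" by linarith
  qed
  have dis: "jt_exp n m l j \<noteq> c k" if "k < n" for j k
  proof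
    assume e: "jt_exp n m l j = c k"
    then have e': "int j + int (card {i. i < n \<and> l i > int m - 1 - int j}) = int m - l k + int k"
      using ic[OF that] by (simp add: jt_exp_def)
    show False
    proof (cases "l k > int m - 1 - int j")
      case True
      then show False using card_filter_gt(1)[OF l that True] e' by linarith
    next
      case False
      then show False using card_filter_gt(2)[OF l that False] e' by linarith
    qed
  qed
  have ran: "jt_exp n m l j < (m + w) + n" if "j < m + w" for j
  proof -
    have "card {i. i < n \<and> l i > int m - 1 - int j} \<le> card {..<n}" by (intro card_mono) auto
    then show ?thesis using that by (simp add: jt_exp_def)
  qed
  show "jt_exp n m l ` {..<m + w} = {..<(m + w) + n} - c ` {..<n}"
  proof (rule card_subset_eq)
    show "jt_exp n m l ` {..<m + w} \<subseteq> {..<(m + w) + n} - c ` {..<n}" using dis ran by auto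
    have "card (jt_exp n m l ` {..<m + w}) = m + w"
      using card_image[OF strict_mono_on_imp_inj_on[OF jt_exp_strict_mono]] by simp
    moreover have "card ({..<(m + w) + n} - c ` {..<n}) = m + w"
      using cr card_image[OF strict_mono_on_imp_inj_on[OF sm]] by (subst card_Diff_subset) auto
    ultimately show "card (jt_exp n m l ` {..<m + w}) = card ({..<(m + w) + n} - c ` {..<n})" by simp
  qed simp
qed

lemma moment_det_smult: "moment_det n m l (Polynomial.smult a q) = a ^ n * moment_det n m l q"
proof -
  have "moment_det n m l (Polynomial.smult a q) =
     matdet n (\<lambda>k j. a * coeff_int q (int m - l k + int k - int j))"
    unfolding moment_det_def by (rule det_mat_cong) (simp add: coeff_int_def)
  also have "\<dots> = Determinant.det (a \<cdot>\<^sub>m Matrix.mat n n (\<lambda>(k, j). coeff_int q (int m - l k + int k - int j)))"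
    by (intro arg_cong[of _ _ Determinant.det] eq_matI) auto
  finally show ?thesis by (simp add: moment_det_def)
qed

theorem moment_det_eq_asum:
  assumes l: "antimono_on {..<n} l" and box: "\<And>i. i < n \<Longrightarrow> - int w \<le> l i \<and> l i \<le> int m"
    and zs: "distinct zs" "length zs = m + w"
  shows "moment_det n m l (\<Prod>z\<in>set zs. [:- z, 1:]) =
    (\<Prod>k<n. (-1) ^ w * (-1) powi l k) *
     asum (map (\<lambda>j. int (jt_exp n m l (m + w - 1 - j))) [0..<m + w]) (set zs)"
proof -
  let ?r = "m + w"
  define c where "c = (\<lambda>k. nat (int m - l k + int k))"
  define ks where "ks = map (\<lambda>j. int (jt_exp n m l (?r - 1 - j))) [0..<?r]"
  have P: "(\<Prod>i<?r. [:- (zs ! i), 1:]) = (\<Prod>z\<in>set zs. [:- z, 1:])"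
    by (rule prod_nth_distinct[OF zs])
  note comp = jt_exp_complement[OF l box]
  have ic: "int (c k) = int m - l k + int k" if "k < n" for k
    using box[OF that] by (simp add: c_def)
  let ?V = "matdet ?r (\<lambda>i j. zs ! i ^ j)"
  have "moment_det n m l (\<Prod>z\<in>set zs. [:- z, 1:]) =
    matdet n (\<lambda>k j. coeff (monom 1 j * (\<Prod>i<?r. [:- (zs ! i), 1:])) (c k))"
    unfolding moment_det_def P
  proof (rule det_mat_cong)
    fix k j assume k: "k < n"
    have "int m - l k + int k - int j = int (c k) - int j" using ic[OF k] by simp
    then show "coeff_int (\<Prod>z\<in>set zs. [:- z, 1:]) (int m - l k + int k - int j) =
       coeff (monom 1 j * (\<Prod>z\<in>set zs. [:- z, 1:])) (c k)"
      by (simp only: coeff_int_diff)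
  qed
  also have "?V * \<dots> = (\<Prod>k<n. (-1) ^ (?r + k + c k)) * matdet ?r (\<lambda>i j. zs ! i ^ jt_exp n m l j)"
    unfolding c_def by (rule det_coeff_eq_alternant[OF comp(1,2) jt_exp_strict_mono comp(3)])
  also have "matdet ?r (\<lambda>i j. zs ! i ^ jt_exp n m l j) = asum ks (set zs) * ?V"
    by (rule alternant_ratio_powers(1)[OF zs]) (auto simp: ks_def)
  \<comment> \<open>The exponent equals \<open>2 m + 2 k + w - l k\<close>.\<close>
  also have "(\<Prod>k<n. (-1) ^ (?r + k + c k)) = (\<Prod>k<n. (-1) ^ w * (-1 :: complex) powi l k)"
  proof (rule prod.cong [OF refl])
    fix k assume "k \<in> {..<n}"
    then have "l k = int m + int k - int (c k)" using ic by simp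
    then have "(-1 :: complex) powi l k = (-1) ^ m * (-1) ^ k / (-1) ^ c k"
      by (simp add: power_int_diff power_int_add)
    also have "\<dots> = (-1) ^ m * (-1) ^ k * (-1) ^ c k"
      by (cases "even (c k)") auto
    finally show "(-1) ^ (?r + k + c k) = (-1) ^ w * (-1 :: complex) powi l k" by (simp add: power_add)
  qed
  finally have "?V * moment_det n m l (\<Prod>z\<in>set zs. [:- z, 1:]) =
    ?V * ((\<Prod>k<n. (-1) ^ w * (-1 :: complex) powi l k) * asum ks (set zs))" by (simp add: mult_ac)
  moreover have "?V \<noteq> 0"
    by (rule alternant_ratio_powers(2)[OF zs, where ks = ks and \<kappa> = "jt_exp n m l"]) (auto simp: ks_def)
  ultimately show ?thesis unfolding ks_def by simp
qed

lemma prod_mset_mset_set: "(\<Prod>x\<in>#mset_set S. f x) = (\<Prod>x\<in>S. f x)"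
  by (simp add: prod_unfold_prod_mset)

lemma prod_linear_factors_inverse:
  fixes B :: "complex set"
  assumes "finite B" "0 \<notin> B"
  shows "(\<Prod>b\<in>B. [:1, - b:]) = Polynomial.smult (\<Prod>b\<in>B. - b) (\<Prod>z\<in>inverse ` B. [:- z, 1:])"
proof -
  have "(\<Prod>z\<in>inverse ` B. [:- z, 1:]) = (\<Prod>b\<in>B. [:- inverse b, 1:])"
    by (subst prod.reindex) (auto simp: inj_on_def)
  moreover have "(\<Prod>b\<in>B. [:1, - b:]) = (\<Prod>b\<in>B. Polynomial.smult (- b) [:- inverse b, 1:])"
  proof (rule prod.cong [OF refl])
    fix b assume "b \<in> B"
    then have "b \<noteq> 0" using assms by auto
    then show "[:1, - b:] = Polynomial.smult (- b) [:- inverse b, 1:]" by simp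
  qed
  ultimately show ?thesis by (simp only: prod_smult)
qed

section \<open>The subset expansion for weights inside the box\<close>

context
  fixes A B :: "complex set" and n m w :: nat and l :: "nat \<Rightarrow> int"
  assumes adm: "admissible_pair A B" and dom: "antimono_on {..<n} l"
    and card_A: "card A = m" and card_B: "card B = w"
    and box: "\<And>i. i < n \<Longrightarrow> - int w \<le> l i \<and> l i \<le> int m"
begin

private lemma fin: "finite A" "finite B" and nz: "0 \<notin> A" "0 \<notin> B" and dis: "A \<inter> inverse ` B = {}"
  using adm by (auto simp: admissible_pair_def)

private lemma disj_inv: "a \<in> A \<Longrightarrow> b \<in> B \<Longrightarrow> a \<noteq> inverse b" "a \<in> A \<Longrightarrow> b \<in> B \<Longrightarrow> inverse a \<noteq> b"
proof -
  show "a \<in> A \<Longrightarrow> b \<in> B \<Longrightarrow> a \<noteq> inverse b" using dis by auto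
  then show "a \<in> A \<Longrightarrow> b \<in> B \<Longrightarrow> inverse a \<noteq> b" by auto
qed

private lemma inverse_notin: "x \<in> B \<Longrightarrow> inverse x \<notin> A"
  using disj_inv(1)[of "inverse x" x] by auto

private lemma inverse_notin': "x \<in> A \<Longrightarrow> inverse x \<notin> B"
  using disj_inv(2)[of x "inverse x"] by auto

private abbreviation "\<mu>' \<equiv> conjugate_partition n (positive_part l)"
private abbreviation "\<nu>' \<equiv> conjugate_partition n (negative_part n l)"

text \<open>The \<open>w\<close> largest exponents. Up to the common shift
  \<open>m + n + w - 1\<close> they are the negatives, in reversed order, of the exponents of the
  Schur function of \<open>\<nu>'\<close> in \<open>w\<close> variables, so they belong to that
  Schur function in inverted variables.\<close>

private definition "ks1 = map (\<lambda>j. int (m + w) - 1 - int j + int n - \<nu>' (w - 1 - j)) [0..<w]"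

text \<open>The first \<open>w\<close> exponents count the \<open>l i\<close> above negative
  thresholds and see only the negative part of the weight; the last \<open>m\<close> have
  nonnegative thresholds and see only the positive part. In this way one Schur function in all the
  roots separates into the two Schur functions of the recipe.\<close>

private lemma jt_exps_split:
  "map (\<lambda>j. int (jt_exp n m l (m + w - 1 - j))) [0..<m + w] = ks1 @ part_exps m \<mu>'"
proof (rule nth_equalityI)
  fix j assume "j < length (map (\<lambda>j. int (jt_exp n m l (m + w - 1 - j))) [0..<m + w])"
  then have j: "j < m + w" by simp
  show "map (\<lambda>j. int (jt_exp n m l (m + w - 1 - j))) [0..<m + w] ! j = (ks1 @ part_exps m \<mu>') ! j"
  proof (cases "j < w")
    case True
    have e: "int m - 1 - int (m + w - 1 - j) = - int (w - 1 - j) - 1" using True by auto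
    have "int (jt_exp n m l (m + w - 1 - j)) =
       int (m + w - 1 - j) + int (card {i. i < n \<and> l i > - int (w - 1 - j) - 1})"
      unfolding jt_exp_def e by simp
    also have "\<dots> = int (m + w) - 1 - int j + int n - \<nu>' (w - 1 - j)"
      unfolding conjugate_negative_part using True by auto
    finally show ?thesis using True by (simp add: ks1_def nth_append)
  next
    case False
    have e: "int m - 1 - int (m + w - 1 - j) = int (j - w)" using False j by auto
    have "int (jt_exp n m l (m + w - 1 - j)) = int (m + w - 1 - j) + int (card {i. i < n \<and> l i > int (j - w)})"
      unfolding jt_exp_def e by simp
    also have "\<dots> = int m - 1 - int (j - w) + \<mu>' (j - w)"
      unfolding conjugate_positive_part using False j by auto
    finally show ?thesis using False j by (simp add: ks1_def nth_append nth_part_exps)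
  qed
qed (simp add: ks1_def)

private lemma asum_ks1:
  assumes D: "finite D" "card D = w" "0 \<notin> D"
  shows "asum ks1 (inverse ` D) = (\<Prod>d\<in>D. d powi (- int (m + n))) * asum (part_exps w \<nu>') D"
proof -
  let ?c = "- int (m + n + (w - 1))"
  have "map uminus (rev ks1) = map ((+) ?c) (part_exps w \<nu>')"
  proof (rule nth_equalityI)
    fix i assume "i < length (map uminus (rev ks1))"
    then have i: "i < w" by (simp add: ks1_def)
    then have "w - 1 - (w - Suc i) = i" by simp
    then show "map uminus (rev ks1) ! i = map ((+) ?c) (part_exps w \<nu>') ! i"
      using i by (simp add: ks1_def rev_nth nth_part_exps)
  qed (simp add: ks1_def)
  then have "asum ks1 (inverse ` D) = (\<Prod>d\<in>D. d ^ (w - 1)) * ((\<Prod>d\<in>D. d powi ?c) * asum (part_exps w \<nu>') D)"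
    using asum_inverse[of D ks1] asum_shift[of D "part_exps w \<nu>'" ?c] D by (simp add: ks1_def)
  also have "\<dots> = (\<Prod>d\<in>D. d ^ (w - 1) * d powi ?c) * asum (part_exps w \<nu>') D"
    by (simp add: prod.distrib)
  also have "(\<Prod>d\<in>D. d ^ (w - 1) * d powi ?c) = (\<Prod>d\<in>D. d powi (- int (m + n)))"
  proof (rule prod.cong [OF refl])
    fix d assume "d \<in> D"
    then have "d \<noteq> 0" using D by auto
    then have "d powi (int (w - 1)) * d powi ?c = d powi (int (w - 1) + ?c)" by (subst power_int_add) auto
    also have "int (w - 1) + ?c = - int (m + n)" by simp
    finally show "d ^ (w - 1) * d powi ?c = d powi (- int (m + n))" by (simp only: power_int_of_nat)
  qed
  finally show ?thesis .
qed

text \<open>\<open>1/D\<close> is the chosen subset of the roots and \<open>C\<close> the rest. The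
  cross factor \<open>1/(1/d - c) = d/(1 - c d)\<close> supplies the denominator of
  \<open>Z_factor\<close> and a power \<open>d^m\<close>, which reduces the exponent
  \<open>-(m + n)\<close> from the inverted variables to \<open>-n\<close>. The sign stems from the
  negated arguments of the Schur polynomials in \<open>Z_factor\<close>.\<close>

private lemma term_eq:
  assumes C: "finite C" "card C = m" and D: "finite D" "card D = w" "0 \<notin> D"
  shows "asum ks1 (inverse ` D) * asum (part_exps m \<mu>') C * (\<Prod>s\<in>inverse ` D. \<Prod>c\<in>C. 1 / (s - c)) =
    (\<Prod>k<n. (-1) powi l k) * (\<Prod>d\<in>D. inverse (d ^ n)) * Z_factor n l (mset_set C) (mset_set D)"
proof -
  have "(\<Prod>s\<in>inverse ` D. \<Prod>c\<in>C. 1 / (s - c)) = (\<Prod>d\<in>D. \<Prod>c\<in>C. 1 / (inverse d - c))"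
    by (subst prod.reindex) (auto simp: inj_on_def)
  also have "\<dots> = (\<Prod>d\<in>D. \<Prod>c\<in>C. d * (1 / (1 - c * d)))"
  proof (intro prod.cong refl)
    fix d c assume "d \<in> D"
    then have "d \<noteq> 0" using D by auto
    then have "inverse d - c = (1 - c * d) / d" by (simp add: field_simps)
    then show "1 / (inverse d - c) = d * (1 / (1 - c * d))" by simp
  qed
  also have "\<dots> = (\<Prod>d\<in>D. d ^ m) * (\<Prod>d\<in>D. \<Prod>c\<in>C. 1 / (1 - c * d))"
    using C by (simp only: prod.distrib prod_constant)
  finally have 1: "(\<Prod>s\<in>inverse ` D. \<Prod>c\<in>C. 1 / (s - c)) = (\<Prod>d\<in>D. d ^ m) * (\<Prod>c\<in>C. \<Prod>d\<in>D. 1 / (1 - c * d))"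
    by (subst (2) prod.swap)
  have 2: "(\<Prod>d\<in>D. d powi (- int (m + n))) * (\<Prod>d\<in>D. d ^ m) = (\<Prod>d\<in>D. inverse (d ^ n))"
    unfolding prod.distrib[symmetric]
  proof (rule prod.cong [OF refl])
    fix d assume "d \<in> D"
    then have "d \<noteq> 0" using D by auto
    moreover have "d powi (- int (m + n)) = inverse (d ^ (m + n))"
      by (simp only: power_int_minus power_int_of_nat)
    ultimately show "d powi (- int (m + n)) * d ^ m = inverse (d ^ n)"
      by (simp add: power_add)
  qed
  let ?sm = "\<Prod>j<m. (-1 :: complex) powi \<mu>' j" and ?sn = "\<Prod>j<w. (-1 :: complex) powi \<nu>' j"
  \<comment> \<open>The diagrams of \<mu> and \<nu> together have as many boxes as the sum of the
    \<open>\<bar>l k\<bar>\<close>, a number of the same parity as the sum of the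
    \<open>l k\<close>.\<close>
  have s: "?sm * ?sn = (\<Prod>k<n. (-1) powi l k)"
  proof -
    have "?sm = (\<Prod>i<n. (-1) powi positive_part l i)"
      by (rule conjugate_partition_sign) (use box in \<open>auto simp: positive_part_def\<close>)
    moreover have "?sn = (\<Prod>i<n. (-1) powi negative_part n l i)"
    proof (rule conjugate_partition_sign)
      fix i assume "i < n"
      then show "0 \<le> negative_part n l i \<and> negative_part n l i \<le> int w"
        using box[of "n - 1 - i"] by (auto simp: negative_part_def)
    qed
    moreover have "(\<Prod>i<n. (-1 :: complex) powi negative_part n l i) = (\<Prod>i<n. (-1) powi max (- l i) 0)"
      using prod.nat_diff_reindex[of "\<lambda>i. (-1 :: complex) powi max (- l i) 0" n]
      by (simp add: negative_part_def)
    moreover have "(\<Prod>i<n. (-1 :: complex) powi positive_part l i) * (\<Prod>i<n. (-1) powi max (- l i) 0) = (\<Prod>k<n. (-1) powi l k)"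
      unfolding prod.distrib[symmetric]
    proof (rule prod.cong [OF refl])
      fix k
      show "(-1 :: complex) powi positive_part l k * (-1) powi max (- l k) 0 = (-1) powi l k"
      proof (cases "l k \<ge> 0")
        case False
        then have "(-1 :: complex) powi (- l k) = (-1) powi l k" by (simp add: power_int_minus_left)
        then show ?thesis using False by (simp add: positive_part_def)
      qed (simp add: positive_part_def)
    qed
    ultimately show ?thesis by simp
  qed
  have "(\<Prod>k<n. (-1 :: complex) powi l k) * (\<Prod>k<n. (-1) powi l k) = (\<Prod>k<n. ((-1) * (-1)) powi l k)"
    by (simp only: prod.distrib[symmetric] power_int_mult_distrib)
  then have ss: "(\<Prod>k<n. (-1 :: complex) powi l k) * (\<Prod>k<n. (-1) powi l k) = 1" by simp
  have "\<mu>' i = 0" if "i \<ge> m" for i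
    using box that unfolding conjugate_positive_part by fastforce
  then have a: "schur_poly \<mu>' (image_mset uminus (mset_set C)) = ?sm * asum (part_exps m \<mu>') C"
    by (intro schur_poly_uminus_mset_set C)
  have "\<nu>' i = 0" if "i \<ge> w" for i
  proof -
    have "{j. j < n \<and> l j > - int i - 1} = {..<n}" using box that by fastforce
    then show ?thesis unfolding conjugate_negative_part by simp
  qed
  then have b: "schur_poly \<nu>' (image_mset uminus (mset_set D)) = ?sn * asum (part_exps w \<nu>') D"
    by (intro schur_poly_uminus_mset_set D)
  have "(\<Prod>k<n. (-1) powi l k) * Z_factor n l (mset_set C) (mset_set D) =
     (\<Prod>k<n. (-1) powi l k) * (?sm * ?sn) * (asum (part_exps m \<mu>') C * asum (part_exps w \<nu>') D * (\<Prod>c\<in>C. \<Prod>d\<in>D. 1 / (1 - c * d)))"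
    unfolding Z_factor_def a b prod_mset_mset_set by (simp only: mult_ac)
  also have "\<dots> = asum (part_exps m \<mu>') C * asum (part_exps w \<nu>') D * (\<Prod>c\<in>C. \<Prod>d\<in>D. 1 / (1 - c * d))"
    unfolding s ss by simp
  finally have Z: "(\<Prod>k<n. (-1) powi l k) * Z_factor n l (mset_set C) (mset_set D) =
    asum (part_exps m \<mu>') C * asum (part_exps w \<nu>') D * (\<Prod>c\<in>C. \<Prod>d\<in>D. 1 / (1 - c * d))" .
  have "asum ks1 (inverse ` D) * asum (part_exps m \<mu>') C * (\<Prod>s\<in>inverse ` D. \<Prod>c\<in>C. 1 / (s - c)) =
    ((\<Prod>d\<in>D. d powi (- int (m + n))) * (\<Prod>d\<in>D. d ^ m)) *
      (asum (part_exps m \<mu>') C * asum (part_exps w \<nu>') D * (\<Prod>c\<in>C. \<Prod>d\<in>D. 1 / (1 - c * d)))"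
    unfolding asum_ks1[OF D] 1 by (simp only: mult_ac)
  then show ?thesis unfolding 2 Z[symmetric] by (simp only: mult_ac)
qed

text \<open>\<open>V\<close> consists of those \<open>b\<close> whose inverse is left out of
  \<open>S\<close>. As \<open>A\<close> and \<open>1/B\<close> are disjoint,
  \<open>|S| = |U| + w - |V|\<close>, so the condition \<open>|U| = |V|\<close> of the recipe is
  \<open>|S| = w\<close>.\<close>

private lemma subset_bij:
  "bij_betw (\<lambda>(U, V). U \<union> inverse ` (B - V)) {(U, V). U \<subseteq> A \<and> V \<subseteq> B \<and> card U = card V}
     {S. S \<subseteq> A \<union> inverse ` B \<and> card S = w}"
proof (rule bij_betw_byWitness[where f' = "\<lambda>S. (S \<inter> A, {b\<in>B. inverse b \<notin> S})"], goal_cases)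
  case 1
  show ?case using inverse_notin by auto
next
  case 2
  show ?case using inverse_notin by auto
next
  case 3
  show ?case
  proof clarify
    fix U V assume UV: "U \<subseteq> A" "V \<subseteq> B" "card U = card V"
    have f: "finite U" "finite V" using UV fin finite_subset by auto
    have "card (U \<union> inverse ` (B - V)) = card U + card (inverse ` (B - V))"
      using f fin UV dis by (intro card_Un_disjoint) auto
    also have "card (inverse ` (B - V)) = card (B - V)" by (rule card_image) (auto simp: inj_on_def)
    also have "\<dots> = w - card V" using UV f card_B by (simp add: card_Diff_subset)
    finally have "card (U \<union> inverse ` (B - V)) = w"
      using UV card_mono[OF fin(2) UV(2)] card_B by simp
    then show "U \<union> inverse ` (B - V) \<subseteq> A \<union> inverse ` B \<and> card (U \<union> inverse ` (B - V)) = w"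
      using UV by auto
  qed
next
  case 4
  show ?case
  proof clarify
    fix S assume S: "S \<subseteq> A \<union> inverse ` B" "w = card S"
    have "S = (S \<inter> A) \<union> inverse ` {b\<in>B. inverse b \<in> S}" using S by auto
    then have "card S = card (S \<inter> A) + card (inverse ` {b\<in>B. inverse b \<in> S})"
      using fin dis by (subst (1) \<open>S = _\<close>, intro card_Un_disjoint) auto
    also have "card (inverse ` {b\<in>B. inverse b \<in> S}) = card {b\<in>B. inverse b \<in> S}"
      by (rule card_image) (auto simp: inj_on_def)
    finally have 1: "w = card (S \<inter> A) + card {b\<in>B. inverse b \<in> S}" using S by simp
    have "card ({b\<in>B. inverse b \<in> S} \<union> {b\<in>B. inverse b \<notin> S}) = card {b\<in>B. inverse b \<in> S} + card {b\<in>B. inverse b \<notin> S}"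
      using fin by (intro card_Un_disjoint) auto
    moreover have "{b\<in>B. inverse b \<in> S} \<union> {b\<in>B. inverse b \<notin> S} = B" by auto
    ultimately have "w = card {b\<in>B. inverse b \<in> S} + card {b\<in>B. inverse b \<notin> S}" using card_B by simp
    then show "S \<inter> A \<subseteq> A \<and> {b\<in>B. inverse b \<notin> S} \<subseteq> B \<and> card (S \<inter> A) = card {b\<in>B. inverse b \<notin> S}"
      using 1 by auto
  qed
qed

lemma recipe_sum_box:
  "recipe_sum n l A B = moment_det n m l ((\<Prod>a\<in>A. [:- a, 1:]) * (\<Prod>b\<in>B. [:1, - b:]))"
proof -
  define Z where "Z = A \<union> inverse ` B"
  have finZ: "finite Z" using fin by (simp add: Z_def)
  have cardZ: "card Z = m + w"
    using fin dis card_A card_B unfolding Z_def by (subst card_Un_disjoint) (auto simp: card_image inj_on_def)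
  obtain zs where zs: "set zs = Z" "distinct zs" using finite_distinct_list[OF finZ] by auto
  have lz: "length zs = m + w" using distinct_card[OF zs(2)] zs cardZ by simp
  let ?P = "\<Prod>z\<in>Z. [:- z, 1:]"
  have "(\<Prod>a\<in>A. [:- a, 1:]) * (\<Prod>b\<in>B. [:1, - b:]) = Polynomial.smult (\<Prod>b\<in>B. - b) ?P"
    unfolding prod_linear_factors_inverse[OF fin(2) nz(2)] Z_def using fin dis
    by (subst prod.union_disjoint) auto
  then have "moment_det n m l ((\<Prod>a\<in>A. [:- a, 1:]) * (\<Prod>b\<in>B. [:1, - b:])) = (\<Prod>b\<in>B. - b) ^ n * moment_det n m l ?P"
    by (simp only: moment_det_smult)
  also have "moment_det n m l ?P = (\<Prod>k<n. (-1) ^ w * (-1) powi l k) * asum (ks1 @ part_exps m \<mu>') Z"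
    using moment_det_eq_asum[OF dom box zs(2) lz] unfolding jt_exps_split zs by simp
  \<comment> \<open>The sign \<open>(-1)^(w n)\<close> of the leading coefficients cancels the one
    from the dual Jacobi-Trudi identity.\<close>
  also have "(\<Prod>b\<in>B. - b) ^ n * ((\<Prod>k<n. (-1) ^ w * (-1) powi l k) * asum (ks1 @ part_exps m \<mu>') Z) =
     (\<Prod>b\<in>B. b ^ n) * (\<Prod>k<n. (-1) powi l k) * asum (ks1 @ part_exps m \<mu>') Z"
  proof -
    have "(\<Prod>b\<in>B. - b) = (\<Prod>b\<in>B. (-1) * b)" by simp
    also have "\<dots> = (-1) ^ w * (\<Prod>b\<in>B. b)" by (simp only: prod.distrib prod_constant card_B)
    finally have "(\<Prod>b\<in>B. - b) ^ n = ((-1) ^ w) ^ n * (\<Prod>b\<in>B. b ^ n)"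
      by (simp add: power_mult_distrib prod_power_distrib)
    moreover have "((-1 :: complex) ^ w) ^ n * ((-1) ^ w) ^ n = 1"
      by (simp add: power_mult_distrib[symmetric])
    ultimately show ?thesis by (simp add: prod.distrib)
  qed
  also have "asum (ks1 @ part_exps m \<mu>') Z = (\<Sum>S | S \<subseteq> Z \<and> card S = w.
     asum ks1 S * asum (part_exps m \<mu>') (Z - S) * (\<Prod>s\<in>S. \<Prod>z\<in>Z - S. 1 / (s - z)))"
    using asum_append[of Z ks1 "part_exps m \<mu>'"] finZ cardZ by (simp add: ks1_def)
  also have "\<dots> = (\<Sum>(U, V) | U \<subseteq> A \<and> V \<subseteq> B \<and> card U = card V.
     asum ks1 (U \<union> inverse ` (B - V)) * asum (part_exps m \<mu>') (Z - (U \<union> inverse ` (B - V))) *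
       (\<Prod>s\<in>U \<union> inverse ` (B - V). \<Prod>z\<in>Z - (U \<union> inverse ` (B - V)). 1 / (s - z)))"
    unfolding Z_def
    by (subst sum.reindex_bij_betw[OF subset_bij, symmetric]) (simp only: case_prod_unfold)
  also have "(\<Prod>b\<in>B. b ^ n) * (\<Prod>k<n. (-1) powi l k) * \<dots> = recipe_sum n l A B"
    unfolding recipe_sum_def sum_distrib_left
  proof (rule sum.cong [OF refl], clarify)
    fix U V assume UV: "U \<subseteq> A" "V \<subseteq> B" "card U = card V"
    have f: "finite U" "finite V" using UV fin finite_subset by auto
    define C D where "C = (A - U) \<union> inverse ` V" and "D = (B - V) \<union> inverse ` U"
    \<comment> \<open>\<open>C\<close> and \<open>D\<close> are the two arguments of the recipe
      term; the chosen subset of the roots is \<open>1/D\<close> and its complement is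
      \<open>C\<close>.\<close>
    have S: "U \<union> inverse ` (B - V) = inverse ` D" by (force simp: D_def image_Un image_image)
    have ZS: "Z - inverse ` D = C"
      unfolding S[symmetric] C_def Z_def using UV disj_inv by auto
    have dC: "(A - U) \<inter> inverse ` V = {}" using inverse_notin UV by auto
    have dD: "(B - V) \<inter> inverse ` U = {}" using inverse_notin' UV by auto
    have le: "card U \<le> m" "card V \<le> w" using card_mono[OF fin(1) UV(1)] card_mono[OF fin(2) UV(2)] card_A card_B by auto
    have C: "finite C" "card C = m"
    proof -
      have "card C = card (A - U) + card (inverse ` V)" unfolding C_def using fin f dC by (intro card_Un_disjoint) auto
      also have "card (inverse ` V) = card V" by (rule card_image) (auto simp: inj_on_def)
      finally show "card C = m" using UV f le card_A by (simp add: card_Diff_subset)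
    qed (use fin f in \<open>auto simp: C_def\<close>)
    have D: "finite D" "card D = w" "0 \<notin> D"
    proof -
      have "card D = card (B - V) + card (inverse ` U)" unfolding D_def using fin f dD by (intro card_Un_disjoint) auto
      also have "card (inverse ` U) = card U" by (rule card_image) (auto simp: inj_on_def)
      finally show "card D = w" using UV f le card_B by (simp add: card_Diff_subset)
    qed (use fin f nz UV in \<open>auto simp: D_def\<close>)
    have mC: "mset_set (A - U) + image_mset inverse (mset_set V) = mset_set C"
      unfolding C_def using dC fin f by (subst mset_set_Union) (auto simp: image_mset_mset_set inj_on_def)
    have mD: "mset_set (B - V) + image_mset inverse (mset_set U) = mset_set D"
      unfolding D_def using dD fin f by (subst mset_set_Union) (auto simp: image_mset_mset_set inj_on_def)
    \<comment> \<open>The leading coefficients of the factors \<open>1 - b x\<close> contribute the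
      n-th powers over \<open>B\<close>. The elements of \<open>B - V\<close> cancel against those
      in \<open>D\<close>, while the elements \<open>1/u\<close> of \<open>D\<close> return
      \<open>u^n\<close>: what remains is \<open>(UV)^n\<close>.\<close>
    have pD: "(\<Prod>b\<in>B. b ^ n) * (\<Prod>d\<in>D. inverse (d ^ n)) = (\<Prod>u\<in>U. u ^ n) * (\<Prod>v\<in>V. v ^ n)"
    proof -
      have "(\<Prod>d\<in>D. inverse (d ^ n)) = (\<Prod>d\<in>B - V. inverse (d ^ n)) * (\<Prod>d\<in>inverse ` U. inverse (d ^ n))"
        unfolding D_def using fin f dD by (intro prod.union_disjoint) auto
      also have "(\<Prod>d\<in>inverse ` U. inverse (d ^ n)) = (\<Prod>u\<in>U. u ^ n)"
        by (subst prod.reindex) (auto simp: inj_on_def power_inverse)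
      finally have 1: "(\<Prod>d\<in>D. inverse (d ^ n)) = (\<Prod>d\<in>B - V. inverse (d ^ n)) * (\<Prod>u\<in>U. u ^ n)" .
      have 2: "(\<Prod>b\<in>B. b ^ n) = (\<Prod>b\<in>B - V. b ^ n) * (\<Prod>v\<in>V. v ^ n)"
        using prod.subset_diff[OF UV(2) fin(2)] by auto
      have "(\<Prod>b\<in>B - V. b ^ n) * (\<Prod>d\<in>B - V. inverse (d ^ n)) = 1"
        unfolding prod.distrib[symmetric]
      proof (intro prod.neutral ballI)
        fix b assume "b \<in> B - V"
        then have "b \<noteq> 0" using nz by auto
        then show "b ^ n * inverse (b ^ n) = 1" by simp
      qed
      then show ?thesis unfolding 1 2 by (simp add: mult_ac)
    qed
    have "(\<Prod>b\<in>B. b ^ n) * (\<Prod>k<n. (-1) powi l k) *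
        (asum ks1 (inverse ` D) * asum (part_exps m \<mu>') C * (\<Prod>s\<in>inverse ` D. \<Prod>z\<in>C. 1 / (s - z))) =
       ((\<Prod>b\<in>B. b ^ n) * (\<Prod>d\<in>D. inverse (d ^ n))) * (((\<Prod>k<n. (-1) powi l k) * (\<Prod>k<n. (-1) powi l k)) * Z_factor n l (mset_set C) (mset_set D))"
      unfolding term_eq[OF C D] by (simp only: mult_ac)
    also have "(\<Prod>k<n. (-1 :: complex) powi l k) * (\<Prod>k<n. (-1) powi l k) = 1"
      by (simp only: prod.distrib[symmetric] power_int_mult_distrib[symmetric]) simp
    finally show "(\<Prod>b\<in>B. b ^ n) * (\<Prod>k<n. (-1) powi l k) *
        (asum ks1 (U \<union> inverse ` (B - V)) * asum (part_exps m \<mu>') (Z - (U \<union> inverse ` (B - V))) *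
       (\<Prod>s\<in>U \<union> inverse ` (B - V). \<Prod>z\<in>Z - (U \<union> inverse ` (B - V)). 1 / (s - z))) =
      (\<Prod>u\<in>U. u ^ n) * (\<Prod>v\<in>V. v ^ n) * Z_factor n l (mset_set (A - U) + image_mset inverse (mset_set V))
         (mset_set (B - V) + image_mset inverse (mset_set U))"
      unfolding S ZS mC mD pD by simp
  qed
  finally show ?thesis by simp
qed

end

lemma schur_poly_eq_0: "\<rho> (size E) \<noteq> 0 \<Longrightarrow> schur_poly \<rho> E = 0"
  by (auto simp: schur_poly_def)

text \<open>Outside the box both sides vanish. If \<open>l 0 > |A|\<close>, then
  \<open>\<mu>'\<close> has more than \<open>|A|\<close> nonzero parts, too many for every first
  argument of \<open>Z_factor\<close>, and the first row of the determinant has only negative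
  indices. If the last part is below \<open>-|B|\<close>, the same happens to \<open>\<nu>'\<close>,
  and the indices in the last row exceed the degree of the polynomial.\<close>

theorem recipe_sum_eq_moment_det:
  assumes adm: "admissible_pair A B" and dom: "dominant_weight n l"
  shows "recipe_sum n l A B = moment_det n (card A) l ((\<Prod>a\<in>A. [:- a, 1:]) * (\<Prod>b\<in>B. [:1, - b:]))"
proof -
  let ?m = "card A" and ?w = "card B" and ?q = "(\<Prod>a\<in>A. [:- a, 1:]) * (\<Prod>b\<in>B. [:1, - b:])"
  have l: "antimono_on {..<n} l" using dom by (simp add: dominant_weight_def)
  have fin: "finite A" "finite B" using adm by (auto simp: admissible_pair_def)
  have mono: "l j \<le> l i" if "i \<le> j" "j < n" for i j
    using l that by (auto simp: monotone_on_def)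
  have size: "size (image_mset uminus (mset_set (A - U) + image_mset inverse (mset_set V))) = ?m"
     "size (image_mset uminus (mset_set (B - V) + image_mset inverse (mset_set U))) = ?w"
    if "U \<subseteq> A" "V \<subseteq> B" "card U = card V" for U V
    using that fin card_mono[OF fin(1) that(1)] card_mono[OF fin(2) that(2)] finite_subset[OF that(1)] finite_subset[OF that(2)]
    by (auto simp: card_Diff_subset)
  consider "\<forall>i<n. - int ?w \<le> l i \<and> l i \<le> int ?m" | "n > 0" "l 0 > int ?m" | "n > 0" "l (n - 1) < - int ?w"
  proof (cases "n > 0 \<and> (l 0 > int ?m \<or> l (n - 1) < - int ?w)")
    case False
    have "- int ?w \<le> l i \<and> l i \<le> int ?m" if "i < n" for i
    proof -
      have "l (n - 1) \<le> l i" "l i \<le> l 0" using that by (auto intro!: mono)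
      then show ?thesis using that False by auto
    qed
    then show ?thesis using that by blast
  qed (use that in blast)
  then show ?thesis
  proof cases
    case 1
    then show ?thesis using recipe_sum_box[OF adm l refl refl] by simp
  next
    case 2
    have "0 \<in> {i. i < n \<and> l i > int ?m}" using 2 by simp
    then have "card {i. i < n \<and> l i > int ?m} \<noteq> 0" by (subst card_0_eq) auto
    then have "conjugate_partition n (positive_part l) ?m \<noteq> 0" unfolding conjugate_positive_part by simp
    then have "Z_factor n l (mset_set (A - U) + image_mset inverse (mset_set V)) D = 0"
      if "U \<subseteq> A" "V \<subseteq> B" "card U = card V" for U V D
      using size[OF that] unfolding Z_factor_def by (subst schur_poly_eq_0) simp_all
    then have "recipe_sum n l A B = 0" unfolding recipe_sum_def by (intro sum.neutral) auto
    moreover have "moment_det n ?m l ?q = 0"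
      unfolding moment_det_def by (rule det_mat_zero_row[of 0]) (use 2 in \<open>auto simp: coeff_int_def\<close>)
    ultimately show ?thesis by simp
  next
    case 3
    have "card {i. i < n \<and> l i > - int ?w - 1} \<le> n - 1"
      using card_filter_gt(2)[OF l, of "n - 1" "- int ?w - 1"] 3 by simp
    then have "conjugate_partition n (negative_part n l) ?w \<noteq> 0" unfolding conjugate_negative_part using 3 by auto
    then have "Z_factor n l C (mset_set (B - V) + image_mset inverse (mset_set U)) = 0"
      if "U \<subseteq> A" "V \<subseteq> B" "card U = card V" for U V C
      using size[OF that] unfolding Z_factor_def by (subst (2) schur_poly_eq_0) simp_all
    then have "recipe_sum n l A B = 0" unfolding recipe_sum_def by (intro sum.neutral) auto
    moreover have "degree ?q \<le> ?m + ?w"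
    proof -
      have "degree (\<Prod>a\<in>A. [:- a, 1:]) \<le> ?m"
        using degree_prod_sum_le[OF fin(1), of "\<lambda>a. [:- a, 1:]"] by simp
      moreover have "degree (\<Prod>b\<in>B. [:1, - b:]) \<le> ?w"
        using degree_prod_sum_le[OF fin(2), of "\<lambda>b. [:1, - b:]"] sum_mono[of B "\<lambda>b. degree [:1, - b:]" "\<lambda>_. 1"] by fastforce
      ultimately show ?thesis using degree_mult_le[of "\<Prod>a\<in>A. [:- a, 1:]" "\<Prod>b\<in>B. [:1, - b:]"] by linarith
    qed
    then have "moment_det n ?m l ?q = 0"
      unfolding moment_det_def using 3
      by (intro det_mat_zero_row[of "n - 1"]) (auto simp: coeff_int_def intro!: coeff_eq_0)
    ultimately show ?thesis by simp
  qed
qed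

section \<open>Invariant differentiation under the Haar integral\<close>

lemma matrix_mult_nth: "(A ** B) $ i $ j = (\<Sum>k\<in>UNIV. A $ i $ k * B $ k $ j)"
  by (simp add: matrix_matrix_mult_def)

lemma mat_1_nth: "mat 1 $ i $ j = (if i = j then 1 else 0)"
  by (simp add: Finite_Cartesian_Product.mat_def)

lemma conj_transpose_nth: "conj_transpose g $ i $ j = cnj (g $ j $ i)"
  by (simp add: conj_transpose_def)

lemma conj_transpose_mult: "conj_transpose (g ** h) = conj_transpose h ** conj_transpose g"
  by (simp add: Finite_Cartesian_Product.vec_eq_iff matrix_mult_nth conj_transpose_nth mult.commute)

lemma conj_transpose_involution: "conj_transpose (conj_transpose g) = g"
  by (simp add: Finite_Cartesian_Product.vec_eq_iff conj_transpose_nth)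

lemma unitaryD: "g \<in> unitary_group \<Longrightarrow> conj_transpose g ** g = mat 1"
  "g \<in> unitary_group \<Longrightarrow> g ** conj_transpose g = mat 1"
  by (auto simp: unitary_group_def)

lemma unitary_conj_transpose: "g \<in> unitary_group \<Longrightarrow> conj_transpose g \<in> unitary_group"
  by (auto simp: unitary_group_def conj_transpose_involution)

lemma mat_1_unitary: "mat 1 \<in> unitary_group"
proof -
  have "conj_transpose (mat 1) = mat 1"
    by (simp add: Finite_Cartesian_Product.vec_eq_iff conj_transpose_nth mat_1_nth)
  then show ?thesis by (simp add: unitary_group_def)
qed

lemma unitary_mult: "g \<in> unitary_group \<Longrightarrow> h \<in> unitary_group \<Longrightarrow> g ** h \<in> unitary_group"
proof -
  assume g: "g \<in> unitary_group" and h: "h \<in> unitary_group"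
  have "conj_transpose (g ** h) ** (g ** h) = conj_transpose h ** (conj_transpose g ** g) ** h"
    by (simp only: conj_transpose_mult matrix_mul_assoc)
  also have "\<dots> = mat 1" by (simp add: unitaryD[OF g] unitaryD[OF h])
  moreover have "(g ** h) ** conj_transpose (g ** h) = g ** (h ** conj_transpose h) ** conj_transpose g"
    by (simp only: conj_transpose_mult matrix_mul_assoc)
  moreover have "\<dots> = mat 1" by (simp add: unitaryD[OF g] unitaryD[OF h])
  ultimately show ?thesis by (simp add: unitary_group_def)
qed

lemma continuous_on_nth_nth [continuous_intros]:
  fixes f :: "'b :: topological_space \<Rightarrow> complex^'m^'n"
  shows "continuous_on S f \<Longrightarrow> continuous_on S (\<lambda>x. f x $ i $ j)"
  by (intro continuous_on_component)

lemma unitary_entry_le_1: 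
  fixes g :: "complex^'n^'n"
  assumes "g \<in> unitary_group" shows "norm (g $ i $ j) \<le> 1"
proof -
  have "(\<Sum>k\<in>UNIV. g $ i $ k * cnj (g $ i $ k)) = 1"
    using arg_cong[OF unitaryD(2)[OF assms], of "\<lambda>A. A $ i $ i"]
    by (simp add: matrix_mult_nth conj_transpose_nth mat_1_nth)
  then have "of_real (\<Sum>k\<in>UNIV. (norm (g $ i $ k))\<^sup>2) = (1 :: complex)"
    by (simp only: of_real_sum complex_norm_square of_real_1)
  then have 1: "(\<Sum>k\<in>UNIV. (norm (g $ i $ k))\<^sup>2) = 1" by (metis of_real_eq_1_iff)
  have "(norm (g $ i $ j))\<^sup>2 \<le> (\<Sum>k\<in>UNIV. (norm (g $ i $ k))\<^sup>2)"
    by (rule member_le_sum) auto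
  then show ?thesis using 1 by (simp add: power_le_one_iff abs_square_le_1)
qed

lemma compact_unitary_group: "compact (unitary_group :: (complex^'n^'n) set)"
unfolding compact_eq_bounded_closed
proof
  have "norm g \<le> (\<Sum>i\<in>(UNIV :: 'n set). \<Sum>j\<in>(UNIV :: 'n set). (1 :: real))" if "g \<in> unitary_group" for g :: "complex^'n^'n"
  proof -
    have "norm g \<le> (\<Sum>i\<in>UNIV. norm (g $ i))"
      unfolding norm_vec_def by (rule L2_set_le_sum) auto
    also have "\<dots> \<le> (\<Sum>i\<in>UNIV. \<Sum>j\<in>UNIV. norm (g $ i $ j))"
      by (rule sum_mono) (unfold norm_vec_def, rule L2_set_le_sum, auto)
    also have "\<dots> \<le> (\<Sum>i\<in>(UNIV :: 'n set). \<Sum>j\<in>(UNIV :: 'n set). (1 :: real))"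
      by (intro sum_mono unitary_entry_le_1 that)
    finally show ?thesis .
  qed
  then show "bounded (unitary_group :: (complex^'n^'n) set)" unfolding bounded_iff by blast
  have "(unitary_group :: (complex^'n^'n) set) =
    (\<Inter>i. \<Inter>j. {g. (conj_transpose g ** g) $ i $ j = mat 1 $ i $ j} \<inter> {g. (g ** conj_transpose g) $ i $ j = mat 1 $ i $ j})"
    by (auto simp: unitary_group_def Finite_Cartesian_Product.vec_eq_iff)
  also have "closed \<dots>"
    unfolding matrix_mult_nth conj_transpose_nth
    by (intro closed_INT closed_Int ballI closed_Collect_eq continuous_intros)
  finally show "closed (unitary_group :: (complex^'n^'n) set)" .
qed

lemma continuous_bounded_on_unitary:
  fixes f :: "complex^'n^'n \<Rightarrow> complex"
  assumes "continuous_on UNIV f"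
  obtains K where "K \<ge> 0" "\<And>g. g \<in> unitary_group \<Longrightarrow> norm (f g) \<le> K"
proof -
  have "bounded (f ` unitary_group)"
    by (intro compact_imp_bounded compact_continuous_image compact_unitary_group continuous_on_subset[OF assms]) simp
  then obtain K where "\<And>g. g \<in> unitary_group \<Longrightarrow> norm (f g) \<le> K" by (auto simp: bounded_iff)
  then show thesis using that[of "max K 0"] by (auto simp: max.coboundedI1)
qed

text \<open>A substitute for the one-parameter group \<open>exp(s X)\<close> with \<open>X\<close>
  in the Lie algebra: all that is kept is the expansion \<open>1 + s X\<close> with a quadratic
  error on \<open>[0, 1]\<close>. Explicit estimates of this kind can be integrated over the group
  without differentiating under the integral.\<close>

definition unitary_curve :: "(real \<Rightarrow> complex^'n^'n) \<Rightarrow> complex^'n^'n \<Rightarrow> bool"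
  where "unitary_curve h X \<longleftrightarrow> (\<forall>s. h s \<in> unitary_group) \<and> (\<forall>i j. X $ i $ j = - cnj (X $ j $ i)) \<and>
    (\<exists>C. \<forall>i j. \<forall>s\<in>{0..1}. norm (h s $ i $ j - mat 1 $ i $ j - of_real s * X $ i $ j) \<le> C * s\<^sup>2)"

definition dir_sum :: "complex^'n^'n \<Rightarrow> ('n \<Rightarrow> 'n \<Rightarrow> complex^'n^'n \<Rightarrow> complex) \<Rightarrow> complex^'n^'n \<Rightarrow> complex"
  where "dir_sum X G g = (\<Sum>i\<in>UNIV. \<Sum>j\<in>UNIV. X $ i $ j * G i j g)"

text \<open>
  \<open>G i j\<close> is the derivative of \<open>f\<close> along the right invariant vector field \<open>g \<mapsto> E\<^sub>i\<^sub>j g\<close> of the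
  complexified Lie algebra.
\<close>

definition inv_gradient :: "(complex^'n^'n \<Rightarrow> complex) \<Rightarrow> ('n \<Rightarrow> 'n \<Rightarrow> complex^'n^'n \<Rightarrow> complex) \<Rightarrow> bool"
  where "inv_gradient f G \<longleftrightarrow> continuous_on UNIV f \<and> (\<forall>i j. continuous_on UNIV (G i j)) \<and>
    (\<forall>h X. unitary_curve h X \<longrightarrow> (\<exists>C. \<forall>s\<in>{0..1}. \<forall>g\<in>unitary_group.
        norm (f (h s ** g) - f g - of_real s * dir_sum X G g) \<le> C * s\<^sup>2))"

lemma continuous_on_dir_sum:
  "(\<And>i j. continuous_on UNIV (G i j)) \<Longrightarrow> continuous_on UNIV (dir_sum X G)"
  unfolding dir_sum_def by (intro continuous_intros)

lemma inv_gradientE: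
  assumes "inv_gradient f G" "unitary_curve h X"
  obtains C where "C \<ge> 0" "\<And>s g. s \<in> {0..1} \<Longrightarrow> g \<in> unitary_group \<Longrightarrow>
        norm (f (h s ** g) - f g - of_real s * dir_sum X G g) \<le> C * s\<^sup>2"
proof -
  obtain C where C: "\<And>s g. s \<in> {0..1} \<Longrightarrow> g \<in> unitary_group \<Longrightarrow>
        norm (f (h s ** g) - f g - of_real s * dir_sum X G g) \<le> C * s\<^sup>2"
    using assms unfolding inv_gradient_def by blast
  have "0 \<le> C * 1\<^sup>2" by (rule order_trans[OF norm_ge_zero C[OF _ mat_1_unitary]]) simp
  then have "C \<ge> 0" by simp
  then show thesis by (rule that) (rule C)
qed

lemma inv_gradient_const: "inv_gradient (\<lambda>_. c) (\<lambda>i j g. 0)"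
  by (auto simp: inv_gradient_def dir_sum_def intro!: exI[of _ 0])

text \<open>The entry is linear in the matrix, so the error is the error of the curve multiplied by
  \<open>g\<close>, whose entries are bounded by 1. All other gradients are derived from this one by
  sums, products and conjugation.\<close>

lemma inv_gradient_entry: "inv_gradient (\<lambda>g. g $ k $ l) (\<lambda>i j g. if i = k then g $ j $ l else 0)"
proof -
  have "\<exists>C. \<forall>s\<in>{0..1}. \<forall>g\<in>unitary_group. norm ((h s ** g) $ k $ l - g $ k $ l -
      of_real s * dir_sum X (\<lambda>i j g. if i = k then g $ j $ l else 0) g) \<le> C * s\<^sup>2"
    if h: "unitary_curve h X" for h and X :: "complex^'a^'a"
  proof -
    obtain C where C: "\<And>i j s. s \<in> {0..1} \<Longrightarrow> norm (h s $ i $ j - mat 1 $ i $ j - of_real s * X $ i $ j) \<le> C * s\<^sup>2"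
      using h unfolding unitary_curve_def by blast
    have "norm ((h s ** g) $ k $ l - g $ k $ l -
      of_real s * dir_sum X (\<lambda>i j g. if i = k then g $ j $ l else 0) g) \<le> (of_nat CARD('a) * C) * s\<^sup>2"
      if s: "s \<in> {0..1}" and g: "g \<in> unitary_group" for s and g :: "complex^'a^'a"
    proof -
      have "dir_sum X (\<lambda>i j g. if i = k then g $ j $ l else 0) g =
          (\<Sum>i\<in>UNIV. if i = k then (\<Sum>j\<in>UNIV. X $ k $ j * g $ j $ l) else 0)"
        unfolding dir_sum_def by (rule sum.cong) auto
      then have 1: "dir_sum X (\<lambda>i j g. if i = k then g $ j $ l else 0) g = (\<Sum>j\<in>UNIV. X $ k $ j * g $ j $ l)"
        by simp
      have 2: "g $ k $ l = (\<Sum>j\<in>UNIV. mat 1 $ k $ j * g $ j $ l)"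
        by (simp only: matrix_mult_nth[symmetric] matrix_mul_lid)
      have "(h s ** g) $ k $ l - g $ k $ l - of_real s * dir_sum X (\<lambda>i j g. if i = k then g $ j $ l else 0) g =
         (\<Sum>j\<in>UNIV. (h s $ k $ j - mat 1 $ k $ j - of_real s * X $ k $ j) * g $ j $ l)"
        unfolding 1 by (subst 2) (simp add: matrix_mult_nth sum_distrib_left sum_subtractf[symmetric] algebra_simps)
      also have "norm \<dots> \<le> (\<Sum>j\<in>(UNIV :: 'a set). C * s\<^sup>2)"
      proof (rule sum_norm_le)
        fix j
        have "norm ((h s $ k $ j - mat 1 $ k $ j - of_real s * X $ k $ j) * g $ j $ l) \<le> (C * s\<^sup>2) * 1"
          unfolding norm_mult by (intro mult_mono C s unitary_entry_le_1 g order_trans[OF norm_ge_zero C]) auto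
        then show "norm ((h s $ k $ j - mat 1 $ k $ j - of_real s * X $ k $ j) * g $ j $ l) \<le> C * s\<^sup>2" by simp
      qed
      finally show ?thesis by simp
    qed
    then show ?thesis by blast
  qed
  moreover have "continuous_on UNIV (\<lambda>g. if i = k then g $ j $ l else 0 :: complex)" for i j :: 'a
    by (cases "i = k") (auto intro!: continuous_intros)
  moreover have "continuous_on UNIV (\<lambda>g :: complex^'a^'a. g $ k $ l)" by (intro continuous_intros)
  ultimately show ?thesis unfolding inv_gradient_def by blast
qed

lemma inv_gradient_add:
  assumes f: "inv_gradient f1 G1" "inv_gradient f2 G2"
  shows "inv_gradient (\<lambda>g. f1 g + f2 g) (\<lambda>i j g. G1 i j g + G2 i j g)"
proof -
  have "\<exists>C. \<forall>s\<in>{0..1}. \<forall>g\<in>unitary_group. norm ((f1 (h s ** g) + f2 (h s ** g)) - (f1 g + f2 g) -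
      of_real s * dir_sum X (\<lambda>i j g. G1 i j g + G2 i j g) g) \<le> C * s\<^sup>2"
    if h: "unitary_curve h X" for h X
  proof -
    obtain C1 where C1: "C1 \<ge> 0" "\<And>s g. s \<in> {0..1} \<Longrightarrow> g \<in> unitary_group \<Longrightarrow>
        norm (f1 (h s ** g) - f1 g - of_real s * dir_sum X G1 g) \<le> C1 * s\<^sup>2"
      by (rule inv_gradientE[OF f(1) h]) (rule that)
    obtain C2 where C2: "C2 \<ge> 0" "\<And>s g. s \<in> {0..1} \<Longrightarrow> g \<in> unitary_group \<Longrightarrow>
        norm (f2 (h s ** g) - f2 g - of_real s * dir_sum X G2 g) \<le> C2 * s\<^sup>2"
      by (rule inv_gradientE[OF f(2) h]) (rule that)
    have "norm ((f1 (h s ** g) + f2 (h s ** g)) - (f1 g + f2 g) -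
      of_real s * dir_sum X (\<lambda>i j g. G1 i j g + G2 i j g) g) \<le> (C1 + C2) * s\<^sup>2"
      if "s \<in> {0..1}" "g \<in> unitary_group" for s g
    proof -
      have "(f1 (h s ** g) + f2 (h s ** g)) - (f1 g + f2 g) - of_real s * dir_sum X (\<lambda>i j g. G1 i j g + G2 i j g) g =
        (f1 (h s ** g) - f1 g - of_real s * dir_sum X G1 g) + (f2 (h s ** g) - f2 g - of_real s * dir_sum X G2 g)"
        by (simp add: dir_sum_def algebra_simps sum.distrib)
      also have "norm \<dots> \<le> C1 * s\<^sup>2 + C2 * s\<^sup>2"
        by (intro order_trans[OF norm_triangle_ineq] add_mono C1 C2 that)
      finally show ?thesis by (simp add: algebra_simps)
    qed
    then show ?thesis by blast
  qed
  then show ?thesis using f unfolding inv_gradient_def by (auto intro!: continuous_intros)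
qed

lemma inv_gradient_mult:
  assumes f: "inv_gradient f1 G1" "inv_gradient f2 G2"
  shows "inv_gradient (\<lambda>g. f1 g * f2 g) (\<lambda>i j g. G1 i j g * f2 g + f1 g * G2 i j g)"
proof -
  have c: "continuous_on UNIV f1" "continuous_on UNIV f2" "\<And>i j. continuous_on UNIV (G1 i j)" "\<And>i j. continuous_on UNIV (G2 i j)"
    using f by (auto simp: inv_gradient_def)
  have "\<exists>C. \<forall>s\<in>{0..1}. \<forall>g\<in>unitary_group. norm (f1 (h s ** g) * f2 (h s ** g) - f1 g * f2 g -
      of_real s * dir_sum X (\<lambda>i j g. G1 i j g * f2 g + f1 g * G2 i j g) g) \<le> C * s\<^sup>2"
    if h: "unitary_curve h X" for h X
  proof -
    obtain C1 where C1: "C1 \<ge> 0" "\<And>s g. s \<in> {0..1} \<Longrightarrow> g \<in> unitary_group \<Longrightarrow>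
        norm (f1 (h s ** g) - f1 g - of_real s * dir_sum X G1 g) \<le> C1 * s\<^sup>2"
      by (rule inv_gradientE[OF f(1) h]) (rule that)
    obtain C2 where C2: "C2 \<ge> 0" "\<And>s g. s \<in> {0..1} \<Longrightarrow> g \<in> unitary_group \<Longrightarrow>
        norm (f2 (h s ** g) - f2 g - of_real s * dir_sum X G2 g) \<le> C2 * s\<^sup>2"
      by (rule inv_gradientE[OF f(2) h]) (rule that)
    obtain K1 where K1: "K1 \<ge> 0" "\<And>g. g \<in> unitary_group \<Longrightarrow> norm (f1 g) \<le> K1"
      by (rule continuous_bounded_on_unitary[OF c(1)]) (rule that)
    obtain K2 where K2: "K2 \<ge> 0" "\<And>g. g \<in> unitary_group \<Longrightarrow> norm (f2 g) \<le> K2"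
      by (rule continuous_bounded_on_unitary[OF c(2)]) (rule that)
    obtain P where P: "P \<ge> 0" "\<And>g. g \<in> unitary_group \<Longrightarrow> norm (dir_sum X G1 g) \<le> P"
      by (rule continuous_bounded_on_unitary[OF continuous_on_dir_sum[OF c(3), where X = X]]) (rule that)
    obtain Q where Q: "Q \<ge> 0" "\<And>g. g \<in> unitary_group \<Longrightarrow> norm (dir_sum X G2 g) \<le> Q"
      by (rule continuous_bounded_on_unitary[OF continuous_on_dir_sum[OF c(4), where X = X]]) (rule that)
    have "norm (f1 (h s ** g) * f2 (h s ** g) - f1 g * f2 g -
      of_real s * dir_sum X (\<lambda>i j g. G1 i j g * f2 g + f1 g * G2 i j g) g) \<le> (C1 * K2 + P * Q + (K1 + P) * C2) * s\<^sup>2"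
      if s: "s \<in> {0..1}" and g: "g \<in> unitary_group" for s g
    proof -
      define p q where "p = dir_sum X G1 g" and "q = dir_sum X G2 g"
      define a b a' b' where "a = f1 g" and "b = f2 g" and "a' = f1 (h s ** g)" and "b' = f2 (h s ** g)"
      define S where "S = complex_of_real s"
      have hg: "h s ** g \<in> unitary_group" using h g by (auto simp: unitary_curve_def intro: unitary_mult)
      have nS: "norm S \<le> 1" "norm S ^ 2 = s\<^sup>2" using s by (auto simp: S_def)
      have "dir_sum X (\<lambda>i j g. G1 i j g * f2 g + f1 g * G2 i j g) g = p * b + a * q"
        unfolding p_def q_def a_def b_def dir_sum_def
        by (simp add: sum.distrib sum_distrib_left sum_distrib_right algebra_simps)
      \<comment> \<open>The error of the product is the error of the first factor times the new
        value of the second, a term of second order, and the linearized first factor times the error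
        of the second.\<close>
      then have "f1 (h s ** g) * f2 (h s ** g) - f1 g * f2 g -
         of_real s * dir_sum X (\<lambda>i j g. G1 i j g * f2 g + f1 g * G2 i j g) g =
         (a' - a - S * p) * b' + S\<^sup>2 * (p * q) + (a + S * p) * (b' - b - S * q)"
        unfolding a_def[symmetric] b_def[symmetric] a'_def[symmetric] b'_def[symmetric] S_def[symmetric]
        by (simp add: algebra_simps power2_eq_square)
      also have "norm \<dots> \<le> (C1 * s\<^sup>2) * K2 + s\<^sup>2 * (P * Q) + (K1 + 1 * P) * (C2 * s\<^sup>2)"
      proof (intro order_trans[OF norm_triangle_ineq] add_mono)
        show "norm ((a' - a - S * p) * b') \<le> (C1 * s\<^sup>2) * K2"
          unfolding norm_mult a'_def a_def S_def p_def b'_def using C1 K2 hg s g by (intro mult_mono) auto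
        show "norm (S\<^sup>2 * (p * q)) \<le> s\<^sup>2 * (P * Q)"
        proof -
          have "norm p * norm q \<le> P * Q" unfolding p_def q_def using P Q g by (intro mult_mono) auto
          then have "s\<^sup>2 * (norm p * norm q) \<le> s\<^sup>2 * (P * Q)" by (intro mult_left_mono) auto
          then show ?thesis by (simp only: norm_mult norm_power nS(2))
        qed
        have "norm (S * p) \<le> 1 * P"
          unfolding norm_mult p_def using P g nS by (intro mult_mono) auto
        then have "norm (a + S * p) \<le> K1 + 1 * P"
          unfolding a_def using K1 g by (intro order_trans[OF norm_triangle_ineq] add_mono) auto
        then show "norm ((a + S * p) * (b' - b - S * q)) \<le> (K1 + 1 * P) * (C2 * s\<^sup>2)"
          unfolding norm_mult b'_def b_def S_def q_def using K1 P C2 hg s g by (intro mult_mono) auto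
      qed
      finally show ?thesis by (simp add: algebra_simps)
    qed
    then show ?thesis by blast
  qed
  then show ?thesis using c unfolding inv_gradient_def by (auto intro!: continuous_intros)
qed

lemma inv_gradient_cong:
  assumes "inv_gradient f G" "\<And>g. f g = f' g" "\<And>i j g. G i j g = G' i j g"
  shows "inv_gradient f' G'"
proof -
  have "f = f'" "G = G'" using assms by (auto intro!: ext)
  then show ?thesis using assms by simp
qed

lemma inv_gradient_sum:
  assumes "finite S" "\<And>x. x \<in> S \<Longrightarrow> inv_gradient (f x) (G x)"
  shows "inv_gradient (\<lambda>g. \<Sum>x\<in>S. f x g) (\<lambda>i j g. \<Sum>x\<in>S. G x i j g)"
  using assms by (induction S) (auto intro: inv_gradient_const inv_gradient_add)

lemma inv_gradient_prod:
  assumes "finite S" "\<And>x. x \<in> S \<Longrightarrow> inv_gradient (f x) (G x)"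
  shows "inv_gradient (\<lambda>g. \<Prod>x\<in>S. f x g) (\<lambda>i j g. \<Sum>x\<in>S. G x i j g * (\<Prod>y\<in>S - {x}. f y g))"
  using assms
proof (induction S)
  case empty
  then show ?case using inv_gradient_const[of 1] by simp
next
  case (insert a S)
  have "inv_gradient (\<lambda>g. f a g * (\<Prod>x\<in>S. f x g))
    (\<lambda>i j g. G a i j g * (\<Prod>x\<in>S. f x g) + f a g * (\<Sum>x\<in>S. G x i j g * (\<Prod>y\<in>S - {x}. f y g)))"
    using insert by (intro inv_gradient_mult) auto
  then show ?case
  proof (rule inv_gradient_cong)
    fix i j g
    have "(\<Sum>x\<in>S. G x i j g * (\<Prod>y\<in>insert a S - {x}. f y g)) = (\<Sum>x\<in>S. f a g * (G x i j g * (\<Prod>y\<in>S - {x}. f y g)))"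
    proof (rule sum.cong [OF refl])
      fix x assume x: "x \<in> S"
      then have "insert a S - {x} = insert a (S - {x})" using insert by auto
      then show "G x i j g * (\<Prod>y\<in>insert a S - {x}. f y g) = f a g * (G x i j g * (\<Prod>y\<in>S - {x}. f y g))"
        using insert by simp
    qed
    moreover have "insert a S - {a} = S" using insert by auto
    ultimately show "G a i j g * (\<Prod>x\<in>S. f x g) + f a g * (\<Sum>x\<in>S. G x i j g * (\<Prod>y\<in>S - {x}. f y g)) =
      (\<Sum>x\<in>insert a S. G x i j g * (\<Prod>y\<in>insert a S - {x}. f y g))"
      using insert by (simp add: sum_distrib_left)
  qed (use insert in auto)
qed

text \<open>\<open>X\<close> is antihermitian: conjugating the combination of the
  \<open>G i j\<close> with coefficients \<open>X $ i $ j\<close> turns the coefficient into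
  \<open>- X $ j $ i\<close>, whence the interchanged indices and the sign.\<close>

lemma inv_gradient_cnj:
  assumes f: "inv_gradient f G"
  shows "inv_gradient (\<lambda>g. cnj (f g)) (\<lambda>i j g. - cnj (G j i g))"
proof -
  have "\<exists>C. \<forall>s\<in>{0..1}. \<forall>g\<in>unitary_group. norm (cnj (f (h s ** g)) - cnj (f g) -
      of_real s * dir_sum X (\<lambda>i j g. - cnj (G j i g)) g) \<le> C * s\<^sup>2"
    if h: "unitary_curve h X" for h X
  proof -
    obtain C where C: "C \<ge> 0" "\<And>s g. s \<in> {0..1} \<Longrightarrow> g \<in> unitary_group \<Longrightarrow>
        norm (f (h s ** g) - f g - of_real s * dir_sum X G g) \<le> C * s\<^sup>2"
      by (rule inv_gradientE[OF f h]) (rule that)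
    have X: "cnj (X $ j $ i) = - X $ i $ j" for i j
      using h unfolding unitary_curve_def by (metis minus_minus)
    have "dir_sum X (\<lambda>i j g. - cnj (G j i g)) g = cnj (dir_sum X G g)" for g
    proof -
      have "cnj (dir_sum X G g) = (\<Sum>i\<in>UNIV. \<Sum>j\<in>UNIV. cnj (X $ i $ j) * cnj (G i j g))"
        by (simp add: dir_sum_def)
      also have "\<dots> = (\<Sum>i\<in>UNIV. \<Sum>j\<in>UNIV. cnj (X $ j $ i) * cnj (G j i g))" by (rule sum.swap)
      also have "\<dots> = (\<Sum>i\<in>UNIV. \<Sum>j\<in>UNIV. X $ i $ j * - cnj (G j i g))"
        by (simp add: X)
      finally show ?thesis by (simp add: dir_sum_def)
    qed
    then have "norm (cnj (f (h s ** g)) - cnj (f g) - of_real s * dir_sum X (\<lambda>i j g. - cnj (G j i g)) g) =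
       norm (cnj (f (h s ** g) - f g - of_real s * dir_sum X G g))" for s g
      by simp
    then have "norm (cnj (f (h s ** g)) - cnj (f g) - of_real s * dir_sum X (\<lambda>i j g. - cnj (G j i g)) g) =
       norm (f (h s ** g) - f g - of_real s * dir_sum X G g)" for s g
      by (simp only: complex_mod_cnj)
    then show ?thesis using C(2) by (intro exI[of _ C]) auto
  qed
  then show ?thesis using f unfolding inv_gradient_def by (auto intro!: continuous_intros)
qed

section \<open>Invariance of the Haar integral and vanishing of integrated derivatives\<close>

context
  fixes M :: "(complex^'n^'n) measure"
  assumes haar: "normalized_haar_measure M"
begin

lemma haar_space: "space M = unitary_group"
  and haar_sets: "sets M = sets (restrict_space borel unitary_group)"
  and haar_total: "emeasure M (space M) = 1"
  and haar_translate: "h \<in> unitary_group \<Longrightarrow> S \<in> sets M \<Longrightarrow> emeasure M ((\<lambda>g. h ** g) ` S) = emeasure M S"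
  using haar by (auto simp: normalized_haar_measure_def)

lemma haar_finite_measure: "finite_measure M"
  by standard (simp add: haar_total)

lemma haar_measurable:
  fixes f :: "complex^'n^'n \<Rightarrow> complex"
  assumes "continuous_on UNIV f" shows "f \<in> borel_measurable M"
proof -
  have "f \<in> borel_measurable (restrict_space borel unitary_group)"
    using assms by (intro measurable_restrict_space1 borel_measurable_continuous_onI)
  then show ?thesis using measurable_cong_sets[OF haar_sets refl] by blast
qed

lemma haar_integrable:
  fixes f :: "complex^'n^'n \<Rightarrow> complex"
  assumes "continuous_on UNIV f" shows "integrable M f"
proof -
  obtain K where K: "K \<ge> 0" "\<And>g. g \<in> unitary_group \<Longrightarrow> norm (f g) \<le> K"
    by (rule continuous_bounded_on_unitary[OF assms]) (rule that)
  show ?thesis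
    by (rule finite_measure.integrable_const_bound[OF haar_finite_measure, where B = K])
      (auto simp: haar_space K haar_measurable assms)
qed

lemma haar_integral_norm_le:
  fixes f :: "complex^'n^'n \<Rightarrow> complex"
  assumes "continuous_on UNIV f" "\<And>g. g \<in> unitary_group \<Longrightarrow> norm (f g) \<le> K"
  shows "norm (LINT g|M. f g) \<le> K"
proof -
  have "norm (LINT g|M. f g) \<le> (LINT g|M. norm (f g))" by (rule integral_norm_bound)
  also have "\<dots> \<le> (LINT g|M. K)"
    using assms haar_finite_measure
    by (intro integral_mono integrable_norm haar_integrable finite_measure.integrable_const) (auto simp: haar_space)
  also have "\<dots> = K" using haar_total by (simp add: measure_def)
  finally show ?thesis .
qed

lemma continuous_on_matrix_mult_left:
  fixes h :: "complex^'n^'n"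
  shows "continuous_on UNIV (\<lambda>g :: complex^'n^'n. h ** g)"
  unfolding matrix_matrix_mult_def by (intro continuous_on_vec_lambda continuous_intros)

text \<open>Invariance is assumed for images of sets, whereas the distribution of a map is given by
  preimages; the preimage under multiplication by \<open>h\<close> is the image under multiplication
  by its adjoint.\<close>

lemma haar_integral_translate:
  fixes f :: "complex^'n^'n \<Rightarrow> complex"
  assumes f: "continuous_on UNIV f" and h: "h \<in> unitary_group"
  shows "(LINT g|M. f (h ** g)) = (LINT g|M. f g)"
proof -
  have meas: "(\<lambda>g. h ** g) \<in> measurable M M"
  proof -
    have "(\<lambda>g. h ** g) \<in> measurable (restrict_space borel unitary_group) (restrict_space borel unitary_group)"
      by (rule measurable_restrict_space3)
        (auto intro!: borel_measurable_continuous_onI continuous_on_matrix_mult_left unitary_mult h)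
    then show ?thesis using measurable_cong_sets[OF haar_sets haar_sets] by blast
  qed
  have "distr M M (\<lambda>g. h ** g) = M"
  proof (rule measure_eqI)
    fix S assume "S \<in> sets (distr M M (\<lambda>g. h ** g))"
    then have S: "S \<in> sets M" by simp
    have SU: "S \<subseteq> unitary_group" using sets.sets_into_space[OF S] by (simp add: haar_space)
    have "(\<lambda>g. h ** g) -` S \<inter> space M = (\<lambda>g. conj_transpose h ** g) ` S"
    proof (intro equalityI subsetI)
      fix g assume "g \<in> (\<lambda>g. h ** g) -` S \<inter> space M"
      moreover have "g = conj_transpose h ** (h ** g)" by (simp add: matrix_mul_assoc unitaryD[OF h])
      ultimately show "g \<in> (\<lambda>g. conj_transpose h ** g) ` S" by blast
    next
      fix g assume "g \<in> (\<lambda>g. conj_transpose h ** g) ` S"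
      then obtain g' where g': "g' \<in> S" "g = conj_transpose h ** g'" by auto
      have "h ** g = g'" unfolding g' by (simp add: matrix_mul_assoc unitaryD[OF h])
      moreover have "g \<in> unitary_group"
        unfolding g' using g' SU h by (intro unitary_mult unitary_conj_transpose) auto
      ultimately show "g \<in> (\<lambda>g. h ** g) -` S \<inter> space M" using g' by (simp add: haar_space)
    qed
    then show "emeasure (distr M M (\<lambda>g. h ** g)) S = emeasure M S"
      using S meas haar_translate[OF unitary_conj_transpose[OF h] S] by (simp add: emeasure_distr)
  qed simp
  then have "(LINT g|M. f g) = (LINT g|distr M M (\<lambda>g. h ** g). f g)" by simp
  also have "\<dots> = (LINT g|M. f (h ** g))"
    by (rule integral_distr[OF meas haar_measurable[OF f]])
  finally show ?thesis by simp
qed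

text \<open>By invariance the difference of \<open>f (h s ** g)\<close> and \<open>f g\<close> has
  integral 0, so \<open>s\<close> times the integral of the derivative is at most
  \<open>C s^2\<close> in absolute value. Divide by \<open>s\<close> and let it tend to 0.\<close>

lemma haar_integral_dir_sum:
  assumes f: "inv_gradient f G" and h: "unitary_curve h X"
  shows "(LINT g|M. dir_sum X G g) = 0"
proof -
  obtain C where C: "C \<ge> 0" "\<And>s g. s \<in> {0..1} \<Longrightarrow> g \<in> unitary_group \<Longrightarrow>
        norm (f (h s ** g) - f g - of_real s * dir_sum X G g) \<le> C * s\<^sup>2"
    by (rule inv_gradientE[OF f h]) (rule that)
  have cf: "continuous_on UNIV f" and cG: "\<And>i j. continuous_on UNIV (G i j)"
    using f by (auto simp: inv_gradient_def)
  have cD: "continuous_on UNIV (dir_sum X G)" by (rule continuous_on_dir_sum[OF cG])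
  let ?I = "LINT g|M. dir_sum X G g"
  have le: "norm ?I \<le> C * s" if s: "0 < s" "s \<le> 1" for s
  proof -
    have cfh: "continuous_on UNIV (\<lambda>g. f (h s ** g))"
      by (rule continuous_on_compose2[OF cf continuous_on_matrix_mult_left]) simp
    have "(LINT g|M. f (h s ** g) - f g - of_real s * dir_sum X G g) =
       (LINT g|M. f (h s ** g)) - (LINT g|M. f g) - of_real s * ?I"
      by (simp add: haar_integrable cfh cf cD integrable_mult_right)
    also have "(LINT g|M. f (h s ** g)) = (LINT g|M. f g)"
      using h by (intro haar_integral_translate cf) (simp add: unitary_curve_def)
    finally have "norm (of_real s * ?I) = norm (LINT g|M. f (h s ** g) - f g - of_real s * dir_sum X G g)" by simp
    also have "\<dots> \<le> C * s\<^sup>2"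
      by (intro haar_integral_norm_le continuous_intros cfh cf cD C) (use s in auto)
    finally have "s * norm ?I \<le> s * (C * s)" using s by (simp add: norm_mult power2_eq_square mult_ac)
    then show ?thesis using s by simp
  qed
  have "norm ?I \<le> 0"
  proof (rule field_le_epsilon)
    fix e :: real assume e: "e > 0"
    define s where "s = min 1 (e / (C + 1))"
    have s: "0 < s" "s \<le> 1" using C e by (auto simp: s_def)
    have "C * s \<le> C * (e / (C + 1))" using C by (intro mult_left_mono) (auto simp: s_def)
    also have "\<dots> \<le> e" using C e by (simp add: field_simps)
    finally show "norm ?I \<le> 0 + e" using le[OF s] by simp
  qed
  then show ?thesis by simp
qed

end

text \<open>
  If \<open>E\<close> is antihermitian and \<open>E\<^sup>3 = - E\<close>, then \<open>1 + \<sigma> E + (1 - c) E\<^sup>2\<close> with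
  \<open>c\<^sup>2 + \<sigma>\<^sup>2 = 1\<close> is unitary. The rational parametrization of the circle replaces \<open>cos\<close> and \<open>sin\<close>.
\<close>

lemma unitary_curve_exists:
  fixes E :: "complex^'n^'n"
  assumes anti: "\<And>i j. cnj (E $ i $ j) = - E $ j $ i" and cube: "E ** E ** E = - E"
  shows "\<exists>h. unitary_curve h (\<chi> i j. 2 * E $ i $ j)"
proof -
  define E2 where "E2 = E ** E"
  \<comment> \<open>\<open>\<sigma> s\<close> and \<open>1 - t s\<close> are sine and cosine of the
    angle \<open>2 arctan s\<close>. The slope of \<open>\<sigma>\<close> at 0 is 2, which is why
    the tangent of the curve is \<open>2 E\<close>.\<close>
  define \<sigma> t where "\<sigma> s = 2 * s / (1 + s\<^sup>2)" and "t s = 2 * s\<^sup>2 / (1 + s\<^sup>2)" for s :: real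
  define h :: "real \<Rightarrow> complex^'n^'n"
    where "h s = (\<chi> i j. mat 1 $ i $ j + of_real (\<sigma> s) * E $ i $ j + of_real (t s) * E2 $ i $ j)" for s
  have pos: "1 + s\<^sup>2 > 0" for s :: real by (simp add: add_pos_nonneg)
  \<comment> \<open>The equation \<open>c^2 + \<sigma>^2 = 1\<close> for
    \<open>c = 1 - t\<close>.\<close>
  have rel: "2 * t s - (\<sigma> s)\<^sup>2 - (t s)\<^sup>2 = 0" for s
  proof -
    have "2 * t s - (\<sigma> s)\<^sup>2 - (t s)\<^sup>2 = (4 * s\<^sup>2 * (1 + s\<^sup>2) - (2 * s)\<^sup>2 - (2 * s\<^sup>2)\<^sup>2) / (1 + s\<^sup>2)\<^sup>2"
      using pos[of s] unfolding \<sigma>_def t_def power_divide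
      by (simp add: diff_divide_distrib power2_eq_square)
    also have "4 * s\<^sup>2 * (1 + s\<^sup>2) - (2 * s)\<^sup>2 - (2 * s\<^sup>2)\<^sup>2 = 0" by (simp add: algebra_simps power2_eq_square)
    finally show ?thesis by simp
  qed
  have E2n: "(\<Sum>k\<in>UNIV. E $ i $ k * E $ k $ j) = E2 $ i $ j" for i j
    by (simp add: E2_def matrix_mult_nth)
  have E3: "E2 ** E = - E" using cube by (simp add: E2_def)
  have E3': "E ** E2 = - E" using cube by (simp add: E2_def matrix_mul_assoc)
  have E4: "E2 ** E2 = - E2"
  proof -
    have "E2 ** E2 = (E2 ** E) ** E" unfolding E2_def by (simp add: matrix_mul_assoc)
    also have "\<dots> = (- E) ** E" by (simp only: E3)
    also have "\<dots> = - E2" unfolding E2_def by (simp add: Finite_Cartesian_Product.vec_eq_iff matrix_mult_nth sum_negf)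
    finally show ?thesis .
  qed
  have E3n: "(\<Sum>k\<in>UNIV. E2 $ i $ k * E $ k $ j) = - E $ i $ j"
     "(\<Sum>k\<in>UNIV. E $ i $ k * E2 $ k $ j) = - E $ i $ j"
     "(\<Sum>k\<in>UNIV. E2 $ i $ k * E2 $ k $ j) = - E2 $ i $ j" for i j
    using E3 E3' E4 by (simp_all add: Finite_Cartesian_Product.vec_eq_iff matrix_mult_nth)
  have E2c: "cnj (E2 $ i $ j) = E2 $ j $ i" for i j
    unfolding E2n[symmetric] by (simp add: anti mult.commute)
  have d: "(\<Sum>k\<in>UNIV. mat 1 $ i $ k * A $ k $ j) = A $ i $ j" "(\<Sum>k\<in>UNIV. A $ i $ k * mat 1 $ k $ j) = A $ i $ j"
    for i j and A :: "complex^'n^'n"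
    by (simp_all add: matrix_mult_nth[symmetric])
  \<comment> \<open>Stated for both signs of \<open>\<sigma> s\<close>: one gives the product of
    \<open>h s\<close> with its adjoint, the other the product in the opposite order.\<close>
  have prod: "(\<Sum>k\<in>UNIV. (mat 1 $ i $ k + of_real a * E $ i $ k + of_real (t s) * E2 $ i $ k) *
      (mat 1 $ k $ j - of_real a * E $ k $ j + of_real (t s) * E2 $ k $ j)) = mat 1 $ i $ j"
    if a: "a\<^sup>2 = (\<sigma> s)\<^sup>2" for a s i j
  proof -
    have "(\<Sum>k\<in>UNIV. (mat 1 $ i $ k + of_real a * E $ i $ k + of_real (t s) * E2 $ i $ k) *
      (mat 1 $ k $ j - of_real a * E $ k $ j + of_real (t s) * E2 $ k $ j)) =
      (\<Sum>k\<in>UNIV. mat 1 $ i $ k * mat 1 $ k $ j - of_real a * (mat 1 $ i $ k * E $ k $ j) + of_real (t s) * (mat 1 $ i $ k * E2 $ k $ j)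
        + of_real a * (E $ i $ k * mat 1 $ k $ j) - of_real a * of_real a * (E $ i $ k * E $ k $ j) + of_real a * of_real (t s) * (E $ i $ k * E2 $ k $ j)
        + of_real (t s) * (E2 $ i $ k * mat 1 $ k $ j) - of_real (t s) * of_real a * (E2 $ i $ k * E $ k $ j)
        + of_real (t s) * of_real (t s) * (E2 $ i $ k * E2 $ k $ j))"
      by (intro sum.cong refl) (simp add: algebra_simps)
    also have "\<dots> = mat 1 $ i $ j - of_real a * E $ i $ j + of_real (t s) * E2 $ i $ j
        + of_real a * E $ i $ j - of_real a * of_real a * E2 $ i $ j + of_real a * of_real (t s) * (- E $ i $ j)
        + of_real (t s) * E2 $ i $ j - of_real (t s) * of_real a * (- E $ i $ j)
        + of_real (t s) * of_real (t s) * (- E2 $ i $ j)"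
      unfolding sum.distrib sum_subtractf sum_distrib_left[symmetric] d E2n E3n ..
    also have "\<dots> = mat 1 $ i $ j + of_real (2 * t s - a\<^sup>2 - (t s)\<^sup>2) * E2 $ i $ j"
      by (simp add: algebra_simps power2_eq_square)
    finally show ?thesis unfolding a rel by simp
  qed
  have hn: "h s $ i $ j = mat 1 $ i $ j + of_real (\<sigma> s) * E $ i $ j + of_real (t s) * E2 $ i $ j" for s i j
    by (simp add: h_def)
  have hc: "conj_transpose (h s) $ i $ j = mat 1 $ i $ j - of_real (\<sigma> s) * E $ i $ j + of_real (t s) * E2 $ i $ j" for s i j
    unfolding conj_transpose_nth hn by (simp add: anti E2c mat_1_nth)
  have U: "h s \<in> unitary_group" for s
  proof -
    have "h s ** conj_transpose (h s) = mat 1"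
      unfolding Finite_Cartesian_Product.vec_eq_iff matrix_mult_nth hn hc using prod[of "\<sigma> s" s] by simp
    moreover have "conj_transpose (h s) ** h s = mat 1"
      unfolding Finite_Cartesian_Product.vec_eq_iff matrix_mult_nth hn hc using prod[of "- \<sigma> s" s] by simp
    ultimately show ?thesis by (simp add: unitary_group_def)
  qed
  have B: "norm (h s $ i $ j - mat 1 $ i $ j - of_real s * (\<chi> i j. 2 * E $ i $ j) $ i $ j) \<le>
      (2 * (\<Sum>i\<in>UNIV. \<Sum>j\<in>UNIV. norm (E $ i $ j) + norm (E2 $ i $ j))) * s\<^sup>2" if s: "s \<in> {0..1}" for s i j
  proof -
    have s3: "\<bar>\<sigma> s - 2 * s\<bar> \<le> 2 * s\<^sup>2"
    proof -
      have "\<sigma> s - 2 * s = - (2 * s * s\<^sup>2 / (1 + s\<^sup>2))"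
        using pos[of s] by (simp add: \<sigma>_def field_simps power2_eq_square)
      moreover have "2 * s * s\<^sup>2 / (1 + s\<^sup>2) \<le> 2 * s\<^sup>2"
      proof -
        have "2 * s * s\<^sup>2 \<le> 2 * s\<^sup>2 * 1" using s mult_right_mono[of s 1 "2 * s\<^sup>2"] by (simp add: mult_ac)
        also have "\<dots> \<le> 2 * s\<^sup>2 * (1 + s\<^sup>2)" by (intro mult_left_mono) auto
        finally show ?thesis using pos[of s] by (simp add: divide_le_eq)
      qed
      moreover have "2 * s * s\<^sup>2 / (1 + s\<^sup>2) \<ge> 0" using s pos[of s] by simp
      ultimately show ?thesis by simp
    qed
    have t2: "\<bar>t s\<bar> \<le> 2 * s\<^sup>2"
    proof -
      have "2 * s\<^sup>2 * 1 \<le> 2 * s\<^sup>2 * (1 + s\<^sup>2)" by (intro mult_left_mono) auto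
      then have "t s \<le> 2 * s\<^sup>2" using pos[of s] by (simp add: t_def divide_le_eq)
      moreover have "t s \<ge> 0" by (simp add: t_def)
      ultimately show ?thesis by simp
    qed
    have "h s $ i $ j - mat 1 $ i $ j - of_real s * (\<chi> i j. 2 * E $ i $ j) $ i $ j =
      of_real (\<sigma> s - 2 * s) * E $ i $ j + of_real (t s) * E2 $ i $ j"
      by (simp add: hn algebra_simps)
    also have "norm \<dots> \<le> (2 * s\<^sup>2) * norm (E $ i $ j) + (2 * s\<^sup>2) * norm (E2 $ i $ j)"
      using s3 t2 by (intro order_trans[OF norm_triangle_ineq] add_mono) (auto simp: norm_mult intro!: mult_right_mono simp del: of_real_diff)
    also have "\<dots> = (2 * (norm (E $ i $ j) + norm (E2 $ i $ j))) * s\<^sup>2" by (simp add: algebra_simps)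
    also have "\<dots> \<le> (2 * (\<Sum>i\<in>UNIV. \<Sum>j\<in>UNIV. norm (E $ i $ j) + norm (E2 $ i $ j))) * s\<^sup>2"
    proof (intro mult_right_mono mult_left_mono)
      have "norm (E $ i $ j) + norm (E2 $ i $ j) \<le> (\<Sum>j\<in>UNIV. norm (E $ i $ j) + norm (E2 $ i $ j))"
        by (rule member_le_sum) auto
      also have "\<dots> \<le> (\<Sum>i\<in>UNIV. \<Sum>j\<in>UNIV. norm (E $ i $ j) + norm (E2 $ i $ j))"
        by (rule member_le_sum[where f = "\<lambda>i. \<Sum>j\<in>UNIV. norm (E $ i $ j) + norm (E2 $ i $ j)"]) (auto intro!: sum_nonneg add_nonneg_nonneg simp del: sum.distrib)
      finally show "norm (E $ i $ j) + norm (E2 $ i $ j) \<le> (\<Sum>i\<in>UNIV. \<Sum>j\<in>UNIV. norm (E $ i $ j) + norm (E2 $ i $ j))" .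
    qed auto
    finally show ?thesis .
  qed
  have "unitary_curve h (\<chi> i j. 2 * E $ i $ j)"
    unfolding unitary_curve_def using U B anti by (intro conjI allI exI ballI) auto
  then show ?thesis by blast
qed

text \<open>Write \<open>E_jk\<close> for the matrix units. The antihermitian matrices
  \<open>\<i> E_jj\<close>, \<open>E_jk - E_kj\<close> and \<open>\<i> (E_jk + E_kj)\<close> satisfy
  the cubic equation and are tangent to curves. Over the complex numbers they span all matrices, so
  every single component of the gradient has integral 0.\<close>

theorem haar_integral_gradient:
  fixes M :: "(complex^'n^'n) measure"
  assumes haar: "normalized_haar_measure M" and f: "inv_gradient f G"
  shows "(LINT g|M. G i j g) = 0"
proof -
  define I where "I i j = (LINT g|M. G i j g)" for i j
  have cG: "\<And>i j. continuous_on UNIV (G i j)" using f by (auto simp: inv_gradient_def)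
  have zero: "(\<Sum>i\<in>UNIV. \<Sum>j\<in>UNIV. E $ i $ j * I i j) = 0"
    if E: "\<And>i j. cnj (E $ i $ j) = - E $ j $ i" "E ** E ** E = - E" for E
  proof -
    obtain h where h: "unitary_curve h (\<chi> i j. 2 * E $ i $ j)" using unitary_curve_exists[OF E] by blast
    have "0 = (LINT g|M. dir_sum (\<chi> i j. 2 * E $ i $ j) G g)"
      by (rule haar_integral_dir_sum[OF haar f h, symmetric])
    also have "\<dots> = (\<Sum>i\<in>UNIV. \<Sum>j\<in>UNIV. 2 * E $ i $ j * I i j)"
      unfolding dir_sum_def I_def
      by (subst Bochner_Integration.integral_sum; (subst Bochner_Integration.integral_sum)?)
        (auto intro!: Bochner_Integration.integrable_sum integrable_mult_right haar_integrable[OF haar] continuous_intros cG)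
    also have "\<dots> = 2 * (\<Sum>i\<in>UNIV. \<Sum>j\<in>UNIV. E $ i $ j * I i j)"
      by (simp add: sum_distrib_left mult.assoc)
    finally show ?thesis by simp
  qed
  have diag: "I i i = 0" for i
  proof -
    define E :: "complex^'n^'n" where "E = (\<chi> a b. if a = i \<and> b = i then \<i> else 0)"
    have E: "E $ a $ b = (if a = i then if b = i then \<i> else 0 else 0)" for a b by (simp add: E_def)
    have "(E ** E) $ a $ b = (if a = i then if b = i then -1 else 0 else 0)" for a b
      unfolding matrix_mult_nth E by (simp add: if_distrib[of "\<lambda>x. x * _"] if_distrib[of "\<lambda>x. _ * x"] cong: if_cong)
    then have "(E ** E ** E) $ a $ b = - E $ a $ b" for a b
      unfolding matrix_mult_nth[of "E ** E"] E by (simp add: if_distrib[of "\<lambda>x. x * _"] if_distrib[of "\<lambda>x. _ * x"] cong: if_cong)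
    then have "E ** E ** E = - E" by (simp add: Finite_Cartesian_Product.vec_eq_iff)
    moreover have "cnj (E $ a $ b) = - E $ b $ a" for a b by (simp add: E)
    ultimately have "(\<Sum>a\<in>UNIV. \<Sum>b\<in>UNIV. E $ a $ b * I a b) = 0" by (intro zero)
    also have "(\<Sum>a\<in>UNIV. \<Sum>b\<in>UNIV. E $ a $ b * I a b) = (\<Sum>a\<in>UNIV. if a = i then \<i> * I i i else 0)"
    proof (rule sum.cong [OF refl])
      fix a
      have "(\<Sum>b\<in>UNIV. E $ a $ b * I a b) = (\<Sum>b\<in>UNIV. if b = i then if a = i then \<i> * I i i else 0 else 0)"
        by (intro sum.cong refl) (auto simp: E)
      then show "(\<Sum>b\<in>UNIV. E $ a $ b * I a b) = (if a = i then \<i> * I i i else 0)" by simp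
    qed
    finally show ?thesis by simp
  qed
  have off: "\<omega> * I j k - cnj \<omega> * I k j = 0" if jk: "j \<noteq> k" and \<omega>: "\<omega> * cnj \<omega> = 1" for j k \<omega>
  proof -
    define E :: "complex^'n^'n" where "E = (\<chi> a b. if a = j \<and> b = k then \<omega> else if a = k \<and> b = j then - cnj \<omega> else 0)"
    have E: "E $ a $ b = (if a = j \<and> b = k then \<omega> else if a = k \<and> b = j then - cnj \<omega> else 0)" for a b
      by (simp add: E_def)
    have row: "(E ** A) $ a $ b = (if a = j then \<omega> * A $ k $ b else if a = k then - cnj \<omega> * A $ j $ b else 0)"
      for A a b
    proof -
      have "(E ** A) $ a $ b = (\<Sum>e\<in>UNIV. (if e = k then if a = j then \<omega> * A $ k $ b else 0 else 0) +
          (if e = j then if a = k then - cnj \<omega> * A $ j $ b else 0 else 0))"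
        unfolding matrix_mult_nth E using jk by (intro sum.cong refl) auto
      then show ?thesis using jk by (simp add: sum.distrib)
    qed
    have "(E ** (E ** E)) $ a $ b = - E $ a $ b" for a b
      unfolding row E using jk \<omega> by (auto simp: mult_ac)
    then have "E ** E ** E = - E" by (simp add: Finite_Cartesian_Product.vec_eq_iff matrix_mul_assoc)
    moreover have "cnj (E $ a $ b) = - E $ b $ a" for a b using jk by (auto simp: E)
    ultimately have "(\<Sum>a\<in>UNIV. \<Sum>b\<in>UNIV. E $ a $ b * I a b) = 0" by (intro zero)
    also have "(\<Sum>a\<in>UNIV. \<Sum>b\<in>UNIV. E $ a $ b * I a b) =
      (\<Sum>a\<in>UNIV. (if a = j then \<omega> * I j k else 0) + (if a = k then - cnj \<omega> * I k j else 0))"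
    proof (rule sum.cong [OF refl])
      fix a
      have "(\<Sum>b\<in>UNIV. E $ a $ b * I a b) = (\<Sum>b\<in>UNIV. (if b = k then if a = j then \<omega> * I j k else 0 else 0) +
          (if b = j then if a = k then - cnj \<omega> * I k j else 0 else 0))"
        unfolding E using jk by (intro sum.cong refl) auto
      then show "(\<Sum>b\<in>UNIV. E $ a $ b * I a b) = (if a = j then \<omega> * I j k else 0) + (if a = k then - cnj \<omega> * I k j else 0)"
        by (simp add: sum.distrib)
    qed
    finally show ?thesis by (simp add: sum.distrib)
  qed
  have "I i j = 0"
  proof (cases "i = j")
    case False
    have "I i j - I j i = 0" using off[OF False, of 1] by simp
    moreover have "\<i> * (I i j + I j i) = 0" using off[OF False, of \<i>] by (simp add: algebra_simps)
    ultimately show ?thesis by simp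
  qed (simp add: diag)
  then show ?thesis by (simp add: I_def)
qed

section \<open>Eigenvalues\<close>

text \<open>An enumeration of the index type. It carries matrices over types to numbered matrices,
  for which characteristic polynomials and triangularization are available.\<close>

definition idx :: "nat \<Rightarrow> 'n :: finite"
  where "idx = (SOME b. bij_betw b {..<CARD('n)} UNIV)"

lemma idx_bij: "bij_betw (idx :: nat \<Rightarrow> 'n :: finite) {..<CARD('n)} UNIV"
proof -
  have "\<exists>b :: nat \<Rightarrow> 'n. bij_betw b {..<CARD('n)} UNIV"
    using ex_bij_betw_nat_finite[of "UNIV :: 'n set"] by (simp add: lessThan_atLeast0)
  then show ?thesis unfolding idx_def by (rule someI_ex)
qed

definition to_jnf :: "'a^'n^'n \<Rightarrow> 'a Matrix.mat"
  where "to_jnf g = Matrix.mat CARD('n) CARD('n) (\<lambda>(i, j). g $ idx i $ idx j)"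

lemma to_jnf_carrier: "to_jnf (g :: 'a^'n^'n) \<in> carrier_mat CARD('n) CARD('n)"
  by (simp add: to_jnf_def)

lemma sum_idx: "(\<Sum>k\<in>(UNIV :: 'n :: finite set). f k) = (\<Sum>k<CARD('n). f (idx k))"
  by (rule sum.reindex_bij_betw[OF idx_bij, symmetric])

lemma prod_idx: "(\<Prod>k\<in>(UNIV :: 'n :: finite set). f k) = (\<Prod>k<CARD('n). f (idx k))"
  by (rule prod.reindex_bij_betw[OF idx_bij, symmetric])

lemma to_jnf_mult: "to_jnf (A ** B) = to_jnf A * to_jnf (B :: 'a :: semiring_1^'n^'n)"
  by (intro eq_matI) (auto simp: to_jnf_def matrix_matrix_mult_def scalar_prod_def sum_idx lessThan_atLeast0)

text \<open>Both determinants are Leibniz sums, and transporting a permutation along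
  \<open>idx\<close> preserves its sign.\<close>

lemma det_to_jnf:
  fixes A :: "'a :: comm_ring_1^'n^'n"
  shows "det A = Determinant.det (to_jnf A)"
proof -
  let ?m = "map_permutation {..<CARD('n)} (idx :: nat \<Rightarrow> 'n)"
  have inj: "inj_on (idx :: nat \<Rightarrow> 'n) {..<CARD('n)}" using idx_bij by (auto simp: bij_betw_def)
  have m: "?m q (idx k) = idx (q k)" if "k < CARD('n)" for q k
    using that by (intro map_permutation_apply inj) auto
  have injm: "inj_on ?m {q. q permutes {..<CARD('n)}}"
  proof (rule inj_onI, clarify)
    fix q q' assume q: "q permutes {..<CARD('n)}" "q' permutes {..<CARD('n)}" "?m q = ?m q'"
    show "q = q'"
    proof
      fix k show "q k = q' k"
      proof (cases "k < CARD('n)")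
        case True
        then have "idx (q k) = (idx (q' k) :: 'n)" using m[OF True] q(3) by metis
        moreover have "q k < CARD('n)" "q' k < CARD('n)"
          using True permutes_in_image[OF q(1), of k] permutes_in_image[OF q(2), of k] by auto
        ultimately show ?thesis using inj by (auto simp: inj_on_def)
      next
        case False
        then show ?thesis using q by (metis lessThan_iff permutes_not_in)
      qed
    qed
  qed
  have "?m ` {q. q permutes {..<CARD('n)}} = {p. p permutes (UNIV :: 'n set)}"
  proof (rule card_subset_eq)
    show "?m ` {q. q permutes {..<CARD('n)}} \<subseteq> {p. p permutes (UNIV :: 'n set)}"
      using map_permutation_permutes[OF idx_bij] by auto
    show "card (?m ` {q. q permutes {..<CARD('n)}}) = card {p. p permutes (UNIV :: 'n set)}"
      by (simp add: card_image[OF injm] card_permutations)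
  qed (simp add: finite_permutations)
  with injm have bij: "bij_betw ?m {q. q permutes {..<CARD('n)}} {p. p permutes (UNIV :: 'n set)}"
    by (simp add: bij_betw_def)
  have "det A = (\<Sum>q | q permutes {..<CARD('n)}. of_int (sign (?m q)) * (\<Prod>i\<in>UNIV. A $ i $ ?m q i))"
    unfolding Determinants.det_def by (rule sum.reindex_bij_betw[OF bij, symmetric])
  also have "\<dots> = (\<Sum>q | q permutes {..<CARD('n)}. of_int (sign q) * (\<Prod>i<CARD('n). A $ idx i $ idx (q i)))"
    by (rule sum.cong [OF refl]) (auto simp: sign_map_permutation[OF inj] prod_idx m)
  finally show ?thesis unfolding to_jnf_def det_mat_leibniz .
qed

lemma char_poly_to_jnf:
  fixes g :: "complex^'n^'n"
  shows "det (\<chi> i j. (if i = j then [:0, 1:] else 0) - [:g $ i $ j:]) = char_poly (to_jnf g)"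
proof -
  have "to_jnf (\<chi> i j. (if i = j then [:0, 1:] else 0) - [:g $ i $ j:]) = char_poly_matrix (to_jnf g)"
    using idx_bij[where 'n = 'n]
    by (intro eq_matI) (auto simp: to_jnf_def char_poly_matrix_def bij_betw_def inj_on_def)
  then show ?thesis by (simp add: det_to_jnf char_poly_def)
qed

primrec matpow :: "'a :: semiring_1^'n^'n \<Rightarrow> nat \<Rightarrow> 'a^'n^'n"
  where "matpow g 0 = mat 1" | "matpow g (Suc k) = matpow g k ** g"

lemma to_jnf_matpow: "to_jnf (matpow g k) = to_jnf (g :: 'a :: semiring_1^'n^'n) ^\<^sub>m k"
proof (induction k)
  case 0
  show ?case
    using idx_bij[where 'n = 'n]
    by (intro eq_matI) (auto simp: to_jnf_def Finite_Cartesian_Product.mat_def bij_betw_def inj_on_def)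
next
  case (Suc k)
  then show ?case using Suc by (simp add: to_jnf_mult)
qed

lemma trace_to_jnf: "trace g = (\<Sum>i<CARD('n). to_jnf (g :: 'a :: semiring_1^'n^'n) $$ (i, i))"
  unfolding trace_def sum_idx by (simp add: to_jnf_def)

lemma upper_triangular_pow_diag:
  fixes B :: "'a :: comm_ring_1 Matrix.mat"
  assumes B: "B \<in> carrier_mat n n" "upper_triangular B"
  shows "B ^\<^sub>m k \<in> carrier_mat n n \<and> (\<forall>i<n. \<forall>j<i. (B ^\<^sub>m k) $$ (i, j) = 0) \<and> (\<forall>i<n. (B ^\<^sub>m k) $$ (i, i) = B $$ (i, i) ^ k)"
proof (induction k)
  case 0
  then show ?case using B by auto
next
  case (Suc k)
  let ?C = "B ^\<^sub>m k"
  have C: "?C \<in> carrier_mat n n" "\<And>i j. i < n \<Longrightarrow> j < i \<Longrightarrow> ?C $$ (i, j) = 0" "\<And>i. i < n \<Longrightarrow> ?C $$ (i, i) = B $$ (i, i) ^ k"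
    using Suc by auto
  have B0: "\<And>i j. i < n \<Longrightarrow> j < i \<Longrightarrow> B $$ (i, j) = 0" using B by (auto simp: upper_triangular_def)
  have e: "(?C * B) $$ (i, j) = (\<Sum>e<n. ?C $$ (i, e) * B $$ (e, j))" if "i < n" "j < n" for i j
    using that C(1) B(1) by (auto simp: scalar_prod_def lessThan_atLeast0 intro!: sum.cong)
  have "(?C * B) $$ (i, j) = 0" if ij: "i < n" "j < i" for i j
  proof -
    have "?C $$ (i, e) * B $$ (e, j) = 0" if "e < n" for e
      using C(2)[of i e] B0[of e j] ij that by (cases "e < i") auto
    then show ?thesis using e[of i j] ij by simp
  qed
  moreover have "(?C * B) $$ (i, i) = B $$ (i, i) ^ Suc k" if i: "i < n" for i
  proof -
    have "(\<Sum>e<n. ?C $$ (i, e) * B $$ (e, i)) = (\<Sum>e<n. if e = i then ?C $$ (i, i) * B $$ (i, i) else 0)"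
    proof (rule sum.cong [OF refl])
      fix x assume "x \<in> {..<n}"
      then show "?C $$ (i, x) * B $$ (x, i) = (if x = i then ?C $$ (i, i) * B $$ (i, i) else 0)"
        using C(2)[of i x] B0[of x i] i by (cases x i rule: linorder_cases) auto
    qed
    then show ?thesis using e[of i i] i C(3) by (simp add: mult.commute)
  qed
  ultimately show ?case using B C by auto
qed

lemma mat_trace_comm:
  fixes P C :: "'a :: comm_ring_1 Matrix.mat"
  assumes "P \<in> carrier_mat n n" "C \<in> carrier_mat n n"
  shows "(\<Sum>i<n. (P * C) $$ (i, i)) = (\<Sum>i<n. (C * P) $$ (i, i))"
proof -
  have "(\<Sum>i<n. (P * C) $$ (i, i)) = (\<Sum>i<n. \<Sum>j<n. P $$ (i, j) * C $$ (j, i))"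
    using assms by (intro sum.cong) (auto simp: scalar_prod_def lessThan_atLeast0)
  also have "\<dots> = (\<Sum>j<n. \<Sum>i<n. P $$ (i, j) * C $$ (j, i))" by (rule sum.swap)
  also have "\<dots> = (\<Sum>i<n. (C * P) $$ (i, i))"
    using assms by (intro sum.cong) (auto simp: scalar_prod_def lessThan_atLeast0 mult.commute)
  finally show ?thesis .
qed

lemma eigenvalues_mset_char_poly: "eigenvalues_mset g = proots (char_poly (to_jnf g))"
  unfolding eigenvalues_mset_def char_poly_to_jnf ..

lemma proots_linear_factors: "proots (\<Prod>a\<leftarrow>as. [:- a, 1:]) = mset (as :: complex list)"
proof (induction as)
  case (Cons a as)
  have "(\<Prod>a\<leftarrow>as. [:- a, 1:]) \<noteq> 0" by (auto simp: prod_list_zero_iff)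
  then show ?case using Cons by (simp add: proots_mult del: mult_pCons_left)
qed simp

context
  fixes g :: "complex^'n^'n" and ts :: "complex list"
  assumes ts: "mset ts = eigenvalues_mset g"
begin

lemma char_poly_eigenvalues: "char_poly (to_jnf g) = (\<Prod>a\<leftarrow>ts. [:- a, 1:])"
  and length_eigenvalues: "length ts = CARD('n)"
proof -
  obtain as where as: "char_poly (to_jnf g) = (\<Prod>a\<leftarrow>as. [:- a, 1:])" "length as = CARD('n)"
    using char_poly_factorized[OF to_jnf_carrier] by metis
  have m: "mset as = mset ts" using ts as by (simp add: eigenvalues_mset_char_poly proots_linear_factors)
  then show "length ts = CARD('n)" using as by (metis size_mset)
  have "(\<Prod>a\<leftarrow>as. [:- a, 1:]) = (\<Prod>a\<leftarrow>ts. [:- a, 1:])"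
    using arg_cong[OF m, of "\<lambda>M. prod_mset (image_mset (\<lambda>a. [:- a, 1:]) M)"]
    by (simp add: prod_mset_prod_list[symmetric])
  with as show "char_poly (to_jnf g) = (\<Prod>a\<leftarrow>ts. [:- a, 1:])" by simp
qed

text \<open>The matrix is similar to a triangular one whose diagonal lists the eigenvalues; powers
  preserve this form and the trace is invariant under similarity. Power sums of the eigenvalues thus
  become polynomials in the entries, to which the rules for gradients apply.\<close>

lemma trace_matpow_eigenvalues: "trace (matpow g k) = (\<Sum>i<CARD('n). ts ! i ^ k)"
proof -
  let ?n = "CARD('n)" and ?A = "to_jnf g"
  obtain B where B: "B \<in> carrier_mat ?n ?n" "upper_triangular B" "similar_mat ?A B"
    using schur_decomposition_exists[OF to_jnf_carrier char_poly_eigenvalues] by blast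
  obtain P Q where w: "similar_mat_wit ?A B P Q" using B(3) by (auto simp: similar_mat_def)
  have PQ: "P \<in> carrier_mat ?n ?n" "Q \<in> carrier_mat ?n ?n" "Q * P = 1\<^sub>m ?n"
    using w to_jnf_carrier[of g] unfolding similar_mat_wit_def Let_def by auto
  note Bk = upper_triangular_pow_diag[OF B(1,2), of k]
  have "mset (diag_mat B) = mset ts"
  proof -
    have "char_poly ?A = (\<Prod>a\<leftarrow>diag_mat B. [:- a, 1:])"
      using char_poly_similar[OF B(3)] char_poly_upper_triangular[OF B(1,2)] by simp
    then show ?thesis using ts by (simp add: eigenvalues_mset_char_poly proots_linear_factors)
  qed
  then have "sum_mset (image_mset (\<lambda>a. a ^ k) (mset (diag_mat B))) = sum_mset (image_mset (\<lambda>a. a ^ k) (mset ts))"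
    by simp
  then have d: "(\<Sum>a\<leftarrow>diag_mat B. a ^ k) = (\<Sum>a\<leftarrow>ts. a ^ k)"
    by (simp add: sum_mset_sum_list[symmetric])
  have "trace (matpow g k) = (\<Sum>i<?n. (P * B ^\<^sub>m k * Q) $$ (i, i))"
    unfolding trace_to_jnf to_jnf_matpow similar_mat_wit_pow_id[OF w] ..
  also have "\<dots> = (\<Sum>i<?n. (Q * (P * B ^\<^sub>m k)) $$ (i, i))"
    using PQ Bk by (intro mat_trace_comm) auto
  also have "Q * (P * B ^\<^sub>m k) = B ^\<^sub>m k"
    using PQ Bk assoc_mult_mat[of Q ?n ?n P ?n "B ^\<^sub>m k" ?n] left_mult_one_mat[of "B ^\<^sub>m k" ?n ?n] by simp
  also have "(\<Sum>i<?n. (B ^\<^sub>m k) $$ (i, i)) = (\<Sum>i<?n. B $$ (i, i) ^ k)" using Bk by simp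
  also have "\<dots> = (\<Sum>a\<leftarrow>diag_mat B. a ^ k)"
    using B(1) by (simp add: diag_mat_def comp_def lessThan_atLeast0 interv_sum_list_conv_sum_set_nat)
  also have "\<dots> = (\<Sum>i<?n. ts ! i ^ k)"
    unfolding d using length_eigenvalues by (simp add: sum_list_sum_nth lessThan_atLeast0)
  finally show ?thesis .
qed

lemma det_eigenvalues: "det (\<chi> i j. (if i = j then x else 0) - g $ i $ j) = (\<Prod>i<CARD('n). x - ts ! i)"
proof -
  have "poly (char_poly (to_jnf g)) x = Determinant.det (to_jnf (\<chi> i j. (if i = j then x else 0) - g $ i $ j))"
    unfolding char_poly_def
  proof (rule poly_det_cong[OF to_jnf_carrier])
    show "char_poly_matrix (to_jnf g) \<in> carrier_mat CARD('n) CARD('n)"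
      by (rule char_poly_matrix_closed[OF to_jnf_carrier])
  qed (use idx_bij[where 'n = 'n] in \<open>auto simp: to_jnf_def char_poly_matrix_def bij_betw_def inj_on_def\<close>)
  then have "det (\<chi> i j. (if i = j then x else 0) - g $ i $ j) = poly (char_poly (to_jnf g)) x"
    by (simp add: det_to_jnf)
  also have "\<dots> = (\<Prod>a\<leftarrow>ts. x - a)"
    unfolding char_poly_eigenvalues by (simp add: poly_prod_list comp_def)
  also have "\<dots> = (\<Prod>i<CARD('n). x - ts ! i)"
    using length_eigenvalues by (simp add: prod.list_conv_set_nth lessThan_atLeast0)
  finally show ?thesis .
qed

end

section \<open>The Casimir operator on class functions\<close>

lemma matpow_add: "matpow g (a + b) = matpow g a ** matpow g b"
  by (induction b) (simp_all add: matrix_mul_assoc)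

text \<open>In the product of \<open>k\<close> copies of \<open>g\<close> one copy is replaced by
  \<open>E_ij g\<close>, where \<open>E_ij\<close> is the matrix unit. If \<open>b\<close> copies
  precede it, the result is \<open>g^b E_ij g^(k-b)\<close>.\<close>

lemma inv_gradient_matpow:
  fixes a c :: "'n :: finite"
  shows "inv_gradient (\<lambda>g :: complex^'n^'n. matpow g k $ a $ c)
     (\<lambda>i j g. \<Sum>b<k. matpow g b $ a $ i * matpow g (k - b) $ j $ c)"
proof (induction k arbitrary: c)
  case 0
  then show ?case using inv_gradient_const by simp
next
  case (Suc k)
  have "inv_gradient (\<lambda>g :: complex^'n^'n. \<Sum>e\<in>UNIV. matpow g k $ a $ e * g $ e $ c)
     (\<lambda>i j g. \<Sum>e\<in>UNIV. (\<Sum>b<k. matpow g b $ a $ i * matpow g (k - b) $ j $ e) * g $ e $ c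
         + matpow g k $ a $ e * (if i = e then g $ j $ c else 0))"
    by (intro inv_gradient_sum inv_gradient_mult Suc inv_gradient_entry) simp
  then show ?case
  proof (rule inv_gradient_cong)
    fix g :: "complex^'n^'n" and i j
    have "(\<Sum>e\<in>UNIV. matpow g k $ a $ e * (if i = e then g $ j $ c else 0)) = matpow g k $ a $ i * g $ j $ c"
      by (simp add: if_distrib[of "\<lambda>x. _ * x"] cong: if_cong)
    moreover have "(\<Sum>e\<in>UNIV. (\<Sum>b<k. matpow g b $ a $ i * matpow g (k - b) $ j $ e) * g $ e $ c) =
       (\<Sum>b<k. matpow g b $ a $ i * (matpow g (k - b) ** g) $ j $ c)"
      unfolding matrix_mult_nth sum_distrib_left sum_distrib_right by (subst sum.swap) (simp add: mult.assoc)
    moreover have "(\<Sum>b<k. matpow g b $ a $ i * (matpow g (k - b) ** g) $ j $ c) =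
       (\<Sum>b<k. matpow g b $ a $ i * matpow g (Suc k - b) $ j $ c)"
      by (intro sum.cong refl) (auto simp: Suc_diff_le)
    ultimately show "(\<Sum>e\<in>UNIV. (\<Sum>b<k. matpow g b $ a $ i * matpow g (k - b) $ j $ e) * g $ e $ c
         + matpow g k $ a $ e * (if i = e then g $ j $ c else 0)) =
       (\<Sum>b<Suc k. matpow g b $ a $ i * matpow g (Suc k - b) $ j $ c)"
      by (simp add: sum.distrib)
  qed (simp add: matrix_mult_nth)
qed

text \<open>By cyclicity of the trace each of the \<open>k\<close> positions of the replaced factor
  contributes the same entry of \<open>g^k\<close>.\<close>

lemma inv_gradient_trace_matpow:
  "inv_gradient (\<lambda>g :: complex^'n^'n. trace (matpow g k)) (\<lambda>i j g. matpow g k $ j $ i * of_nat k)"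
proof -
  have "inv_gradient (\<lambda>g :: complex^'n^'n. \<Sum>a\<in>UNIV. matpow g k $ a $ a)
     (\<lambda>i j g. \<Sum>a\<in>UNIV. \<Sum>b<k. matpow g b $ a $ i * matpow g (k - b) $ j $ a)"
    by (intro inv_gradient_sum inv_gradient_matpow) simp
  then show ?thesis
  proof (rule inv_gradient_cong)
    fix g :: "complex^'n^'n" and i j
    have "(\<Sum>a\<in>UNIV. \<Sum>b<k. matpow g b $ a $ i * matpow g (k - b) $ j $ a) =
       (\<Sum>b<k. (matpow g (k - b) ** matpow g b) $ j $ i)"
      unfolding matrix_mult_nth by (subst sum.swap) (simp add: mult.commute)
    also have "\<dots> = (\<Sum>b<k. matpow g k $ j $ i)"
      by (intro sum.cong refl) (simp add: matpow_add[symmetric])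
    finally show "(\<Sum>a\<in>UNIV. \<Sum>b<k. matpow g b $ a $ i * matpow g (k - b) $ j $ a) = matpow g k $ j $ i * of_nat k"
      by simp
  qed (simp add: trace_def)
qed

text \<open>The matrix unit \<open>E_ij\<close> times \<open>g\<close> has row \<open>j\<close> of
  \<open>g\<close> as row \<open>i\<close>. The derivative of the determinant is thus the
  determinant with row \<open>i\<close> replaced by row \<open>j\<close>, which has two equal rows
  unless \<open>i = j\<close>.\<close>

lemma inv_gradient_det:
  "inv_gradient (\<lambda>g :: complex^'n^'n. det g) (\<lambda>i j g. if i = j then det g else 0)"
proof -
  let ?P = "{p. p permutes (UNIV :: 'n set)}"
  have "inv_gradient (\<lambda>g :: complex^'n^'n. \<Sum>p\<in>?P. of_int (sign p) * (\<Prod>a\<in>UNIV. g $ a $ p a))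
     (\<lambda>i j g. \<Sum>p\<in>?P. 0 * (\<Prod>a\<in>UNIV. g $ a $ p a) + of_int (sign p) *
        (\<Sum>a\<in>UNIV. (if i = a then g $ j $ p a else 0) * (\<Prod>y\<in>UNIV - {a}. g $ y $ p y)))"
    by (intro inv_gradient_sum inv_gradient_mult inv_gradient_const inv_gradient_prod inv_gradient_entry)
       (auto intro: finite_permutations)
  then show ?thesis
  proof (rule inv_gradient_cong)
    fix g :: "complex^'n^'n" and i j
    define g' :: "complex^'n^'n" where "g' = (\<chi> y. if y = i then g $ j else g $ y)"
    have "(\<Sum>a\<in>UNIV. (if i = a then g $ j $ p a else 0) * (\<Prod>y\<in>UNIV - {a}. g $ y $ p y)) = (\<Prod>y\<in>UNIV. g' $ y $ p y)" for p
    proof -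
      have "(\<Sum>a\<in>UNIV. (if i = a then g $ j $ p a else 0) * (\<Prod>y\<in>UNIV - {a}. g $ y $ p y)) =
        (\<Sum>a\<in>UNIV. if a = i then g $ j $ p i * (\<Prod>y\<in>UNIV - {i}. g $ y $ p y) else 0)"
        by (intro sum.cong refl) auto
      also have "\<dots> = g $ j $ p i * (\<Prod>y\<in>UNIV - {i}. g $ y $ p y)" by simp
      also have "(\<Prod>y\<in>UNIV - {i}. g $ y $ p y) = (\<Prod>y\<in>UNIV - {i}. g' $ y $ p y)"
        by (intro prod.cong) (auto simp: g'_def)
      also have "g $ j $ p i = g' $ i $ p i" by (simp add: g'_def)
      also have "g' $ i $ p i * (\<Prod>y\<in>UNIV - {i}. g' $ y $ p y) = (\<Prod>y\<in>UNIV. g' $ y $ p y)"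
        by (rule prod.remove[symmetric]) auto
      finally show ?thesis .
    qed
    then have "(\<Sum>p\<in>?P. 0 * (\<Prod>a\<in>UNIV. g $ a $ p a) + of_int (sign p) *
        (\<Sum>a\<in>UNIV. (if i = a then g $ j $ p a else 0) * (\<Prod>y\<in>UNIV - {a}. g $ y $ p y))) = det g'"
      by (simp add: Determinants.det_def)
    also have "det g' = (if i = j then det g else 0)"
    proof (cases "i = j")
      case True
      then have "g' = g" by (simp add: g'_def Finite_Cartesian_Product.vec_eq_iff)
      then show ?thesis using True by simp
    next
      case False
      then have "Finite_Cartesian_Product.row i g' = Finite_Cartesian_Product.row j g'"
        by (simp add: g'_def Finite_Cartesian_Product.row_def Finite_Cartesian_Product.vec_eq_iff)
      then show ?thesis using False Determinants.det_identical_rows[of i j g'] by simp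
    qed
    finally show "(\<Sum>p\<in>?P. 0 * (\<Prod>a\<in>UNIV. g $ a $ p a) + of_int (sign p) *
        (\<Sum>a\<in>UNIV. (if i = a then g $ j $ p a else 0) * (\<Prod>y\<in>UNIV - {a}. g $ y $ p y))) =
        (if i = j then det g else 0)" .
  qed (simp add: Determinants.det_def)
qed

text \<open>
  \<open>radial F \<phi>\<close>: the class function \<open>F\<close> on the unitary group is given by the symmetric Laurent
  polynomial \<open>\<phi>\<close> in the eigenvalues. On unitary matrices \<open>cnj (det g) = 1 / det g\<close>.
\<close>

inductive radial :: "(complex^'n^'n \<Rightarrow> complex) \<Rightarrow> ((nat \<Rightarrow> complex) \<Rightarrow> complex) \<Rightarrow> bool" where
  radial_const: "radial (\<lambda>_. c) (\<lambda>_. c)"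
| radial_power_sum: "radial (\<lambda>g :: complex^'n^'n. trace (matpow g k)) (\<lambda>t. \<Sum>i<CARD('n). t i ^ k)"
| radial_inv_det: "radial (\<lambda>g :: complex^'n^'n. cnj (det g)) (\<lambda>t. \<Prod>i<CARD('n). inverse (t i))"
| radial_add: "radial F \<phi> \<Longrightarrow> radial F' \<phi>' \<Longrightarrow> radial (\<lambda>g. F g + F' g) (\<lambda>t. \<phi> t + \<phi>' t)"
| radial_mult: "radial F \<phi> \<Longrightarrow> radial F' \<phi>' \<Longrightarrow> radial (\<lambda>g. F g * F' g) (\<lambda>t. \<phi> t * \<phi>' t)"

lemma radial_sum:
  assumes "\<And>a. a \<in> S \<Longrightarrow> radial (F a) (\<phi> a)"
  shows "radial (\<lambda>g. \<Sum>a\<in>S. F a g) (\<lambda>t. \<Sum>a\<in>S. \<phi> a t)"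
proof (cases "finite S")
  case True
  then show ?thesis using assms by (induction S) (auto intro: radial_const radial_add)
qed (auto intro: radial_const)

lemma radial_prod:
  assumes "\<And>a. a \<in> S \<Longrightarrow> radial (F a) (\<phi> a)"
  shows "radial (\<lambda>g. \<Prod>a\<in>S. F a g) (\<lambda>t. \<Prod>a\<in>S. \<phi> a t)"
proof (cases "finite S")
  case True
  then show ?thesis using assms by (induction S) (auto intro: radial_const radial_mult)
qed (auto intro: radial_const)

text \<open>\<open>d\<close> is the value at \<open>t\<close> of the Euler operator \<open>t\<^sub>i \<partial>/\<partial>t\<^sub>i\<close> applied to \<open>\<phi>\<close>.\<close>

definition has_theta :: "((nat \<Rightarrow> complex) \<Rightarrow> complex) \<Rightarrow> nat \<Rightarrow> (nat \<Rightarrow> complex) \<Rightarrow> complex \<Rightarrow> bool"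
  where "has_theta \<phi> i t d \<longleftrightarrow> ((\<lambda>x. \<phi> (t(i := x))) has_field_derivative d / t i) (at (t i))"

lemma has_theta_const: "has_theta (\<lambda>_. c) i t 0"
  by (simp add: has_theta_def)

lemma has_theta_add:
  "has_theta \<phi> i t d \<Longrightarrow> has_theta \<psi> i t e \<Longrightarrow> has_theta (\<lambda>t. \<phi> t + \<psi> t) i t (d + e)"
  unfolding has_theta_def add_divide_distrib by (rule DERIV_add)

lemma has_theta_mult:
  "has_theta \<phi> i t d \<Longrightarrow> has_theta \<psi> i t e \<Longrightarrow> has_theta (\<lambda>t. \<phi> t * \<psi> t) i t (d * \<psi> t + \<phi> t * e)"
  unfolding has_theta_def by (drule (1) DERIV_mult) (simp add: add_divide_distrib algebra_simps)

lemma has_theta_sum: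
  assumes "\<And>a. a \<in> S \<Longrightarrow> has_theta (\<phi> a) i t (d a)"
  shows "has_theta (\<lambda>t. \<Sum>a\<in>S. \<phi> a t) i t (\<Sum>a\<in>S. d a)"
proof (cases "finite S")
  case True
  then show ?thesis using assms by (induction S) (auto intro: has_theta_const has_theta_add)
qed (auto intro: has_theta_const)

lemma has_theta_powi:
  assumes "t i \<noteq> 0"
  shows "has_theta (\<lambda>t. t a powi k) i t (if a = i then of_int k * t i powi k else 0)"
proof (cases "a = i")
  case True
  have "((\<lambda>x. x powi k) has_field_derivative of_int k * t i powi (k - 1)) (at (t i))"
    using assms by (auto intro!: derivative_eq_intros)
  moreover have "of_int k * t i powi (k - 1) = of_int k * t i powi k / t i"
    using assms by (simp add: power_int_diff)
  ultimately show ?thesis using True by (simp add: has_theta_def)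
qed (simp add: has_theta_def)

text \<open>The gradient of a class function is a combination of powers of \<open>g\<close> with
  class functions as coefficients. The same exponents and coefficients give the Euler derivatives of
  its Laurent polynomial, with the power of \<open>g\<close> replaced by a power of
  \<open>t i\<close>. Recording both together allows a second differentiation on either
  side.\<close>

definition gradient_data ::
  "(complex^'n^'n \<Rightarrow> complex) \<Rightarrow> ((nat \<Rightarrow> complex) \<Rightarrow> complex) \<Rightarrow>
    nat \<Rightarrow> (nat \<Rightarrow> nat) \<Rightarrow> (nat \<Rightarrow> complex^'n^'n \<Rightarrow> complex) \<Rightarrow> (nat \<Rightarrow> (nat \<Rightarrow> complex) \<Rightarrow> complex) \<Rightarrow> bool"
  where "gradient_data F \<phi> K k F' \<phi>' \<longleftrightarrow> (\<forall>a<K. radial (F' a) (\<phi>' a)) \<and>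
    inv_gradient F (\<lambda>i j g. \<Sum>a<K. matpow g (k a) $ j $ i * F' a g) \<and>
    (\<forall>t i. i < CARD('n) \<longrightarrow> (\<forall>j<CARD('n). t j \<noteq> 0) \<longrightarrow> has_theta \<phi> i t (\<Sum>a<K. t i ^ k a * \<phi>' a t))"

lemma sum_lessThan_append:
  fixes f :: "nat \<Rightarrow> 'a :: comm_monoid_add"
  shows "(\<Sum>i<a + b. f i) = (\<Sum>i<a. f i) + (\<Sum>i<b. f (a + i))"
  by (induction b) (auto simp: add_ac)

text \<open>The two families of terms are concatenated, each multiplied by a class function.
  Constants 1 give the rule for sums, the two functions themselves the product rule.\<close>

lemma gradient_data_join:
  fixes F1 :: "complex^'n^'n \<Rightarrow> complex"
  assumes "gradient_data F1 \<phi>1 K1 k1 F1' \<phi>1'" "gradient_data F2 \<phi>2 K2 k2 F2' \<phi>2'"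
    and "radial H1 h1" "radial H2 h2"
  obtains k F' \<phi>' where "\<forall>a<K1 + K2. radial (F' a) (\<phi>' a)"
    and "\<And>(g :: complex^'n^'n) i j. (\<Sum>a<K1 + K2. matpow g (k a) $ j $ i * F' a g) =
       (\<Sum>a<K1. matpow g (k1 a) $ j $ i * F1' a g) * H2 g + H1 g * (\<Sum>a<K2. matpow g (k2 a) $ j $ i * F2' a g)"
    and "\<And>t i. (\<Sum>a<K1 + K2. t i ^ k a * \<phi>' a t) =
       (\<Sum>a<K1. t i ^ k1 a * \<phi>1' a t) * h2 t + h1 t * (\<Sum>a<K2. t i ^ k2 a * \<phi>2' a t)"
proof
  let ?F' = "\<lambda>a. if a < K1 then (\<lambda>g. F1' a g * H2 g) else (\<lambda>g. H1 g * F2' (a - K1) g)"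
  let ?\<phi>' = "\<lambda>a. if a < K1 then (\<lambda>t. \<phi>1' a t * h2 t) else (\<lambda>t. h1 t * \<phi>2' (a - K1) t)"
  let ?k = "\<lambda>a. if a < K1 then k1 a else k2 (a - K1)"
  show "\<forall>a<K1 + K2. radial (?F' a) (?\<phi>' a)"
    using assms unfolding gradient_data_def by (auto intro!: radial_mult)
  show "(\<Sum>a<K1 + K2. matpow g (?k a) $ j $ i * ?F' a g) =
       (\<Sum>a<K1. matpow g (k1 a) $ j $ i * F1' a g) * H2 g + H1 g * (\<Sum>a<K2. matpow g (k2 a) $ j $ i * F2' a g)" for g i j
    by (auto simp: sum_lessThan_append sum_distrib_left sum_distrib_right mult_ac
      intro!: sum.cong arg_cong2[of _ _ _ _ "(+)"])
  show "(\<Sum>a<K1 + K2. t i ^ ?k a * ?\<phi>' a t) =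
       (\<Sum>a<K1. t i ^ k1 a * \<phi>1' a t) * h2 t + h1 t * (\<Sum>a<K2. t i ^ k2 a * \<phi>2' a t)" for t i
    by (auto simp: sum_lessThan_append sum_distrib_left sum_distrib_right mult_ac
      intro!: sum.cong arg_cong2[of _ _ _ _ "(+)"])
qed

lemma radial_gradient:
  fixes F :: "complex^'n^'n \<Rightarrow> complex"
  assumes "radial F \<phi>"
  shows "\<exists>K k F' \<phi>'. gradient_data F \<phi> K k F' \<phi>'"
  using assms
proof (induction rule: radial.induct)
  case (radial_const c)
  have "gradient_data (\<lambda>_ :: complex^'n^'n. c) (\<lambda>_. c) 0 (\<lambda>_. 0) (\<lambda>_ _. 0) (\<lambda>_ _. 0)"
    by (simp add: gradient_data_def inv_gradient_const has_theta_const)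
  then show ?case by blast
next
  case (radial_power_sum k)
  have "has_theta (\<lambda>t. \<Sum>i<CARD('n). t i ^ k) i t (t i ^ k * of_nat k)"
    if i: "i < CARD('n)" and t: "\<forall>j<CARD('n). t j \<noteq> 0" for t i
  proof -
    have "has_theta (\<lambda>t. \<Sum>a<CARD('n). t a powi int k) i t (\<Sum>a<CARD('n). if a = i then of_int (int k) * t i powi int k else 0)"
      using i t by (intro has_theta_sum has_theta_powi) auto
    then show ?thesis using i by (simp add: mult.commute)
  qed
  then have "gradient_data (\<lambda>g :: complex^'n^'n. trace (matpow g k)) (\<lambda>t. \<Sum>i<CARD('n). t i ^ k) 1 (\<lambda>_. k) (\<lambda>_ _. of_nat k) (\<lambda>_ _. of_nat k)"
    using inv_gradient_trace_matpow[of k, where 'n = 'n] by (simp add: gradient_data_def radial.radial_const)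
  then show ?case by blast
next
  case radial_inv_det
  have "has_theta (\<lambda>t. \<Prod>i<CARD('n). inverse (t i)) i t (t i ^ 0 * (-1 * (\<Prod>i<CARD('n). inverse (t i))))"
    if i: "i < CARD('n)" and t: "\<forall>j<CARD('n). t j \<noteq> 0" for t i
  proof -
    let ?C = "\<Prod>j\<in>{..<CARD('n)} - {i}. inverse (t j)"
    have "(\<Prod>j<CARD('n). inverse ((t(i := x)) j)) = inverse x * ?C" for x
      using i by (subst prod.remove[of _ i]) (auto intro!: prod.cong)
    moreover have "((\<lambda>x. inverse x * ?C) has_field_derivative (- inverse (t i * t i)) * ?C) (at (t i))"
      using i t by (auto intro!: derivative_eq_intros)
    moreover have "(\<Prod>j<CARD('n). inverse (t j)) = inverse (t i) * ?C" 
      using i by (subst prod.remove[of _ i]) (auto intro!: prod.cong)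
    ultimately show ?thesis by (simp add: has_theta_def divide_inverse mult_ac)
  qed
  moreover have "inv_gradient (\<lambda>g :: complex^'n^'n. cnj (det g)) (\<lambda>i j g. matpow g 0 $ j $ i * (-1 * cnj (det g)))"
    by (rule inv_gradient_cong[OF inv_gradient_cnj[OF inv_gradient_det]]) (auto simp: mat_1_nth)
  moreover have r: "radial (\<lambda>g :: complex^'n^'n. -1 * cnj (det g)) (\<lambda>t. -1 * (\<Prod>i<CARD('n). inverse (t i)))"
    by (intro radial.radial_mult radial.radial_const radial.radial_inv_det)
  ultimately have "gradient_data (\<lambda>g :: complex^'n^'n. cnj (det g)) (\<lambda>t. \<Prod>i<CARD('n). inverse (t i)) 1 (\<lambda>_. 0)
     (\<lambda>_ g. -1 * cnj (det g)) (\<lambda>_ t. -1 * (\<Prod>i<CARD('n). inverse (t i)))"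
    unfolding gradient_data_def using r by simp
  then show ?case by blast
next
  case (radial_add F1 \<phi>1 F2 \<phi>2)
  obtain K1 k1 F1' \<phi>1' where 1: "gradient_data F1 \<phi>1 K1 k1 F1' \<phi>1'" using radial_add by blast
  obtain K2 k2 F2' \<phi>2' where 2: "gradient_data F2 \<phi>2 K2 k2 F2' \<phi>2'" using radial_add by blast
  obtain k F' \<phi>' where join: "\<forall>a<K1 + K2. radial (F' a) (\<phi>' a)"
    "\<And>(g :: complex^'n^'n) i j. (\<Sum>a<K1 + K2. matpow g (k a) $ j $ i * F' a g) =
       (\<Sum>a<K1. matpow g (k1 a) $ j $ i * F1' a g) * 1 + 1 * (\<Sum>a<K2. matpow g (k2 a) $ j $ i * F2' a g)"
    "\<And>t i. (\<Sum>a<K1 + K2. t i ^ k a * \<phi>' a t) =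
       (\<Sum>a<K1. t i ^ k1 a * \<phi>1' a t) * 1 + 1 * (\<Sum>a<K2. t i ^ k2 a * \<phi>2' a t)"
    by (rule gradient_data_join[OF 1 2 radial_const[of 1] radial_const[of 1]]) (rule that)
  have "gradient_data (\<lambda>g. F1 g + F2 g) (\<lambda>t. \<phi>1 t + \<phi>2 t) (K1 + K2) k F' \<phi>'"
    unfolding gradient_data_def join(2,3) mult_1_right mult_1_left
    using 1 2 join(1) by (auto simp: gradient_data_def intro!: inv_gradient_add has_theta_add)
  then show ?case by blast
next
  case (radial_mult F1 \<phi>1 F2 \<phi>2)
  obtain K1 k1 F1' \<phi>1' where 1: "gradient_data F1 \<phi>1 K1 k1 F1' \<phi>1'" using radial_mult by blast
  obtain K2 k2 F2' \<phi>2' where 2: "gradient_data F2 \<phi>2 K2 k2 F2' \<phi>2'" using radial_mult by blast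
  obtain k F' \<phi>' where join: "\<forall>a<K1 + K2. radial (F' a) (\<phi>' a)"
    "\<And>(g :: complex^'n^'n) i j. (\<Sum>a<K1 + K2. matpow g (k a) $ j $ i * F' a g) =
       (\<Sum>a<K1. matpow g (k1 a) $ j $ i * F1' a g) * F2 g + F1 g * (\<Sum>a<K2. matpow g (k2 a) $ j $ i * F2' a g)"
    "\<And>t i. (\<Sum>a<K1 + K2. t i ^ k a * \<phi>' a t) =
       (\<Sum>a<K1. t i ^ k1 a * \<phi>1' a t) * \<phi>2 t + \<phi>1 t * (\<Sum>a<K2. t i ^ k2 a * \<phi>2' a t)"
    by (rule gradient_data_join[OF 1 2 radial_mult(1,2)]) (rule that)
  have "gradient_data (\<lambda>g. F1 g * F2 g) (\<lambda>t. \<phi>1 t * \<phi>2 t) (K1 + K2) k F' \<phi>'"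
    unfolding gradient_data_def join(2,3)
    using 1 2 join(1) by (auto simp: gradient_data_def intro!: inv_gradient_mult has_theta_mult)
  then show ?case by blast
qed

lemma radial_continuous:
  fixes F :: "complex^'n^'n \<Rightarrow> complex"
  assumes "radial F \<phi>" shows "continuous_on UNIV F"
  using radial_gradient[OF assms] by (auto simp: gradient_data_def inv_gradient_def)

lemma trace_mult_matpow:
  "(\<Sum>i\<in>UNIV. \<Sum>j\<in>UNIV. matpow g k $ j $ i * matpow g l $ i $ j) = trace (matpow g (k + l))"
  unfolding matpow_add trace_def matrix_mult_nth by (rule sum.swap)

text \<open>\<open>\<Psi>\<close> is the Casimir operator, the sum of all products of the
  derivatives along \<open>E_ij\<close> and \<open>E_ji\<close>, applied to \<open>F\<close>. Each
  summand is a component of a gradient and so has integral 0. With the Euler operators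
  \<open>\<theta>_i\<close>, and since \<open>2 x/(x - y) - 1 = (x + y)/(x - y)\<close>, the formula
  for \<open>\<psi>\<close> is the usual radial part: the sum of the \<open>\<theta>_i^2\<close>
  plus that of \<open>(t_i + t_j)/(t_i - t_j) (\<theta>_i - \<theta>_j)\<close> over
  \<open>i < j\<close>.\<close>

theorem radial_casimir:
  fixes M :: "(complex^'n^'n) measure" and F :: "complex^'n^'n \<Rightarrow> complex"
  assumes haar: "normalized_haar_measure M" and F: "radial F \<phi>"
  obtains \<Psi> \<psi> \<phi>1 \<phi>2 where "radial \<Psi> \<psi>" "(LINT g|M. \<Psi> g) = 0"
    and "\<And>t i. i < CARD('n) \<Longrightarrow> (\<forall>j<CARD('n). t j \<noteq> 0) \<Longrightarrow> has_theta \<phi> i t (\<phi>1 i t)"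
    and "\<And>t i. i < CARD('n) \<Longrightarrow> (\<forall>j<CARD('n). t j \<noteq> 0) \<Longrightarrow> has_theta (\<phi>1 i) i t (\<phi>2 i t)"
    and "\<And>t. (\<forall>j<CARD('n). t j \<noteq> 0) \<Longrightarrow> inj_on t {..<CARD('n)} \<Longrightarrow>
      \<psi> t = (\<Sum>i<CARD('n). \<phi>2 i t) + 2 * (\<Sum>i<CARD('n). \<Sum>j\<in>{..<CARD('n)} - {i}. t i / (t i - t j) * \<phi>1 i t)
         - (of_nat CARD('n) - 1) * (\<Sum>i<CARD('n). \<phi>1 i t)"
proof -
  let ?n = "CARD('n)"
  obtain K k F' \<phi>' where d: "gradient_data F \<phi> K k F' \<phi>'" using radial_gradient[OF F] by blast
  have r': "radial (F' a) (\<phi>' a)" if "a < K" for a using d that by (auto simp: gradient_data_def)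
  then have "\<exists>K' k' F'' \<phi>''. gradient_data (F' a) (\<phi>' a) K' k' F'' \<phi>''" if "a < K" for a
    using radial_gradient that by blast
  then obtain K' k' F'' \<phi>'' where d': "\<And>a. a < K \<Longrightarrow> gradient_data (F' a) (\<phi>' a) (K' a) (k' a) (F'' a) (\<phi>'' a)"
    by metis
  have r'': "radial (F'' a b) (\<phi>'' a b)" if "a < K" "b < K' a" for a b
    using d'[OF that(1)] that(2) by (auto simp: gradient_data_def)
  define \<phi>1 where "\<phi>1 i t = (\<Sum>a<K. t i ^ k a * \<phi>' a t)" for i t
  define \<phi>2 where "\<phi>2 i t = (\<Sum>a<K. of_nat (k a) * t i ^ k a * \<phi>' a t + t i ^ k a * (\<Sum>b<K' a. t i ^ k' a b * \<phi>'' a b t))" for i t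
  define ps where "ps k t = (\<Sum>i<?n. t i ^ k)" for k and t :: "nat \<Rightarrow> complex"
  define \<Psi> where "\<Psi> g = (\<Sum>a<K. (\<Sum>b<k a. trace (matpow g b) * trace (matpow g (k a - b))) * F' a g
     + (\<Sum>b<K' a. trace (matpow g (k a + k' a b)) * F'' a b g))" for g :: "complex^'n^'n"
  define \<psi> where "\<psi> t = (\<Sum>a<K. (\<Sum>b<k a. ps b t * ps (k a - b) t) * \<phi>' a t
     + (\<Sum>b<K' a. ps (k a + k' a b) t * \<phi>'' a b t))" for t
  show thesis
  proof (rule that[of \<Psi> \<psi> \<phi>1 \<phi>2])
    show "radial \<Psi> \<psi>"
      unfolding \<Psi>_def \<psi>_def ps_def
      by (intro radial_sum radial_add radial_mult radial_power_sum r' r'') auto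
  next
    define f where "f i j g = (\<Sum>a<K. matpow g (k a) $ j $ i * F' a g)" for i j and g :: "complex^'n^'n"
    \<comment> \<open>\<open>f i j\<close> is the derivative of \<open>F\<close> along
      \<open>E_ij\<close>, and \<open>G i j p q\<close> that of \<open>f i j\<close> along
      \<open>E_pq\<close>. The Casimir operator needs \<open>p = j\<close> and \<open>q = i\<close>,
      where the products of entries of powers of \<open>g\<close> sum to traces.\<close>
    define G where "G i j p q g = (\<Sum>a<K. (\<Sum>b<k a. matpow g b $ j $ p * matpow g (k a - b) $ q $ i) * F' a g +
        matpow g (k a) $ j $ i * (\<Sum>b<K' a. matpow g (k' a b) $ q $ p * F'' a b g))" for i j p q and g :: "complex^'n^'n"
    have G: "inv_gradient (f i j) (G i j)" for i j
      unfolding f_def G_def using d'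
      by (intro inv_gradient_sum inv_gradient_mult inv_gradient_matpow) (auto simp: gradient_data_def)
    have cont: "continuous_on UNIV (G i j p q)" for i j p q
      using G[of i j] by (auto simp: inv_gradient_def)
    have "\<Psi> g = (\<Sum>i\<in>UNIV. \<Sum>j\<in>UNIV. G i j j i g)" for g
    proof -
      have "(\<Sum>i\<in>UNIV. \<Sum>j\<in>UNIV. G i j j i g) = (\<Sum>a<K.
         (\<Sum>b<k a. (\<Sum>i\<in>UNIV. \<Sum>j\<in>UNIV. matpow g b $ j $ j * matpow g (k a - b) $ i $ i)) * F' a g +
         (\<Sum>b<K' a. (\<Sum>i\<in>UNIV. \<Sum>j\<in>UNIV. matpow g (k a) $ j $ i * matpow g (k' a b) $ i $ j) * F'' a b g))"
      proof -
        have "(\<Sum>i\<in>UNIV. \<Sum>j\<in>UNIV. G i j j i g) = (\<Sum>a<K. \<Sum>i\<in>UNIV. \<Sum>j\<in>UNIV.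
          (\<Sum>b<k a. matpow g b $ j $ j * matpow g (k a - b) $ i $ i) * F' a g +
           matpow g (k a) $ j $ i * (\<Sum>b<K' a. matpow g (k' a b) $ i $ j * F'' a b g))"
          unfolding G_def by (subst sum.swap[where B = "{..<K}"], subst sum.swap[where B = "{..<K}"]) (rule refl)
        also have "\<dots> = (\<Sum>a<K.
         (\<Sum>b<k a. (\<Sum>i\<in>UNIV. \<Sum>j\<in>UNIV. matpow g b $ j $ j * matpow g (k a - b) $ i $ i)) * F' a g +
         (\<Sum>b<K' a. (\<Sum>i\<in>UNIV. \<Sum>j\<in>UNIV. matpow g (k a) $ j $ i * matpow g (k' a b) $ i $ j) * F'' a b g))"
        proof (rule sum.cong [OF refl])
          fix a
          have "(\<Sum>i\<in>UNIV. \<Sum>j\<in>UNIV. (\<Sum>b<k a. matpow g b $ j $ j * matpow g (k a - b) $ i $ i) * F' a g) =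
            (\<Sum>b<k a. (\<Sum>i\<in>UNIV. \<Sum>j\<in>UNIV. matpow g b $ j $ j * matpow g (k a - b) $ i $ i)) * F' a g"
            unfolding sum_distrib_right by (subst sum.swap[where A = "{..<k a}"], subst sum.swap[where A = "{..<k a}"]) (rule refl)
          moreover have "(\<Sum>i\<in>UNIV. \<Sum>j\<in>UNIV. matpow g (k a) $ j $ i * (\<Sum>b<K' a. matpow g (k' a b) $ i $ j * F'' a b g)) =
            (\<Sum>b<K' a. (\<Sum>i\<in>UNIV. \<Sum>j\<in>UNIV. matpow g (k a) $ j $ i * matpow g (k' a b) $ i $ j) * F'' a b g)"
            unfolding sum_distrib_right sum_distrib_left
            by (subst sum.swap[where A = "{..<K' a}"], subst sum.swap[where A = "{..<K' a}"]) (simp add: mult.assoc)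
          ultimately show "(\<Sum>i\<in>UNIV. \<Sum>j\<in>UNIV.
          (\<Sum>b<k a. matpow g b $ j $ j * matpow g (k a - b) $ i $ i) * F' a g +
           matpow g (k a) $ j $ i * (\<Sum>b<K' a. matpow g (k' a b) $ i $ j * F'' a b g)) =
           (\<Sum>b<k a. (\<Sum>i\<in>UNIV. \<Sum>j\<in>UNIV. matpow g b $ j $ j * matpow g (k a - b) $ i $ i)) * F' a g +
         (\<Sum>b<K' a. (\<Sum>i\<in>UNIV. \<Sum>j\<in>UNIV. matpow g (k a) $ j $ i * matpow g (k' a b) $ i $ j) * F'' a b g)"
            by (simp only: sum.distrib)
        qed
        finally show ?thesis .
      qed
      moreover have "(\<Sum>i\<in>UNIV. \<Sum>j\<in>UNIV. matpow g b $ j $ j * matpow g c $ i $ i) = trace (matpow g b) * trace (matpow g c)" for b c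
        unfolding trace_def by (simp add: sum_distrib_left sum_distrib_right)
      ultimately show ?thesis by (simp add: \<Psi>_def trace_mult_matpow)
    qed
    then have "(LINT g|M. \<Psi> g) = (LINT g|M. (\<Sum>i\<in>UNIV. \<Sum>j\<in>UNIV. G i j j i g))" by simp
    also have "\<dots> = (\<Sum>i\<in>UNIV. LINT g|M. (\<Sum>j\<in>UNIV. G i j j i g))"
      by (rule Bochner_Integration.integral_sum) (intro haar_integrable[OF haar] continuous_intros cont)
    also have "\<dots> = (\<Sum>i\<in>UNIV. \<Sum>j\<in>UNIV. LINT g|M. G i j j i g)"
      by (intro sum.cong refl Bochner_Integration.integral_sum haar_integrable[OF haar] cont)
    also have "\<dots> = 0" by (simp add: haar_integral_gradient[OF haar G])
    finally show "(LINT g|M. \<Psi> g) = 0" .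
  next
    fix t :: "nat \<Rightarrow> complex" and i assume "i < ?n" "\<forall>j<?n. t j \<noteq> 0"
    then show "has_theta \<phi> i t (\<phi>1 i t)" unfolding \<phi>1_def using d by (auto simp: gradient_data_def)
  next
    fix t :: "nat \<Rightarrow> complex" and i assume i: "i < ?n" "\<forall>j<?n. t j \<noteq> 0"
    have "has_theta (\<lambda>t. t i powi int (k a)) i t (of_nat (k a) * t i ^ k a)" for a
      using has_theta_powi[of t i i "int (k a)"] i by simp
    then have p: "has_theta (\<lambda>t. t i ^ k a) i t (of_nat (k a) * t i ^ k a)" for a by simp
    show "has_theta (\<phi>1 i) i t (\<phi>2 i t)"
      unfolding \<phi>1_def[abs_def] \<phi>2_def using d' i
      by (intro has_theta_sum has_theta_mult p) (auto simp: gradient_data_def)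
  next
    fix t :: "nat \<Rightarrow> complex" assume nz: "\<forall>j<?n. t j \<noteq> 0" and inj: "inj_on t {..<?n}"
    \<comment> \<open>The summands for \<open>(i, j)\<close> and \<open>(j, i)\<close> combine to
      \<open>(t_i^(k+1) - t_j^(k+1))/(t_i - t_j)\<close>, a geometric sum. Each of its
      \<open>k + 1\<close> terms is completed by the diagonal \<open>i = j\<close>, which
      contributes the power sum \<open>ps k t\<close>.\<close>
    have S: "2 * (\<Sum>i<?n. \<Sum>j\<in>{..<?n} - {i}. t i / (t i - t j) * t i ^ k) = (\<Sum>b\<le>k. ps b t * ps (k - b) t - ps k t)" for k
    proof -
      let ?D = "SIGMA i:{..<?n}. {..<?n} - {i}"
      have "(\<Sum>i<?n. \<Sum>j\<in>{..<?n} - {i}. t i / (t i - t j) * t i ^ k) = (\<Sum>(i, j)\<in>?D. t i / (t i - t j) * t i ^ k)"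
        by (rule sum.Sigma) auto
      moreover have "\<dots> = (\<Sum>(i, j)\<in>?D. t j / (t j - t i) * t j ^ k)"
        by (rule sum.reindex_bij_witness[where i = "\<lambda>(i, j). (j, i)" and j = "\<lambda>(i, j). (j, i)"]) auto
      ultimately have "2 * (\<Sum>i<?n. \<Sum>j\<in>{..<?n} - {i}. t i / (t i - t j) * t i ^ k) =
         (\<Sum>(i, j)\<in>?D. t i / (t i - t j) * t i ^ k) + (\<Sum>(i, j)\<in>?D. t j / (t j - t i) * t j ^ k)" by simp
      also have "\<dots> = (\<Sum>(i, j)\<in>?D. \<Sum>b\<le>k. t i ^ b * t j ^ (k - b))"
        unfolding sum.distrib[symmetric]
      proof (rule sum.cong [OF refl], goal_cases)
        case (1 x)
        then obtain i j where x: "x = (i, j)" and ij: "i < ?n" "j < ?n" "j \<noteq> i" by auto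
        then have ne: "t i - t j \<noteq> 0" "t j - t i \<noteq> 0" using inj by (auto simp: inj_on_def)
        have "t j / (t j - t i) * t j ^ k = - (t j ^ Suc k / (t i - t j))"
          using ne by (simp add: field_simps)
        then have "t i / (t i - t j) * t i ^ k + t j / (t j - t i) * t j ^ k = (t i ^ Suc k - t j ^ Suc k) / (t i - t j)"
          by (simp add: diff_divide_distrib)
        also have "t i ^ Suc k - t j ^ Suc k = (t i - t j) * (\<Sum>b\<le>k. t i ^ b * t j ^ (k - b))"
          using power_diff_sumr2[of "t i" "Suc k" "t j"]
          by (simp add: lessThan_Suc_atMost mult.commute)
        finally show ?case using ne by (simp add: x)
      qed
      also have "\<dots> = (\<Sum>b\<le>k. \<Sum>(i, j)\<in>?D. t i ^ b * t j ^ (k - b))"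
        unfolding case_prod_unfold by (rule sum.swap)
      also have "\<dots> = (\<Sum>b\<le>k. ps b t * ps (k - b) t - ps k t)"
      proof (rule sum.cong [OF refl])
        fix b assume b: "b \<in> {..k}"
        have "(\<Sum>(i, j)\<in>?D. t i ^ b * t j ^ (k - b)) = (\<Sum>i<?n. \<Sum>j\<in>{..<?n} - {i}. t i ^ b * t j ^ (k - b))"
          by (rule sum.Sigma[symmetric]) auto
        also have "\<dots> = (\<Sum>i<?n. (\<Sum>j<?n. t i ^ b * t j ^ (k - b)) - t i ^ k)"
        proof (rule sum.cong [OF refl])
          fix i assume i: "i \<in> {..<?n}"
          have "t i ^ b * t i ^ (k - b) = t i ^ k" using b by (simp add: power_add[symmetric])
          then show "(\<Sum>j\<in>{..<?n} - {i}. t i ^ b * t j ^ (k - b)) = (\<Sum>j<?n. t i ^ b * t j ^ (k - b)) - t i ^ k"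
            using i by (simp add: sum_diff1)
        qed
        also have "\<dots> = ps b t * ps (k - b) t - ps k t"
          unfolding sum_subtractf ps_def sum_product ..
        finally show "(\<Sum>(i, j)\<in>?D. t i ^ b * t j ^ (k - b)) = ps b t * ps (k - b) t - ps k t" .
      qed
      finally show ?thesis .
    qed
    \<comment> \<open>Differentiating the k-th power yields the products with \<open>b < k\<close>,
      one fewer than in \<open>S\<close>. The term \<open>b = k\<close> is the power sum times
      \<open>n\<close>; together with the subtracted \<open>k + 1\<close> copies it is balanced by
      the \<open>k\<close> copies from the second Euler derivative and by the term with factor
      \<open>n - 1\<close>.\<close>
    have R: "(\<Sum>i<?n. of_nat k * t i ^ k) + 2 * (\<Sum>i<?n. \<Sum>j\<in>{..<?n} - {i}. t i / (t i - t j) * t i ^ k) - (of_nat ?n - 1) * ps k t =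
        (\<Sum>b<k. ps b t * ps (k - b) t)" for k
    proof -
      have "ps 0 t = of_nat ?n" by (simp add: ps_def)
      moreover have "(\<Sum>b\<le>k. ps b t * ps (k - b) t - ps k t) = (\<Sum>b<k. ps b t * ps (k - b) t) + ps k t * ps 0 t - of_nat (Suc k) * ps k t"
        by (simp add: sum_subtractf lessThan_Suc_atMost[symmetric])
      ultimately show ?thesis unfolding S by (simp add: sum_distrib_left[symmetric] ps_def[symmetric] algebra_simps)
    qed
    have "(\<Sum>i<?n. \<phi>2 i t) + 2 * (\<Sum>i<?n. \<Sum>j\<in>{..<?n} - {i}. t i / (t i - t j) * \<phi>1 i t) - (of_nat ?n - 1) * (\<Sum>i<?n. \<phi>1 i t) =
      (\<Sum>a<K. ((\<Sum>i<?n. of_nat (k a) * t i ^ k a) + 2 * (\<Sum>i<?n. \<Sum>j\<in>{..<?n} - {i}. t i / (t i - t j) * t i ^ k a) - (of_nat ?n - 1) * ps (k a) t) * \<phi>' a t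
         + (\<Sum>b<K' a. ps (k a + k' a b) t * \<phi>'' a b t))"
    proof -
      have 1: "(\<Sum>i<?n. \<phi>2 i t) = (\<Sum>a<K. (\<Sum>i<?n. of_nat (k a) * t i ^ k a) * \<phi>' a t + (\<Sum>b<K' a. ps (k a + k' a b) t * \<phi>'' a b t))"
      proof -
        have "(\<Sum>i<?n. \<phi>2 i t) = (\<Sum>a<K. \<Sum>i<?n. of_nat (k a) * t i ^ k a * \<phi>' a t + t i ^ k a * (\<Sum>b<K' a. t i ^ k' a b * \<phi>'' a b t))"
          unfolding \<phi>2_def by (rule sum.swap)
        also have "\<dots> = (\<Sum>a<K. (\<Sum>i<?n. of_nat (k a) * t i ^ k a) * \<phi>' a t + (\<Sum>b<K' a. ps (k a + k' a b) t * \<phi>'' a b t))"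
        proof (rule sum.cong [OF refl])
          fix a
          have "(\<Sum>i<?n. t i ^ k a * (\<Sum>b<K' a. t i ^ k' a b * \<phi>'' a b t)) = (\<Sum>b<K' a. ps (k a + k' a b) t * \<phi>'' a b t)"
            unfolding sum_distrib_left ps_def sum_distrib_right by (subst sum.swap) (simp add: power_add mult.assoc)
          then show "(\<Sum>i<?n. of_nat (k a) * t i ^ k a * \<phi>' a t + t i ^ k a * (\<Sum>b<K' a. t i ^ k' a b * \<phi>'' a b t)) =
            (\<Sum>i<?n. of_nat (k a) * t i ^ k a) * \<phi>' a t + (\<Sum>b<K' a. ps (k a + k' a b) t * \<phi>'' a b t)"
            by (simp add: sum.distrib sum_distrib_right)
        qed
        finally show ?thesis .
      qed
      have 2: "(\<Sum>i<?n. \<Sum>j\<in>{..<?n} - {i}. t i / (t i - t j) * \<phi>1 i t) = (\<Sum>a<K. (\<Sum>i<?n. \<Sum>j\<in>{..<?n} - {i}. t i / (t i - t j) * t i ^ k a) * \<phi>' a t)"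
      proof -
        have "(\<Sum>i<?n. \<Sum>j\<in>{..<?n} - {i}. t i / (t i - t j) * \<phi>1 i t) =
           (\<Sum>i<?n. \<Sum>a<K. (\<Sum>j\<in>{..<?n} - {i}. t i / (t i - t j) * t i ^ k a) * \<phi>' a t)"
        proof (rule sum.cong [OF refl])
          fix i
          show "(\<Sum>j\<in>{..<?n} - {i}. t i / (t i - t j) * \<phi>1 i t) =
            (\<Sum>a<K. (\<Sum>j\<in>{..<?n} - {i}. t i / (t i - t j) * t i ^ k a) * \<phi>' a t)"
            unfolding \<phi>1_def sum_distrib_left sum_distrib_right by (subst sum.swap) (simp add: mult.assoc)
        qed
        also have "\<dots> = (\<Sum>a<K. \<Sum>i<?n. (\<Sum>j\<in>{..<?n} - {i}. t i / (t i - t j) * t i ^ k a) * \<phi>' a t)" by (rule sum.swap)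
        finally show ?thesis by (simp add: sum_distrib_right)
      qed
      have 3: "(\<Sum>i<?n. \<phi>1 i t) = (\<Sum>a<K. ps (k a) t * \<phi>' a t)"
        unfolding \<phi>1_def ps_def sum_distrib_right by (rule sum.swap)
      have lin: "(\<Sum>a<K. X a * f a + W a) + 2 * (\<Sum>a<K. Y a * f a) - c * (\<Sum>a<K. Z a * f a) =
         (\<Sum>a<K. (X a + 2 * Y a - c * Z a) * f a + W a)" for X Y Z W f :: "nat \<Rightarrow> complex" and c
        by (simp add: sum.distrib sum_subtractf sum_distrib_left algebra_simps)
      show ?thesis unfolding 1 2 3 by (rule lin)
    qed
    also have "\<dots> = \<psi> t" unfolding R \<psi>_def ..
    finally show "\<psi> t = (\<Sum>i<?n. \<phi>2 i t) + 2 * (\<Sum>i<?n. \<Sum>j\<in>{..<?n} - {i}. t i / (t i - t j) * \<phi>1 i t) - (of_nat ?n - 1) * (\<Sum>i<?n. \<phi>1 i t)" by simp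
  qed
qed

section \<open>Alternants and their Casimir eigenvalues\<close>

definition alt :: "nat \<Rightarrow> (nat \<Rightarrow> int) \<Rightarrow> (nat \<Rightarrow> complex) \<Rightarrow> complex"
  where "alt n \<beta> x = matdet n (\<lambda>j k. x j powi \<beta> k)"

definition stair :: "nat \<Rightarrow> nat \<Rightarrow> int"
  where "stair n k = int n - 1 - int k"

lemma alt_stair: "alt n (stair n) x = vand n x"
  unfolding alt_def stair_def by (rule det_staircase)

lemma alternant_eq_alt: "alternant n l x = alt n (\<lambda>k. stair n k + l k) x"
  by (simp add: alternant_def alt_def stair_def)

lemma alt_leibniz: "alt n \<beta> x = (\<Sum>p | p permutes {..<n}. of_int (sign p) * (\<Prod>i<n. x i powi \<beta> (p i)))"
  unfolding alt_def by (rule det_mat_leibniz)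

lemma alt_permute:
  "p permutes {..<n} \<Longrightarrow> alt n (\<lambda>k. \<beta> (p k)) x = of_int (sign p) * alt n \<beta> x"
  unfolding alt_def by (rule det_mat_permute_cols)

lemma alt_cong: "(\<And>k. k < n \<Longrightarrow> \<beta> k = \<gamma> k) \<Longrightarrow> alt n \<beta> x = alt n \<gamma> x"
  unfolding alt_def by (rule det_mat_cong) simp

lemma alt_eq_0:
  assumes "\<not> inj_on \<beta> {..<n}"
  shows "alt n \<beta> x = 0"
proof -
  obtain i j where ij: "i < n" "j < n" "i \<noteq> j" "\<beta> i = \<beta> j" using assms by (auto simp: inj_on_def)
  define p where "p = Transposition.transpose i j"
  have p: "p permutes {..<n}" unfolding p_def using ij by (intro permutes_swap_id) auto
  have "alt n (\<lambda>k. \<beta> (p k)) x = of_int (sign p) * alt n \<beta> x" by (rule alt_permute[OF p])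
  moreover have "alt n (\<lambda>k. \<beta> (p k)) x = alt n \<beta> x"
    using ij by (intro alt_cong) (auto simp: p_def Transposition.transpose_def)
  moreover have "sign p = -1" unfolding p_def using ij by (simp add: sign_swap_id)
  ultimately show ?thesis by simp
qed

definition generic_tuple :: "nat \<Rightarrow> (nat \<Rightarrow> complex) \<Rightarrow> bool"
  where "generic_tuple n t \<longleftrightarrow> inj_on t {..<n} \<and> (\<forall>j<n. t j \<noteq> 0)"

lemma vand_nonzero: "inj_on t {..<n} \<Longrightarrow> vand n t \<noteq> (0 :: complex)"
  by (auto simp: vand_def inj_on_def)

text \<open>A generic tuple stays generic when one coordinate moves a little, so identities that are
  known at generic tuples only may be differentiated.\<close>

lemma has_theta_unique:
  assumes eq: "\<And>t. generic_tuple n t \<Longrightarrow> f t = g t"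
    and t: "generic_tuple n t" and i: "i < n"
    and f: "has_theta f i t d" and g: "has_theta g i t e"
  shows "d = e"
proof -
  define S where "S = - (insert 0 (t ` ({..<n} - {i})))"
  have "open S" unfolding S_def by (intro open_Compl finite_imp_closed) auto
  moreover have tS: "t i \<in> S" using t i by (auto simp: S_def generic_tuple_def inj_on_def)
  moreover have "g (t(i := x)) = f (t(i := x))" if "x \<in> S" for x
  proof (rule eq[symmetric])
    have x: "t j \<noteq> x" if "j < n" "j \<noteq> i" for j using \<open>x \<in> S\<close> that by (auto simp: S_def)
    have "x \<noteq> 0" using \<open>x \<in> S\<close> by (auto simp: S_def)
    moreover have "inj_on (t(i := x)) {..<n}"
    proof (rule inj_onI)
      fix a b assume ab: "a \<in> {..<n}" "b \<in> {..<n}" "(t(i := x)) a = (t(i := x)) b"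
      show "a = b"
        using ab x[of a] x[of b] t inj_onD[of t "{..<n}" a b]
        by (cases "a = i"; cases "b = i") (simp_all add: generic_tuple_def)
    qed
    ultimately show "generic_tuple n (t(i := x))" using t by (auto simp: generic_tuple_def)
  qed
  ultimately have "((\<lambda>x. f (t(i := x))) has_field_derivative e / t i) (at (t i))"
    by (intro has_field_derivative_transform_within_open[OF g[unfolded has_theta_def]])
  then have "d / t i = e / t i" using f unfolding has_theta_def by (rule DERIV_unique[rotated])
  then show ?thesis using t i by (simp add: generic_tuple_def)
qed

lemma has_theta_monomial:
  assumes "i < n" "t i \<noteq> 0"
  shows "has_theta (\<lambda>t. \<Prod>a<n. t a powi \<gamma> a) i t (of_int (\<gamma> i) * (\<Prod>a<n. t a powi \<gamma> a))"
proof -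
  let ?C = "\<Prod>a\<in>{..<n} - {i}. t a powi \<gamma> a"
  have e: "(\<Prod>a<n. (t(i := x)) a powi \<gamma> a) = x powi \<gamma> i * ?C" for x
    using assms by (subst prod.remove[of _ i]) (auto intro!: prod.cong)
  have "has_theta (\<lambda>t. t i powi \<gamma> i) i t (of_int (\<gamma> i) * t i powi \<gamma> i)"
    using has_theta_powi[of t i i "\<gamma> i"] assms by simp
  then have "((\<lambda>x. x powi \<gamma> i * ?C) has_field_derivative of_int (\<gamma> i) * t i powi \<gamma> i / t i * ?C) (at (t i))"
    unfolding has_theta_def by (intro DERIV_cmult_right) simp
  moreover have "(\<Prod>a<n. t a powi \<gamma> a) = t i powi \<gamma> i * ?C" using e[of "t i"] by simp
  ultimately show ?thesis unfolding has_theta_def e by (simp add: mult_ac)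
qed

text \<open>The Leibniz expansion of an alternant, each term weighted by a function of the exponent
  of the variable \<open>i\<close>. The Euler operator in this variable multiplies the weight by
  that exponent, so the family is closed under it.\<close>

definition alt_weighted :: "nat \<Rightarrow> (nat \<Rightarrow> int) \<Rightarrow> (int \<Rightarrow> complex) \<Rightarrow> nat \<Rightarrow> (nat \<Rightarrow> complex) \<Rightarrow> complex"
  where "alt_weighted n \<beta> w i x =
    (\<Sum>p | p permutes {..<n}. (of_int (sign p) * w (\<beta> (p i))) * (\<Prod>a<n. x a powi \<beta> (p a)))"

lemma alt_weighted_1: "alt_weighted n \<beta> (\<lambda>_. 1) i = alt n \<beta>"
  by (simp add: alt_weighted_def alt_leibniz fun_eq_iff)

lemma has_theta_alt_weighted:
  assumes "i < n" "t i \<noteq> 0"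
  shows "has_theta (alt_weighted n \<beta> w i) i t (alt_weighted n \<beta> (\<lambda>b. w b * of_int b) i t)"
proof -
  have "has_theta (\<lambda>t. \<Sum>p | p permutes {..<n}. (of_int (sign p) * w (\<beta> (p i))) * (\<Prod>a<n. t a powi \<beta> (p a))) i t
    (\<Sum>p | p permutes {..<n}. 0 * (\<Prod>a<n. t a powi \<beta> (p a)) +
       (of_int (sign p) * w (\<beta> (p i))) * (of_int (\<beta> (p i)) * (\<Prod>a<n. t a powi \<beta> (p a))))"
    by (intro has_theta_sum has_theta_mult has_theta_const has_theta_monomial[where \<gamma> = "\<lambda>a. \<beta> (_ a)"] assms)
  then show ?thesis by (simp add: alt_weighted_def[abs_def] mult_ac)
qed

text \<open>Summed over all variables the weight no longer depends on the permutation. Alternants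
  are therefore eigenfunctions of the sum of the Euler operators and of the sum of their
  squares.\<close>

lemma sum_alt_weighted: "(\<Sum>i<n. alt_weighted n \<beta> w i x) = (\<Sum>k<n. w (\<beta> k)) * alt n \<beta> x"
proof -
  have "(\<Sum>i<n. alt_weighted n \<beta> w i x) =
     (\<Sum>p | p permutes {..<n}. (\<Sum>i<n. w (\<beta> (p i))) * (of_int (sign p) * (\<Prod>a<n. x a powi \<beta> (p a))))"
    unfolding alt_weighted_def by (subst sum.swap) (simp add: sum_distrib_left sum_distrib_right mult_ac)
  also have "\<dots> = (\<Sum>p | p permutes {..<n}. (\<Sum>k<n. w (\<beta> k)) * (of_int (sign p) * (\<Prod>a<n. x a powi \<beta> (p a))))"
  proof (rule sum.cong [OF refl])
    fix p assume "p \<in> {p. p permutes {..<n}}"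
    then have "(\<Sum>i<n. w (\<beta> (p i))) = (\<Sum>k<n. w (\<beta> k))"
      using sum.permute[of p "{..<n}" "\<lambda>k. w (\<beta> k)"] by (simp add: comp_def)
    then show "(\<Sum>i<n. w (\<beta> (p i))) * (of_int (sign p) * (\<Prod>a<n. x a powi \<beta> (p a))) =
      (\<Sum>k<n. w (\<beta> k)) * (of_int (sign p) * (\<Prod>a<n. x a powi \<beta> (p a)))" by simp
  qed
  finally show ?thesis by (simp add: alt_leibniz sum_distrib_left)
qed

lemma has_theta_prod:
  assumes "finite S" "\<And>a. a \<in> S \<Longrightarrow> has_theta (\<phi> a) i t (d a)" "\<And>a. a \<in> S \<Longrightarrow> \<phi> a t \<noteq> 0"
  shows "has_theta (\<lambda>t. \<Prod>a\<in>S. \<phi> a t) i t ((\<Prod>a\<in>S. \<phi> a t) * (\<Sum>a\<in>S. d a / \<phi> a t))"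
  using assms
proof (induction S)
  case empty
  then show ?case using has_theta_const[of 1] by simp
next
  case (insert a S)
  have "has_theta (\<lambda>t. \<phi> a t * (\<Prod>a\<in>S. \<phi> a t)) i t
    (d a * (\<Prod>a\<in>S. \<phi> a t) + \<phi> a t * ((\<Prod>a\<in>S. \<phi> a t) * (\<Sum>a\<in>S. d a / \<phi> a t)))"
    using insert by (intro has_theta_mult) auto
  moreover have "\<phi> a t \<noteq> 0" using insert by auto
  then have "d a * (\<Prod>a\<in>S. \<phi> a t) + \<phi> a t * ((\<Prod>a\<in>S. \<phi> a t) * (\<Sum>a\<in>S. d a / \<phi> a t)) =
    (\<phi> a t * (\<Prod>a\<in>S. \<phi> a t)) * (d a / \<phi> a t + (\<Sum>a\<in>S. d a / \<phi> a t))"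
    by (simp add: distrib_left)
  ultimately show ?case using insert by simp
qed

lemma has_theta_vand:
  assumes t: "generic_tuple n t" and i: "i < n"
  shows "has_theta (vand n) i t (vand n t * (\<Sum>j\<in>{..<n} - {i}. t i / (t i - t j)))"
proof -
  let ?D = "SIGMA j:{..<n}. {..<j}"
  have ti: "t i \<noteq> 0" using t i by (simp add: generic_tuple_def)
  have V: "vand n s = (\<Prod>q\<in>?D. s (snd q) - s (fst q))" for s :: "nat \<Rightarrow> complex"
    unfolding vand_def by (subst prod.Sigma) (auto simp: case_prod_unfold)
  have th: "has_theta (\<lambda>t. t a) i t (if a = i then t i else 0)" for a
    using has_theta_powi[of t i a 1] ti by (simp cong: if_cong)
  have "has_theta (\<lambda>t. t a + (-1) * t j) i t ((if a = i then t i else 0) + (0 * t j + (-1) * (if j = i then t i else 0)))" for a j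
    by (intro has_theta_add has_theta_mult has_theta_const th)
  then have th': "has_theta (\<lambda>t. t a - t j) i t ((if a = i then t i else 0) - (if j = i then t i else 0))" for a j
    by (simp cong: if_cong)
  have "has_theta (\<lambda>t. \<Prod>q\<in>?D. t (snd q) - t (fst q)) i t ((\<Prod>q\<in>?D. t (snd q) - t (fst q)) *
     (\<Sum>q\<in>?D. ((if snd q = i then t i else 0) - (if fst q = i then t i else 0)) / (t (snd q) - t (fst q))))"
  proof (intro has_theta_prod th')
    fix q assume "q \<in> ?D"
    then show "t (snd q) - t (fst q) \<noteq> 0"
      using t inj_onD[of t "{..<n}" "snd q" "fst q"] by (auto simp: generic_tuple_def)
  qed auto
  moreover have "(\<Sum>q\<in>?D. ((if snd q = i then t i else 0) - (if fst q = i then t i else 0)) / (t (snd q) - t (fst q))) =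
     (\<Sum>j\<in>{..<n} - {i}. t i / (t i - t j))"
  proof -
    have "(\<Sum>q\<in>?D. ((if snd q = i then t i else 0) - (if fst q = i then t i else 0)) / (t (snd q) - t (fst q))) =
      (\<Sum>j<n. \<Sum>a<j. (if a = i then t i / (t i - t j) else 0) + (if j = i then t i / (t i - t a) else 0))"
    proof (subst sum.Sigma)
      show "(\<Sum>q\<in>?D. ((if snd q = i then t i else 0) - (if fst q = i then t i else 0)) / (t (snd q) - t (fst q))) =
        (\<Sum>(j, a)\<in>?D. (if a = i then t i / (t i - t j) else 0) + (if j = i then t i / (t i - t a) else 0))"
      proof (rule sum.cong [OF refl], clarify)
        fix j a assume "j < n" "a < j"
        have "- t i / (t a - t i) = t i / (t i - t a)"
          by (metis minus_diff_eq minus_divide_divide)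
        then show "((if snd (j, a) = i then t i else 0) - (if fst (j, a) = i then t i else 0)) / (t (snd (j, a)) - t (fst (j, a))) =
          (if a = i then t i / (t i - t j) else 0) + (if j = i then t i / (t i - t a) else 0)"
          using \<open>a < j\<close> by auto
      qed
    qed auto
    also have "\<dots> = (\<Sum>j<n. (if i < j then t i / (t i - t j) else 0) + (if j = i then \<Sum>a<j. t i / (t i - t a) else 0))"
      by (intro sum.cong refl) (auto simp: sum.distrib)
    also have "\<dots> = (\<Sum>j<n. if i < j then t i / (t i - t j) else 0) + (\<Sum>a<i. t i / (t i - t a))"
      using i by (simp add: sum.distrib)
    also have "(\<Sum>j<n. if i < j then t i / (t i - t j) else 0) = (\<Sum>j\<in>{i<..<n}. t i / (t i - t j))"
      by (rule sum.mono_neutral_cong_right) auto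
    also have "(\<Sum>j\<in>{i<..<n}. t i / (t i - t j)) + (\<Sum>a<i. t i / (t i - t a)) = (\<Sum>j\<in>{i<..<n} \<union> {..<i}. t i / (t i - t j))"
      by (rule sum.union_disjoint[symmetric]) auto
    also have "{i<..<n} \<union> {..<i} = {..<n} - {i}" using i by auto
    finally show ?thesis .
  qed
  ultimately show ?thesis unfolding V[abs_def] by simp
qed

text \<open>Apply the Euler operators twice to \<open>\<phi> * vand = alt\<close> and sum. The mixed
  term is twice a derivative of \<open>\<phi>\<close> times a derivative of the Vandermonde product,
  whose logarithmic derivative is the sum of the \<open>t_i/(t_i - t_j)\<close> in the radial part.
  The Vandermonde product is itself an alternant, with the staircase as exponents, so its own
  eigenvalue is subtracted.\<close>

lemma casimir_eigenvalue:
  assumes \<phi>: "\<And>t. generic_tuple n t \<Longrightarrow> \<phi> t * vand n t = alt n \<beta> t"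
    and \<phi>1: "\<And>t i. i < n \<Longrightarrow> (\<forall>j<n. t j \<noteq> 0) \<Longrightarrow> has_theta \<phi> i t (\<phi>1 i t)"
    and \<phi>2: "\<And>t i. i < n \<Longrightarrow> (\<forall>j<n. t j \<noteq> 0) \<Longrightarrow> has_theta (\<phi>1 i) i t (\<phi>2 i t)"
    and t: "generic_tuple n t"
  shows "(\<Sum>i<n. \<phi>2 i t) + 2 * (\<Sum>i<n. \<Sum>j\<in>{..<n} - {i}. t i / (t i - t j) * \<phi>1 i t) - (of_nat n - 1) * (\<Sum>i<n. \<phi>1 i t) =
    of_int ((\<Sum>k<n. \<beta> k * (\<beta> k - (int n - 1))) - (\<Sum>k<n. stair n k * (stair n k - (int n - 1)))) * \<phi> t"
proof -
  let ?a1 = "alt_weighted n \<beta> (\<lambda>b. 1 * of_int b)" and ?a2 = "alt_weighted n \<beta> (\<lambda>b. (1 * of_int b) * of_int b)"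
  let ?v1 = "alt_weighted n (stair n) (\<lambda>b. 1 * of_int b)" and ?v2 = "alt_weighted n (stair n) (\<lambda>b. (1 * of_int b) * of_int b)"
  have nz: "\<forall>j<n. t j \<noteq> 0" if "generic_tuple n t" for t using that by (simp add: generic_tuple_def)
  have v: "has_theta (vand n) i t (?v1 i t)" if "generic_tuple n t" "i < n" for i t
    using has_theta_alt_weighted[of i n t "stair n" "\<lambda>_. 1"] nz[OF that(1)] that(2)
    by (simp add: alt_weighted_1 alt_stair[abs_def])
  have a: "has_theta (alt n \<beta>) i t (?a1 i t)" if "generic_tuple n t" "i < n" for i t
    using has_theta_alt_weighted[of i n t \<beta> "\<lambda>_. 1"] nz[OF that(1)] that(2)
    by (simp add: alt_weighted_1)
  have 1: "\<phi>1 i t * vand n t + \<phi> t * ?v1 i t = ?a1 i t" if "generic_tuple n t" "i < n" for i t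
    by (rule has_theta_unique[OF \<phi> that has_theta_mult a]) (use that v \<phi>1 nz in auto)
  have 2: "(\<phi>2 i t * vand n t + \<phi>1 i t * ?v1 i t) + (\<phi>1 i t * ?v1 i t + \<phi> t * ?v2 i t) = ?a2 i t" if g: "generic_tuple n t" "i < n" for i t
  proof (rule has_theta_unique[OF 1 g])
    show "has_theta (\<lambda>t. \<phi>1 i t * vand n t + \<phi> t * ?v1 i t) i t
      ((\<phi>2 i t * vand n t + \<phi>1 i t * ?v1 i t) + (\<phi>1 i t * ?v1 i t + \<phi> t * ?v2 i t))"
      using g nz[OF g(1)] by (intro has_theta_add has_theta_mult v \<phi>1 \<phi>2 has_theta_alt_weighted) auto
    show "has_theta (?a1 i) i t (?a2 i t)"
      using g nz[OF g(1)] by (intro has_theta_alt_weighted) auto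
  qed (use g in auto)
  have 3: "?v1 i t = vand n t * (\<Sum>j\<in>{..<n} - {i}. t i / (t i - t j))" if "i < n" for i
    by (rule has_theta_unique[OF refl t that v[OF t that] has_theta_vand[OF t that]])
  let ?V = "vand n t"
  have V: "?V \<noteq> 0" using t by (intro vand_nonzero) (simp add: generic_tuple_def)
  have alt: "alt n \<beta> t = \<phi> t * ?V" using \<phi>[OF t] by simp
  have "(\<Sum>i<n. \<phi>1 i t) * ?V + \<phi> t * (\<Sum>i<n. ?v1 i t) = (\<Sum>i<n. ?a1 i t)"
    using 1[OF t] by (simp add: sum_distrib_left sum_distrib_right sum.distrib[symmetric])
  then have "(\<Sum>i<n. \<phi>1 i t) * ?V = ((\<Sum>k<n. of_int (\<beta> k)) - (\<Sum>k<n. of_int (stair n k))) * \<phi> t * ?V"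
    unfolding sum_alt_weighted alt_stair alt by (simp add: algebra_simps)
  then have E: "(\<Sum>i<n. \<phi>1 i t) = ((\<Sum>k<n. of_int (\<beta> k)) - (\<Sum>k<n. of_int (stair n k))) * \<phi> t"
    using V by simp
  have "(\<Sum>i<n. \<phi>2 i t) * ?V + 2 * (\<Sum>i<n. \<phi>1 i t * ?v1 i t) + \<phi> t * (\<Sum>i<n. ?v2 i t) =
    (\<Sum>i<n. (\<phi>2 i t * vand n t + \<phi>1 i t * ?v1 i t) + (\<phi>1 i t * ?v1 i t + \<phi> t * ?v2 i t))"
    by (simp only: sum.distrib sum_distrib_left sum_distrib_right mult_2 add.assoc)
  also have "\<dots> = (\<Sum>i<n. ?a2 i t)" by (intro sum.cong refl) (use 2[OF t] in auto)
  finally have *: "(\<Sum>i<n. \<phi>2 i t) * ?V + 2 * (\<Sum>i<n. \<phi>1 i t * ?v1 i t) + \<phi> t * (\<Sum>i<n. ?v2 i t) = (\<Sum>i<n. ?a2 i t)" .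
  have "(\<Sum>i<n. \<phi>1 i t * ?v1 i t) = (\<Sum>i<n. \<Sum>j\<in>{..<n} - {i}. t i / (t i - t j) * \<phi>1 i t) * ?V"
    unfolding sum_distrib_right[of _ _ ?V]
  proof (rule sum.cong [OF refl])
    fix i assume "i \<in> {..<n}"
    then show "\<phi>1 i t * ?v1 i t = (\<Sum>j\<in>{..<n} - {i}. t i / (t i - t j) * \<phi>1 i t * ?V)"
      by (subst 3) (auto simp: sum_distrib_left mult_ac)
  qed
  with * have "((\<Sum>i<n. \<phi>2 i t) + 2 * (\<Sum>i<n. \<Sum>j\<in>{..<n} - {i}. t i / (t i - t j) * \<phi>1 i t)) * ?V =
    ((\<Sum>k<n. of_int (\<beta> k) * of_int (\<beta> k)) - (\<Sum>k<n. of_int (stair n k) * of_int (stair n k))) * \<phi> t * ?V"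
    unfolding sum_alt_weighted alt_stair alt by (simp add: algebra_simps)
  then have "(\<Sum>i<n. \<phi>2 i t) + 2 * (\<Sum>i<n. \<Sum>j\<in>{..<n} - {i}. t i / (t i - t j) * \<phi>1 i t) =
    ((\<Sum>k<n. of_int (\<beta> k) * of_int (\<beta> k)) - (\<Sum>k<n. of_int (stair n k) * of_int (stair n k))) * \<phi> t"
    using V by simp
  then show ?thesis unfolding E
    by (simp add: algebra_simps sum.distrib sum_subtractf sum_distrib_left sum_distrib_right)
qed

text \<open>Every integer outside \<open>{0..n - 1}\<close> contributes a positive, every inside one a nonpositive term.\<close>

lemma casimir_eigenvalue_nonzero:
  fixes \<beta> :: "nat \<Rightarrow> int"
  assumes inj: "inj_on \<beta> {..<n}" and ne: "\<beta> ` {..<n} \<noteq> {0..int n - 1}"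
  shows "(\<Sum>k<n. \<beta> k * (\<beta> k - (int n - 1))) \<noteq> (\<Sum>k<n. stair n k * (stair n k - (int n - 1)))"
proof -
  define q where "q x = x * (x - (int n - 1))" for x :: int
  define G I where "G = \<beta> ` {..<n}" and "I = {0..int n - 1}"
  have 1: "(\<Sum>k<n. q (\<beta> k)) = (\<Sum>x\<in>G. q x)" unfolding G_def by (simp add: sum.reindex[OF inj])
  have 2: "(\<Sum>k<n. q (stair n k)) = (\<Sum>x\<in>I. q x)"
    by (rule sum.reindex_bij_witness[where i = "\<lambda>x. nat (int n - 1 - x)" and j = "stair n"]) (auto simp: stair_def I_def)
  have card: "card G = n" "card I = n" unfolding G_def I_def using card_image[OF inj] by auto
  have fin: "finite G" "finite I" by (auto simp: G_def I_def)
  have "G - I \<noteq> {}"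
  proof
    assume "G - I = {}"
    then have "G = I" using card fin by (intro card_subset_eq) auto
    then show False using ne by (simp add: G_def I_def)
  qed
  moreover have "q x > 0" if "x \<in> G - I" for x
  proof -
    have "n > 0" using that by (cases n) (auto simp: G_def)
    have "x < 0 \<or> x > int n - 1" using that by (auto simp: I_def)
    then show ?thesis
    proof
      assume "x < 0"
      then show ?thesis unfolding q_def using \<open>n > 0\<close> by (intro mult_neg_neg) auto
    next
      assume "x > int n - 1"
      then show ?thesis unfolding q_def using \<open>n > 0\<close> by (intro mult_pos_pos) auto
    qed
  qed
  ultimately have "(\<Sum>x\<in>G - I. q x) > 0" using fin by (intro sum_pos) auto
  moreover have "(\<Sum>x\<in>I - G. q x) \<le> 0"
    by (intro sum_nonpos) (auto simp: I_def q_def intro: mult_nonneg_nonpos)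
  moreover have "(\<Sum>x\<in>G. q x) = (\<Sum>x\<in>G - I. q x) + (\<Sum>x\<in>G \<inter> I. q x)"
    using sum.Int_Diff[OF fin(1), of q I] by simp
  moreover have "(\<Sum>x\<in>I. q x) = (\<Sum>x\<in>I - G. q x) + (\<Sum>x\<in>G \<inter> I. q x)"
    using sum.Int_Diff[OF fin(2), of q G] by (simp add: Int_commute)
  ultimately have "(\<Sum>x\<in>G. q x) \<noteq> (\<Sum>x\<in>I. q x)" by linarith
  then show ?thesis using 1 2 by (simp add: q_def)
qed

section \<open>Schur functions as class functions\<close>

lemma det_minus: "det (\<chi> i j. - g $ i $ j) = (-1) ^ CARD('n) * det (g :: complex^'n^'n)"
  unfolding Determinants.det_def
  by (simp add: sum_distrib_left prod_uminus mult_ac)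

lemma det_conj_transpose: "det (conj_transpose g) = cnj (det (g :: complex^'n^'n))"
proof -
  have "conj_transpose g = Finite_Cartesian_Product.transpose (\<chi> i j. cnj (g $ i $ j))"
    by (simp add: Finite_Cartesian_Product.vec_eq_iff conj_transpose_nth Finite_Cartesian_Product.transpose_def)
  then have "det (conj_transpose g) = det (\<chi> i j. cnj (g $ i $ j))" by (simp add: Determinants.det_transpose)
  then show ?thesis by (simp add: Determinants.det_def)
qed

lemma unitary_det: "g \<in> unitary_group \<Longrightarrow> cnj (det g) * det (g :: complex^'n^'n) = 1"
  using arg_cong[OF unitaryD(1), of g det] by (simp add: Determinants.det_mul det_conj_transpose)

lemma det_eq_prod_eigenvalues:
  fixes g :: "complex^'n^'n"
  assumes "mset ts = eigenvalues_mset g"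
  shows "det g = (\<Prod>i<CARD('n). ts ! i)"
proof -
  have "(-1) ^ CARD('n) * det g = det (\<chi> i j. (if i = j then 0 else 0) - g $ i $ j)"
    by (simp add: det_minus[symmetric])
  also have "\<dots> = (\<Prod>i<CARD('n). 0 - ts ! i)" by (rule det_eigenvalues[OF assms])
  also have "\<dots> = (-1) ^ CARD('n) * (\<Prod>i<CARD('n). ts ! i)" by (simp add: prod_uminus)
  finally show ?thesis by simp
qed

lemma unitary_eigenvalues_nonzero:
  fixes g :: "complex^'n^'n"
  assumes "mset ts = eigenvalues_mset g" "g \<in> unitary_group" "i < CARD('n)"
  shows "ts ! i \<noteq> 0"
proof
  assume "ts ! i = 0"
  then have "det g = 0" using assms(3) by (auto simp: det_eq_prod_eigenvalues[OF assms(1)])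
  then show False using unitary_det[OF assms(2)] by simp
qed

lemma radial_eval:
  fixes F :: "complex^'n^'n \<Rightarrow> complex"
  assumes "radial F \<phi>" "g \<in> unitary_group" "mset ts = eigenvalues_mset g"
  shows "F g = \<phi> ((!) ts)"
  using assms(1)
proof (induction rule: radial.induct)
  case (radial_power_sum k)
  then show ?case by (rule trace_matpow_eigenvalues[OF assms(3)])
next
  case radial_inv_det
  have "cnj (det g) = inverse (det g)"
    using unitary_det[OF assms(2)] inverse_unique[of "det g" "cnj (det g)"] by (simp add: mult.commute)
  then show ?case
    unfolding det_eq_prod_eigenvalues[OF assms(3)] prod_inversef[symmetric] by (simp add: comp_def)
qed auto

lemma tendsto_coordinate: "((\<lambda>y :: nat \<Rightarrow> complex. y i) \<longlongrightarrow> t i) (at t within S)"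
  using continuous_on_product_coordinates[of i, where 'b = complex]
  unfolding continuous_on_def by (auto intro: tendsto_within_subset)

lemma radial_tendsto:
  fixes F :: "complex^'n^'n \<Rightarrow> complex"
  assumes "radial F \<phi>" "\<forall>j<CARD('n). t j \<noteq> 0"
  shows "(\<phi> \<longlongrightarrow> \<phi> t) (at t within S)"
  using assms(1)
proof (induction rule: radial.induct)
  note c = tendsto_coordinate
  {
    case (radial_power_sum k)
    then show ?case by (intro tendsto_intros c)
  next
    case radial_inv_det
    then show ?case using assms(2) by (intro tendsto_intros c) auto
  }
qed (auto intro: tendsto_intros)

section \<open>Approximation by generic tuples\<close>

lemma eventually_at_right_not_in_finite:
  assumes "finite B" shows "eventually (\<lambda>\<epsilon> :: real. \<epsilon> \<notin> B) (at_right 0)"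
proof -
  obtain d where d: "d > 0" "\<And>x. x \<in> B \<Longrightarrow> x \<noteq> 0 \<Longrightarrow> d \<le> dist 0 x"
    using finite_set_avoid[OF assms, of 0] by blast
  show ?thesis
    unfolding eventually_at_right_field
    using d by (intro exI[of _ d]) force
qed

text \<open>The coordinates move with distinct positive speeds, so each zero of a coordinate and
  each coincidence of two of them occurs for at most one \<epsilon>. Along this path a tuple is
  approached through generic ones.\<close>

definition nudge :: "(nat \<Rightarrow> complex) \<Rightarrow> real \<Rightarrow> nat \<Rightarrow> complex"
  where "nudge x \<epsilon> i = x i + of_real \<epsilon> * of_nat (Suc i)"

lemma eventually_nudge_generic: "eventually (\<lambda>\<epsilon>. generic_tuple n (nudge x \<epsilon>)) (at_right 0)"
proof -
  have 1: "finite {\<epsilon>. nudge x \<epsilon> i = 0}" for i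
  proof (rule finite_subset)
    show "{\<epsilon>. nudge x \<epsilon> i = 0} \<subseteq> {Re (- x i / of_nat (Suc i))}"
    proof clarify
      fix \<epsilon> assume "nudge x \<epsilon> i = 0"
      then have "of_real \<epsilon> * of_nat (Suc i) = - x i" by (simp add: nudge_def add_eq_0_iff del: of_nat_Suc)
      then have "of_real \<epsilon> = - x i / of_nat (Suc i)" by (simp add: field_simps del: of_nat_Suc)
      then show "\<epsilon> = Re (- x i / of_nat (Suc i))" by (metis Re_complex_of_real)
    qed
  qed simp
  have 2: "finite {\<epsilon>. nudge x \<epsilon> i = nudge x \<epsilon> j}" if "i \<noteq> j" for i j
  proof (rule finite_subset)
    show "{\<epsilon>. nudge x \<epsilon> i = nudge x \<epsilon> j} \<subseteq> {Re ((x j - x i) / (of_nat (Suc i) - of_nat (Suc j)))}"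
    proof clarify
      fix \<epsilon> assume "nudge x \<epsilon> i = nudge x \<epsilon> j"
      then have "of_real \<epsilon> * (of_nat (Suc i) - of_nat (Suc j)) = x j - x i"
        by (simp add: nudge_def algebra_simps del: of_nat_Suc)
      moreover have "of_nat (Suc i) - of_nat (Suc j) \<noteq> (0 :: complex)" using that by simp
      ultimately have "of_real \<epsilon> = (x j - x i) / (of_nat (Suc i) - of_nat (Suc j))"
        by (metis nonzero_mult_div_cancel_right)
      then show "\<epsilon> = Re ((x j - x i) / (of_nat (Suc i) - of_nat (Suc j)))" by (metis Re_complex_of_real)
    qed
  qed simp
  have "finite ((\<Union>i<n. {\<epsilon>. nudge x \<epsilon> i = 0}) \<union> (\<Union>i<n. \<Union>j\<in>{..<n} - {i}. {\<epsilon>. nudge x \<epsilon> i = nudge x \<epsilon> j}))"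
    using 1 2 by auto
  from eventually_at_right_not_in_finite[OF this] show ?thesis
    by eventually_elim (auto simp: generic_tuple_def inj_on_def)
qed

lemma filterlim_nudge:
  assumes "eventually (\<lambda>\<epsilon>. nudge x \<epsilon> \<in> S) (at_right 0)"
  shows "filterlim (nudge x) (at x within S) (at_right 0)"
proof -
  have "continuous_on UNIV (nudge x)"
    unfolding nudge_def[abs_def] by (intro continuous_on_coordinatewise_then_product continuous_intros)
  then have "(nudge x \<longlongrightarrow> nudge x 0) (at 0 within {0<..})"
    unfolding continuous_on_def by (auto intro: tendsto_within_subset)
  moreover have "nudge x 0 = x" by (simp add: nudge_def fun_eq_iff)
  moreover have "eventually (\<lambda>\<epsilon>. nudge x \<epsilon> \<noteq> x) (at_right 0)"
  proof -
    have "eventually (\<lambda>\<epsilon> :: real. \<epsilon> \<noteq> 0) (at_right 0)" by (auto simp: eventually_at_filter)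
    then show ?thesis
    proof eventually_elim
      case (elim \<epsilon>)
      then have "nudge x \<epsilon> 0 \<noteq> x 0" by (simp add: nudge_def)
      then show ?case by metis
    qed
  qed
  ultimately show ?thesis using assms
    unfolding filterlim_at by (auto simp: eventually_conj_iff)
qed

lemma filterlim_nudge_UNIV: "filterlim (nudge x) (at x) (at_right 0)"
  by (rule filterlim_nudge) simp

text \<open>Both sides have the same values along the nudged path for small \<epsilon>, and limits
  are unique.\<close>

lemma tuple_ext:
  fixes \<phi> \<psi> :: "(nat \<Rightarrow> complex) \<Rightarrow> complex"
  assumes \<phi>: "(\<phi> \<longlongrightarrow> \<phi> t) (at t)" and \<psi>: "(\<psi> \<longlongrightarrow> \<psi> t) (at t)"
    and eq: "\<And>t. generic_tuple n t \<Longrightarrow> \<phi> t = \<psi> t"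
  shows "\<phi> t = \<psi> t"
proof -
  have "((\<lambda>\<epsilon>. \<phi> (nudge t \<epsilon>)) \<longlongrightarrow> \<phi> t) (at_right 0)"
    by (rule filterlim_compose[OF \<phi> filterlim_nudge_UNIV])
  moreover have "((\<lambda>\<epsilon>. \<psi> (nudge t \<epsilon>)) \<longlongrightarrow> \<psi> t) (at_right 0)"
    by (rule filterlim_compose[OF \<psi> filterlim_nudge_UNIV])
  then have "((\<lambda>\<epsilon>. \<phi> (nudge t \<epsilon>)) \<longlongrightarrow> \<psi> t) (at_right 0)"
    by (rule Lim_transform_eventually)
      (use eventually_nudge_generic[of n t] in \<open>eventually_elim, simp add: eq\<close>)
  ultimately show ?thesis by (rule tendsto_unique[rotated]) simp
qed

lemma radial_ext_unitary:
  fixes F G :: "complex^'n^'n \<Rightarrow> complex"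
  assumes F: "radial F \<phi>" and G: "radial G \<psi>"
    and eq: "\<And>t. generic_tuple CARD('n) t \<Longrightarrow> \<phi> t = \<psi> t" and g: "g \<in> unitary_group"
  shows "F g = G g"
proof -
  obtain ts where ts: "mset ts = eigenvalues_mset g" using ex_mset by blast
  show ?thesis
    unfolding radial_eval[OF F g ts] radial_eval[OF G g ts]
    by (rule tuple_ext[OF radial_tendsto[OF F] radial_tendsto[OF G] eq])
      (use unitary_eigenvalues_nonzero[OF ts g] in auto)
qed

text \<open>
  Weyl's integration formula for symmetric Laurent polynomials: the Casimir eigenvalue of a
  Schur function vanishes only if its exponents are a permutation of the staircase.
\<close>

theorem haar_integral_schur:
  fixes M :: "(complex^'n^'n) measure" and F :: "complex^'n^'n \<Rightarrow> complex"
  assumes haar: "normalized_haar_measure M" and F: "radial F \<phi>"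
    and \<phi>: "\<And>t. generic_tuple CARD('n) t \<Longrightarrow> \<phi> t * vand CARD('n) t = alt CARD('n) \<beta> t"
  shows "(LINT g|M. F g) = (\<Sum>\<sigma> | \<sigma> permutes {..<CARD('n)}.
     if \<forall>k<CARD('n). \<beta> k = stair CARD('n) (\<sigma> k) then of_int (sign \<sigma>) else 0)"
proof -
  let ?n = "CARD('n)"
  have V: "vand ?n t \<noteq> 0" if "generic_tuple ?n t" for t
    using that by (intro vand_nonzero) (simp add: generic_tuple_def)
  \<comment> \<open>If the Laurent polynomial is constant at generic tuples, then the function is
    constant on the group, also where eigenvalues coincide, and the total mass is 1.\<close>
  have const: "(LINT g|M. F g) = c" if "\<And>t. generic_tuple ?n t \<Longrightarrow> \<phi> t = c" for c
  proof -
    have "F g = c" if "g \<in> space M" for g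
      using radial_ext_unitary[OF F radial_const[of c]] \<open>\<And>t. _ \<Longrightarrow> \<phi> t = c\<close> that haar_space[OF haar] by auto
    then have "(LINT g|M. F g) = (LINT g|M. c)" by (intro Bochner_Integration.integral_cong) auto
    also have "\<dots> = c" using haar_total[OF haar] by (simp add: measure_def)
    finally show ?thesis .
  qed
  have stair_inj: "inj_on (stair ?n) {..<?n}" by (auto simp: inj_on_def stair_def)
  have stair_im: "stair ?n ` {..<?n} = {0..int ?n - 1}"
  proof (intro equalityI subsetI)
    fix x assume "x \<in> {0..int ?n - 1}"
    then have "x = stair ?n (nat (int ?n - 1 - x))" "nat (int ?n - 1 - x) < ?n" by (auto simp: stair_def)
    then show "x \<in> stair ?n ` {..<?n}" by blast
  qed (auto simp: stair_def)
  show ?thesis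
  proof (cases "\<exists>\<sigma>. \<sigma> permutes {..<?n} \<and> (\<forall>k<?n. \<beta> k = stair ?n (\<sigma> k))")
    case True
    then obtain \<sigma> where \<sigma>: "\<sigma> permutes {..<?n}" "\<And>k. k < ?n \<Longrightarrow> \<beta> k = stair ?n (\<sigma> k)" by blast
    \<comment> \<open>The sum in the statement has at most one nonzero term. It is written over all
      permutations so that it becomes the Leibniz expansion of the coefficient determinant.\<close>
    have uniq: "\<tau> = \<sigma>" if \<tau>: "\<tau> permutes {..<?n}" "\<forall>k<?n. \<beta> k = stair ?n (\<tau> k)" for \<tau>
    proof
      fix k show "\<tau> k = \<sigma> k"
      proof (cases "k < ?n")
        case True
        then have "stair ?n (\<tau> k) = stair ?n (\<sigma> k)" using \<sigma> \<tau> by metis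
        then show ?thesis by (simp add: stair_def)
      next
        case False
        then show ?thesis using \<sigma>(1) \<tau>(1) by (metis lessThan_iff permutes_not_in)
      qed
    qed
    have "\<phi> t = of_int (sign \<sigma>)" if t: "generic_tuple ?n t" for t
    proof -
      have "alt ?n \<beta> t = alt ?n (\<lambda>k. stair ?n (\<sigma> k)) t" by (rule alt_cong) (use \<sigma> in auto)
      also have "\<dots> = of_int (sign \<sigma>) * vand ?n t" using alt_permute[OF \<sigma>(1)] by (simp add: alt_stair)
      finally show ?thesis using \<phi>[OF t] V[OF t] by simp
    qed
    then have "(LINT g|M. F g) = of_int (sign \<sigma>)" by (rule const)
    also have "\<dots> = (\<Sum>\<tau> | \<tau> permutes {..<?n}. if \<tau> = \<sigma> then of_int (sign \<sigma>) else 0)"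
      using \<sigma>(1) by (simp add: finite_permutations)
    also have "\<dots> = (\<Sum>\<tau> | \<tau> permutes {..<?n}. if \<forall>k<?n. \<beta> k = stair ?n (\<tau> k) then of_int (sign \<tau>) else 0)"
      using \<sigma>(2) uniq by (intro sum.cong refl) auto
    finally show ?thesis .
  next
    case False
    then have "(\<Sum>\<sigma> | \<sigma> permutes {..<?n}. if \<forall>k<?n. \<beta> k = stair ?n (\<sigma> k) then of_int (sign \<sigma>) else 0) = (0 :: complex)"
      by (intro sum.neutral) auto
    moreover have "(LINT g|M. F g) = 0"
    proof (cases "inj_on \<beta> {..<?n}")
      case inj: True
      have ne: "\<beta> ` {..<?n} \<noteq> {0..int ?n - 1}"
      proof
        assume im: "\<beta> ` {..<?n} = {0..int ?n - 1}"
        \<comment> \<open>An injective \<beta> with values filling \<open>{0..n-1}\<close> is a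
          rearranged staircase; solving \<open>stair n (\<sigma> k) = \<beta> k\<close> gives this
          permutation, contrary to the case at hand.\<close>
        define \<sigma> where "\<sigma> k = (if k < ?n then nat (int ?n - 1 - \<beta> k) else k)" for k
        have r: "0 \<le> \<beta> k" "\<beta> k \<le> int ?n - 1" if "k < ?n" for k
        proof -
          have "\<beta> k \<in> {0..int ?n - 1}" using im that by blast
          then show "0 \<le> \<beta> k" "\<beta> k \<le> int ?n - 1" by auto
        qed
        have s: "\<beta> k = stair ?n (\<sigma> k)" if "k < ?n" for k using r[OF that] that by (simp add: \<sigma>_def stair_def)
        have "inj_on \<sigma> {..<?n}"
        proof (rule inj_onI)
          fix a b assume "a \<in> {..<?n}" "b \<in> {..<?n}" "\<sigma> a = \<sigma> b"
          then show "a = b" using s[of a] s[of b] inj_onD[OF inj, of a b] by auto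
        qed
        moreover have "\<sigma> ` {..<?n} \<subseteq> {..<?n}" using r by (fastforce simp: \<sigma>_def)
        ultimately have "bij_betw \<sigma> {..<?n} {..<?n}"
          by (simp add: bij_betw_def endo_inj_surj)
        then have "\<sigma> permutes {..<?n}" by (rule bij_imp_permutes) (auto simp: \<sigma>_def)
        then show False using False s by blast
      qed
      obtain \<Psi> \<psi> \<phi>1 \<phi>2 where c: "radial \<Psi> \<psi>" "(LINT g|M. \<Psi> g) = 0"
        "\<And>t i. i < ?n \<Longrightarrow> (\<forall>j<?n. t j \<noteq> 0) \<Longrightarrow> has_theta \<phi> i t (\<phi>1 i t)"
        "\<And>t i. i < ?n \<Longrightarrow> (\<forall>j<?n. t j \<noteq> 0) \<Longrightarrow> has_theta (\<phi>1 i) i t (\<phi>2 i t)"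
        "\<And>t. (\<forall>j<?n. t j \<noteq> 0) \<Longrightarrow> inj_on t {..<?n} \<Longrightarrow>
      \<psi> t = (\<Sum>i<?n. \<phi>2 i t) + 2 * (\<Sum>i<?n. \<Sum>j\<in>{..<?n} - {i}. t i / (t i - t j) * \<phi>1 i t)
         - (of_nat ?n - 1) * (\<Sum>i<?n. \<phi>1 i t)"
        by (rule radial_casimir[OF haar F]) (rule that)
      define d where "d = (\<Sum>k<?n. \<beta> k * (\<beta> k - (int ?n - 1))) - (\<Sum>k<?n. stair ?n k * (stair ?n k - (int ?n - 1)))"
      have d: "d \<noteq> 0" using casimir_eigenvalue_nonzero[OF inj ne] by (simp add: d_def)
      have e: "\<psi> t = of_int d * \<phi> t" if t: "generic_tuple ?n t" for t
      proof -
        have "\<forall>j<?n. t j \<noteq> 0" "inj_on t {..<?n}" using t by (simp_all add: generic_tuple_def)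
        from c(5)[OF this] casimir_eigenvalue[OF \<phi> c(3,4) t] show ?thesis unfolding d_def by (rule trans)
      qed
      have "\<Psi> g = of_int d * F g" if "g \<in> unitary_group" for g
        by (rule radial_ext_unitary[OF c(1) radial_mult[OF radial_const[of "of_int d"] F] e that])
      then have "(LINT g|M. \<Psi> g) = (LINT g|M. of_int d * F g)"
        by (intro Bochner_Integration.integral_cong) (auto simp: haar_space[OF haar])
      then have "of_int d * (LINT g|M. F g) = 0" using c(2) by simp
      then show ?thesis using d by simp
    next
      case noninj: False
      show ?thesis
        by (rule const) (use \<phi> V alt_eq_0[OF noninj] in \<open>metis mult_eq_0_iff\<close>)
    qed
    ultimately show ?thesis by simp
  qed
qed

section \<open>Newton's identities and the Jacobi-Trudi identity\<close>

definition geo_fps :: "complex \<Rightarrow> complex fps"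
  where "geo_fps c = Abs_fps (\<lambda>k. c ^ k)"

lemma geo_fps_mult: "geo_fps c * (1 - fps_const c * fps_X) = 1"
proof (rule fps_ext)
  fix k
  have "geo_fps c * (1 - fps_const c * fps_X) = geo_fps c - fps_const c * (geo_fps c * fps_X)"
    by (simp add: algebra_simps)
  then show "fps_nth (geo_fps c * (1 - fps_const c * fps_X)) k = fps_nth 1 k"
    by (cases k) (auto simp: geo_fps_def)
qed

lemma geo_fps_deriv: "fps_X * fps_deriv (geo_fps c) = (geo_fps c - 1) * geo_fps c"
proof -
  have g: "fps_const c * fps_X * geo_fps c = geo_fps c - 1"
    using geo_fps_mult[of c] by (simp add: algebra_simps)
  have "fps_deriv (geo_fps c * (1 - fps_const c * fps_X)) = 0" unfolding geo_fps_mult by simp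
  then have "fps_deriv (geo_fps c) * (1 - fps_const c * fps_X) = fps_const c * geo_fps c"
    by (simp add: algebra_simps)
  then have "(fps_deriv (geo_fps c) * (1 - fps_const c * fps_X)) * geo_fps c = fps_const c * geo_fps c * geo_fps c"
    by simp
  then have "fps_deriv (geo_fps c) = fps_const c * geo_fps c * geo_fps c"
    using geo_fps_mult[of c] by (simp only: mult.assoc mult.commute[of "1 - fps_const c * fps_X"]) simp
  then have "fps_X * fps_deriv (geo_fps c) = (fps_const c * fps_X * geo_fps c) * geo_fps c" by (simp add: mult_ac)
  then show ?thesis unfolding g .
qed

definition hom_fps :: "nat \<Rightarrow> (nat \<Rightarrow> complex) \<Rightarrow> complex fps"
  where "hom_fps n t = (\<Prod>i<n. geo_fps (t i))"

definition complete_hom :: "nat \<Rightarrow> nat \<Rightarrow> (nat \<Rightarrow> complex) \<Rightarrow> complex"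
  where "complete_hom n k t = fps_nth (hom_fps n t) k"

text \<open>The logarithmic derivative of a product of geometric series; it is the generating
  function of the power sums. Comparing coefficients gives Newton's identities.\<close>

lemma hom_fps_deriv: "fps_X * fps_deriv (hom_fps n t) = (\<Sum>i<n. geo_fps (t i) - 1) * hom_fps n t"
proof (induction n)
  case (Suc n)
  have "fps_X * fps_deriv (hom_fps (Suc n) t) =
    (fps_X * fps_deriv (hom_fps n t)) * geo_fps (t n) + hom_fps n t * (fps_X * fps_deriv (geo_fps (t n)))"
    by (simp add: hom_fps_def algebra_simps)
  also have "\<dots> = (\<Sum>i<Suc n. geo_fps (t i) - 1) * hom_fps (Suc n) t"
    unfolding Suc geo_fps_deriv by (simp add: hom_fps_def algebra_simps)
  finally show ?case .
qed (simp add: hom_fps_def)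

lemma newton_complete_hom:
  "of_nat (Suc k) * complete_hom n (Suc k) t = (\<Sum>j\<le>k. (\<Sum>i<n. t i ^ Suc j) * complete_hom n (k - j) t)"
proof -
  have "of_nat (Suc k) * complete_hom n (Suc k) t = fps_nth (fps_X * fps_deriv (hom_fps n t)) (Suc k)"
    by (simp add: complete_hom_def)
  also have "\<dots> = (\<Sum>j=0..Suc k. fps_nth (\<Sum>i<n. geo_fps (t i) - 1) j * fps_nth (hom_fps n t) (Suc k - j))"
    unfolding hom_fps_deriv by (rule fps_mult_nth)
  also have "\<dots> = (\<Sum>j=0..k. fps_nth (\<Sum>i<n. geo_fps (t i) - 1) (Suc j) * fps_nth (hom_fps n t) (k - j))"
    by (subst sum.atLeast0_atMost_Suc_shift) (simp add: fps_sum_nth geo_fps_def)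
  also have "\<dots> = (\<Sum>j\<le>k. (\<Sum>i<n. t i ^ Suc j) * complete_hom n (k - j) t)"
    unfolding atLeast0AtMost by (simp add: fps_sum_nth geo_fps_def complete_hom_def)
  finally show ?thesis .
qed

text \<open>Newton's recursion, after division by \<open>k\<close>, expresses complete symmetric
  polynomials by power sums, which are the traces of powers of \<open>g\<close>.\<close>

lemma radial_complete_hom: "\<exists>F :: complex^'n^'n \<Rightarrow> complex. radial F (complete_hom CARD('n) k)"
proof (induction k rule: less_induct)
  case (less k)
  show ?case
  proof (cases k)
    case 0
    have "fps_nth (hom_fps n t) 0 = 1" for n t by (induction n) (auto simp: hom_fps_def geo_fps_def)
    then have "complete_hom CARD('n) k = (\<lambda>_. 1)" using 0 by (simp add: complete_hom_def fun_eq_iff)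
    then show ?thesis using radial_const[of 1] by auto
  next
    case (Suc k')
    then have "\<forall>j. \<exists>F :: complex^'n^'n \<Rightarrow> complex. radial F (complete_hom CARD('n) (k' - j))" using less by simp
    then obtain F :: "nat \<Rightarrow> complex^'n^'n \<Rightarrow> complex" where F: "\<And>j. radial (F j) (complete_hom CARD('n) (k' - j))" by metis
    have "radial (\<lambda>g. inverse (of_nat (Suc k')) * (\<Sum>j\<le>k'. trace (matpow g (Suc j)) * F j g))
      (\<lambda>t. inverse (of_nat (Suc k')) * (\<Sum>j\<le>k'. (\<Sum>i<CARD('n). t i ^ Suc j) * complete_hom CARD('n) (k' - j) t))"
      by (intro radial_mult radial_const radial_sum radial_power_sum F)
    moreover have "(\<lambda>t. inverse (of_nat (Suc k')) * (\<Sum>j\<le>k'. (\<Sum>i<CARD('n). t i ^ Suc j) * complete_hom CARD('n) (k' - j) t)) = complete_hom CARD('n) k"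
      unfolding newton_complete_hom[symmetric] Suc by (simp add: fun_eq_iff del: of_nat_Suc)
    ultimately show ?thesis by auto
  qed
qed

definition complete_hom_int :: "nat \<Rightarrow> int \<Rightarrow> (nat \<Rightarrow> complex) \<Rightarrow> complex"
  where "complete_hom_int n k t = (if k < 0 then 0 else complete_hom n (nat k) t)"

lemma linear_prod_nth_eq_0:
  assumes "finite S" "k > card S"
  shows "fps_nth (\<Prod>i\<in>S. 1 - fps_const (c i) * fps_X) k = (0 :: complex)"
  using assms
proof (induction S arbitrary: k)
  case (insert a S)
  let ?Q = "\<Prod>i\<in>S. 1 - fps_const (c i) * fps_X :: complex fps"
  have "(1 - fps_const (c a) * fps_X) * ?Q = ?Q - fps_const (c a) * (?Q * fps_X)"
    by (simp add: algebra_simps)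
  moreover have "fps_nth ?Q k = 0" using insert by (intro insert.IH) auto
  moreover have "fps_nth (?Q * fps_X) k = 0" using insert by (cases k) auto
  ultimately show ?case using insert by simp
qed auto

text \<open>Multiplying the generating function of the complete symmetric polynomials by all factors
  \<open>1 - t\<^sub>i x\<close> but one leaves a geometric series.\<close>

lemma power_eq_complete_hom:
  assumes j: "j < n" and k: "0 \<le> k"
  shows "t j powi k = (\<Sum>l<n. complete_hom_int n (k - (int n - 1) + int l) t *
     fps_nth (\<Prod>i\<in>{..<n} - {j}. 1 - fps_const (t i) * fps_X) (n - 1 - l))"
proof -
  let ?Q = "\<Prod>i\<in>{..<n} - {j}. 1 - fps_const (t i) * fps_X :: complex fps"
  have "hom_fps n t * ?Q = geo_fps (t j) * ((\<Prod>i\<in>{..<n} - {j}. geo_fps (t i)) * ?Q)"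
    unfolding hom_fps_def using j by (subst prod.remove[of _ j]) (auto simp: mult_ac)
  also have "(\<Prod>i\<in>{..<n} - {j}. geo_fps (t i)) * ?Q = 1"
    by (simp add: prod.distrib[symmetric] geo_fps_mult)
  finally have "geo_fps (t j) = ?Q * hom_fps n t" by (simp add: mult.commute)
  then have "fps_nth (geo_fps (t j)) (nat k) = (\<Sum>a=0..nat k. fps_nth ?Q a * complete_hom n (nat k - a) t)"
    by (simp add: fps_mult_nth complete_hom_def)
  also have "\<dots> = (\<Sum>a\<in>{0..nat k} \<union> {..<n}. fps_nth ?Q a * complete_hom_int n (k - int a) t)"
    by (rule sum.mono_neutral_cong_left) (use k in \<open>auto simp: complete_hom_int_def nat_diff_distrib\<close>)
  also have "\<dots> = (\<Sum>a<n. fps_nth ?Q a * complete_hom_int n (k - int a) t)"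
  proof (rule sum.mono_neutral_right)
    have "fps_nth ?Q a = 0" if "a \<ge> n" for a
      using that j by (intro linear_prod_nth_eq_0) auto
    then show "\<forall>a\<in>{0..nat k} \<union> {..<n} - {..<n}. fps_nth ?Q a * complete_hom_int n (k - int a) t = 0" by auto
  qed auto
  also have "\<dots> = (\<Sum>l<n. (\<lambda>a. fps_nth ?Q a * complete_hom_int n (k - int a) t) (n - Suc l))"
    by (rule sum.nat_diff_reindex[symmetric])
  also have "\<dots> = (\<Sum>l<n. complete_hom_int n (k - (int n - 1) + int l) t * fps_nth ?Q (n - 1 - l))"
  proof (rule sum.cong [OF refl])
    fix l assume "l \<in> {..<n}"
    then have "k - int (n - Suc l) = k - (int n - 1) + int l" by (simp add: of_nat_diff)
    then show "(\<lambda>a. fps_nth ?Q a * complete_hom_int n (k - int a) t) (n - Suc l) =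
      complete_hom_int n (k - (int n - 1) + int l) t * fps_nth ?Q (n - 1 - l)"
      by (simp only: diff_Suc_eq_diff_pred mult.commute)
  qed
  finally show ?thesis using k by (simp add: geo_fps_def power_int_def)
qed

text \<open>Expanding powers in complete symmetric polynomials factors the matrix of the alternant
  into a matrix of these polynomials and a second factor that does not involve the exponents. For
  the staircase the first factor is unitriangular, so the determinant of the second is the
  Vandermonde product. The expansion of powers requires nonnegative exponents.\<close>

theorem jacobi_trudi:
  assumes "\<And>k. k < n \<Longrightarrow> 0 \<le> \<beta> k"
  shows "matdet n (\<lambda>k l. complete_hom_int n (\<beta> k - (int n - 1) + int l) t) * vand n t = alt n \<beta> t"
proof -
  define q where "q l j = fps_nth (\<Prod>i\<in>{..<n} - {j}. 1 - fps_const (t i) * fps_X :: complex fps) (n - 1 - l)" for l j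
  let ?H = "\<lambda>\<beta>. matdet n (\<lambda>k l. complete_hom_int n (\<beta> k - (int n - 1) + int l) t)"
  let ?Q = "matdet n q"
  have *: "alt n \<gamma> t = ?H \<gamma> * ?Q" if "\<And>k. k < n \<Longrightarrow> 0 \<le> \<gamma> k" for \<gamma>
  proof -
    have "alt n \<gamma> t = matdet n (\<lambda>k j. t j powi \<gamma> k)"
      unfolding alt_def by (rule det_mat_transpose[symmetric, of n "\<lambda>j k. t j powi \<gamma> k"])
    also have "\<dots> = matdet n (\<lambda>k j. \<Sum>l<n. complete_hom_int n (\<gamma> k - (int n - 1) + int l) t * q l j)"
      unfolding q_def by (rule det_mat_cong) (rule power_eq_complete_hom, auto simp: that)
    also have "\<dots> = ?H \<gamma> * ?Q" by (rule det_mat_mult)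
    finally show ?thesis .
  qed
  have h0: "complete_hom n 0 t = 1"
    by (induction n) (auto simp: complete_hom_def hom_fps_def geo_fps_def)
  have "?H (stair n) = (\<Prod>k<n. complete_hom_int n (stair n k - (int n - 1) + int k) t)"
    by (rule det_mat_upper_triangular) (auto simp: complete_hom_int_def stair_def)
  also have "\<dots> = 1" by (simp add: complete_hom_int_def stair_def h0)
  finally have "vand n t = ?Q" using *[of "stair n"] by (simp add: alt_stair stair_def)
  then show ?thesis using *[OF assms] by simp
qed

lemma alt_shift:
  assumes "\<forall>i<n. t i \<noteq> 0"
  shows "alt n (\<lambda>k. \<beta> k + c) t = (\<Prod>i<n. t i powi c) * alt n \<beta> t"
proof -
  have "(\<Prod>i<n. t i powi (\<beta> (p i) + c)) = (\<Prod>i<n. t i powi c) * (\<Prod>i<n. t i powi \<beta> (p i))" for p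
    unfolding prod.distrib[symmetric] using assms
    by (intro prod.cong refl) (subst power_int_add, auto)
  then show ?thesis unfolding alt_leibniz by (simp add: sum_distrib_left mult_ac)
qed

text \<open>All exponents are raised by one number \<open>c\<close> to make Jacobi-Trudi applicable,
  and the shift is undone by the c-th power of the inverse determinant. The Schur function becomes a
  polynomial in traces and in the conjugate determinant, and so a continuous function of
  \<open>g\<close> even where eigenvalues coincide.\<close>

theorem radial_schur_exists:
  "\<exists>(F :: complex^'n^'n \<Rightarrow> complex) \<phi>. radial F \<phi> \<and>
     (\<forall>t. (\<forall>i<CARD('n). t i \<noteq> 0) \<longrightarrow> \<phi> t * vand CARD('n) t = alt CARD('n) \<beta> t)"
proof -
  let ?n = "CARD('n)"
  define c where "c = (\<Sum>k<?n. nat (- \<beta> k))"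
  have pos: "0 \<le> \<beta> k + int c" if "k < ?n" for k
  proof -
    have "nat (- \<beta> k) \<le> c" unfolding c_def by (rule member_le_sum) (use that in auto)
    then show ?thesis by linarith
  qed
  have "\<exists>F :: complex^'n^'n \<Rightarrow> complex. radial F (complete_hom_int ?n k)" for k
  proof (cases "k < 0")
    case True
    then have "complete_hom_int ?n k = (\<lambda>_. 0)" by (simp add: complete_hom_int_def fun_eq_iff)
    then show ?thesis using radial_const[of 0] by auto
  next
    case False
    then have "complete_hom_int ?n k = complete_hom ?n (nat k)" by (simp add: complete_hom_int_def fun_eq_iff)
    then show ?thesis using radial_complete_hom[of "nat k", where 'n = 'n] by simp
  qed
  then obtain H :: "int \<Rightarrow> complex^'n^'n \<Rightarrow> complex" where H: "\<And>k. radial (H k) (complete_hom_int ?n k)" by metis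
  let ?\<phi> = "\<lambda>t. (\<Prod>a<c. \<Prod>i<?n. inverse (t i)) *
    (\<Sum>p | p permutes {..<?n}. of_int (sign p) * (\<Prod>i<?n. complete_hom_int ?n (\<beta> i + int c - (int ?n - 1) + int (p i)) t))"
  have "radial (\<lambda>g. (\<Prod>a<c. cnj (det g)) *
    (\<Sum>p | p permutes {..<?n}. of_int (sign p) * (\<Prod>i<?n. H (\<beta> i + int c - (int ?n - 1) + int (p i)) g))) ?\<phi>"
    by (intro radial_mult radial_prod radial_inv_det radial_sum radial_const H)
  moreover have "?\<phi> t * vand ?n t = alt ?n \<beta> t" if t: "\<forall>i<?n. t i \<noteq> 0" for t
  proof -
    have "?\<phi> t * vand ?n t = (\<Prod>a<c. \<Prod>i<?n. inverse (t i)) * alt ?n (\<lambda>k. \<beta> k + int c) t"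
      using jacobi_trudi[of ?n "\<lambda>k. \<beta> k + int c" t] pos by (simp add: det_mat_leibniz mult.assoc)
    also have "\<dots> = ((\<Prod>a<c. \<Prod>i<?n. inverse (t i)) * (\<Prod>i<?n. t i ^ c)) * alt ?n \<beta> t"
      using alt_shift[OF t, of \<beta> "int c"] by simp
    also have "(\<Prod>a<c. \<Prod>i<?n. inverse (t i)) * (\<Prod>i<?n. t i ^ c) = (\<Prod>i<?n. inverse (t i) ^ c * t i ^ c)"
      by (simp add: prod.distrib prod_power_distrib)
    also have "\<dots> = 1" using t by (intro prod.neutral) (auto simp: power_mult_distrib[symmetric])
    finally show ?thesis by simp
  qed
  ultimately show ?thesis by blast
qed

text \<open>Where arguments coincide, the quotient of alternants agrees with the continuous
  \<open>\<phi>\<close> at nearby tuples with distinct entries, since nonzero entries stay nonzero.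
  The nudged path shows that the filter of the limit is proper, so that \<open>Lim\<close> has this
  value.\<close>

lemma gen_schur_eq_radial:
  fixes F :: "complex^'n^'n \<Rightarrow> complex"
  assumes F: "radial F \<phi>" and \<phi>: "\<And>t. generic_tuple CARD('n) t \<Longrightarrow> \<phi> t * vand CARD('n) t = alternant CARD('n) l t"
    and x: "\<forall>i<CARD('n). x i \<noteq> 0"
  shows "gen_schur CARD('n) l x = \<phi> x"
proof -
  let ?n = "CARD('n)"
  have r: "alternant ?n l t / alternant ?n (\<lambda>_. 0) t = \<phi> t" if t: "generic_tuple ?n t" for t
  proof -
    have "vand ?n t \<noteq> 0" using t by (intro vand_nonzero) (simp add: generic_tuple_def)
    then show ?thesis using \<phi>[OF t] by (simp add: alternant_zero field_simps)
  qed
  show ?thesis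
  proof (cases "inj_on x {..<?n}")
    case True
    then show ?thesis using x r[of x] by (simp add: gen_schur_def generic_tuple_def)
  next
    case False
    let ?S = "{y :: nat \<Rightarrow> complex. inj_on y {..<?n}}"
    have "eventually (\<lambda>y. \<forall>i\<in>{..<?n}. y i \<noteq> 0) (at x within ?S)"
      using x by (intro eventually_ball_finite) (auto intro: tendsto_imp_eventually_ne[OF tendsto_coordinate])
    moreover have "eventually (\<lambda>y. y \<in> ?S) (at x within ?S)" by (auto simp: eventually_at_filter)
    ultimately have "eventually (\<lambda>y. \<phi> y = alternant ?n l y / alternant ?n (\<lambda>_. 0) y) (at x within ?S)"
      by eventually_elim (simp add: r generic_tuple_def)
    then have "((\<lambda>y. alternant ?n l y / alternant ?n (\<lambda>_. 0) y) \<longlongrightarrow> \<phi> x) (at x within ?S)"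
      by (rule Lim_transform_eventually[OF radial_tendsto[OF F x]])
    moreover have "at x within ?S \<noteq> bot"
    proof
      assume bot: "at x within ?S = bot"
      have "filterlim (nudge x) (at x within ?S) (at_right 0)"
        by (rule filterlim_nudge) (use eventually_nudge_generic[of ?n x] in \<open>eventually_elim, simp add: generic_tuple_def\<close>)
      then have "filtermap (nudge x) (at_right 0) = bot" unfolding bot filterlim_def by (simp add: bot.extremum_unique)
      then show False by (simp add: filtermap_bot_iff)
    qed
    ultimately show ?thesis using False by (simp add: gen_schur_def tendsto_Lim)
  qed
qed

section \<open>Evaluation of the twisted moment\<close>

lemma alt_leibniz': "alt n \<beta> x = (\<Sum>p | p permutes {..<n}. of_int (sign p) * (\<Prod>k<n. x (p k) powi \<beta> k))"
proof -
  have "alt n \<beta> x = matdet n (\<lambda>k j. x j powi \<beta> k)"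
    unfolding alt_def by (rule det_mat_transpose[symmetric, of n "\<lambda>j k. x j powi \<beta> k"])
  then show ?thesis by (simp add: det_mat_leibniz)
qed

text \<open>The product on the left is symmetric, so in the Leibniz term of \<open>p\<close> its
  factors can be reindexed by \<open>p\<close>: the one in \<open>t (p k)\<close> joins the power
  with exponent \<open>\<gamma> k\<close>. The choice \<open>f\<close> of coefficients then does not
  depend on \<open>p\<close>, and each choice yields a full alternant.\<close>

lemma alt_mult_symmetric:
  assumes nz: "\<forall>i<n. t i \<noteq> 0" and deg: "degree q \<le> D"
  shows "(\<Prod>j<n. t j powi (- int m) * poly q (t j)) * alt n \<gamma> t =
    (\<Sum>f\<in>PiE {..<n} (\<lambda>_. {..D}). (\<Prod>k<n. coeff q (f k)) * alt n (\<lambda>k. \<gamma> k - int m + int (f k)) t)"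
proof -
  have "(\<Prod>j<n. t j powi (- int m) * poly q (t j)) * (\<Prod>k<n. t (p k) powi \<gamma> k) =
    (\<Sum>f\<in>PiE {..<n} (\<lambda>_. {..D}). (\<Prod>k<n. coeff q (f k)) * (\<Prod>k<n. t (p k) powi (\<gamma> k - int m + int (f k))))"
    if p: "p permutes {..<n}" for p
  proof -
    have "(\<Prod>j<n. t j powi (- int m) * poly q (t j)) = (\<Prod>k<n. t (p k) powi (- int m) * poly q (t (p k)))"
      using prod.permute[OF p, of "\<lambda>j. t j powi (- int m) * poly q (t j)"] by (simp add: comp_def)
    then have "(\<Prod>j<n. t j powi (- int m) * poly q (t j)) * (\<Prod>k<n. t (p k) powi \<gamma> k) =
      (\<Prod>k<n. t (p k) powi (- int m) * poly q (t (p k)) * t (p k) powi \<gamma> k)" by (simp add: prod.distrib)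
    also have "\<dots> = (\<Prod>k<n. \<Sum>b\<le>D. coeff q b * t (p k) powi (\<gamma> k - int m + int b))"
    proof (rule prod.cong [OF refl])
      fix k assume "k \<in> {..<n}"
      then have "p k < n" using permutes_in_image[OF p, of k] by simp
      then have nz': "t (p k) \<noteq> 0" using nz by simp
      have "poly q (t (p k)) = (\<Sum>b\<le>D. coeff q b * t (p k) ^ b)"
        unfolding poly_altdef using deg by (intro sum.mono_neutral_left) (auto simp: coeff_eq_0)
      then show "t (p k) powi (- int m) * poly q (t (p k)) * t (p k) powi \<gamma> k = (\<Sum>b\<le>D. coeff q b * t (p k) powi (\<gamma> k - int m + int b))"
        using nz' by (simp add: sum_distrib_left sum_distrib_right power_int_add power_int_diff power_int_minus field_simps)
    qed
    also have "\<dots> = (\<Sum>f\<in>PiE {..<n} (\<lambda>_. {..D}). \<Prod>k<n. coeff q (f k) * t (p k) powi (\<gamma> k - int m + int (f k)))"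
      by (rule prod_sum_PiE) auto
    finally show ?thesis by (simp add: prod.distrib)
  qed
  then have "(\<Prod>j<n. t j powi (- int m) * poly q (t j)) * alt n \<gamma> t =
    (\<Sum>p | p permutes {..<n}. \<Sum>f\<in>PiE {..<n} (\<lambda>_. {..D}). of_int (sign p) * ((\<Prod>k<n. coeff q (f k)) * (\<Prod>k<n. t (p k) powi (\<gamma> k - int m + int (f k)))))"
    unfolding alt_leibniz' sum_distrib_left by (intro sum.cong refl) (auto simp: sum_distrib_left mult.left_commute)
  also have "\<dots> = (\<Sum>f\<in>PiE {..<n} (\<lambda>_. {..D}). \<Sum>p | p permutes {..<n}. of_int (sign p) * ((\<Prod>k<n. coeff q (f k)) * (\<Prod>k<n. t (p k) powi (\<gamma> k - int m + int (f k)))))"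
    by (rule sum.swap)
  finally show ?thesis by (simp add: alt_leibniz' sum_distrib_left mult.left_commute)
qed

lemma det_scale: "det (\<chi> i j. c * g $ i $ j) = c ^ CARD('n) * det (g :: complex^'n^'n)"
  unfolding Determinants.det_def by (simp add: sum_distrib_left prod.distrib mult_ac)

lemma det_one_minus:
  fixes g :: "complex^'n^'n"
  assumes ts: "mset ts = eigenvalues_mset g"
  shows "det (mat 1 - map_matrix ((*) \<beta>) g) = (\<Prod>i<CARD('n). 1 - \<beta> * ts ! i)"
proof (cases "\<beta> = 0")
  case True
  then have "mat 1 - map_matrix ((*) \<beta>) g = mat 1"
    by (simp add: Finite_Cartesian_Product.vec_eq_iff map_matrix_def)
  then show ?thesis using True by simp
next
  case False
  have "mat 1 - map_matrix ((*) \<beta>) g = (\<chi> i j. \<beta> * (\<chi> i j. (if i = j then inverse \<beta> else 0) - g $ i $ j) $ i $ j)"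
    using False by (auto simp: Finite_Cartesian_Product.vec_eq_iff map_matrix_def mat_1_nth algebra_simps)
  then have "det (mat 1 - map_matrix ((*) \<beta>) g) = \<beta> ^ CARD('n) * (\<Prod>i<CARD('n). inverse \<beta> - ts ! i)"
    using det_scale[of \<beta> "\<chi> i j. (if i = j then inverse \<beta> else 0) - g $ i $ j"] det_eigenvalues[OF ts, of "inverse \<beta>"] by simp
  also have "\<beta> ^ CARD('n) = (\<Prod>i<CARD('n). \<beta>)" by simp
  also have "(\<Prod>i<CARD('n). \<beta>) * (\<Prod>i<CARD('n). inverse \<beta> - ts ! i) = (\<Prod>i<CARD('n). \<beta> * (inverse \<beta> - ts ! i))"
    by (rule prod.distrib[symmetric])
  also have "\<dots> = (\<Prod>i<CARD('n). 1 - \<beta> * ts ! i)"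
    using False by (intro prod.cong refl) (simp add: right_diff_distrib)
  finally show ?thesis .
qed

text \<open>Multiplication by the unitary \<open>g\<close> turns the matrix into
  \<open>g - \<alpha>\<close>, whose determinant is the characteristic polynomial at
  \<open>\<alpha>\<close> up to sign. Dividing by the determinant of \<open>g\<close> gives the
  inverse eigenvalues.\<close>

lemma det_one_minus_conj_transpose:
  fixes g :: "complex^'n^'n"
  assumes ts: "mset ts = eigenvalues_mset g" and g: "g \<in> unitary_group"
  shows "det (mat 1 - map_matrix ((*) \<alpha>) (conj_transpose g)) = (\<Prod>i<CARD('n). inverse (ts ! i) * (ts ! i - \<alpha>))"
proof -
  have "((mat 1 - map_matrix ((*) \<alpha>) (conj_transpose g)) ** g) $ i $ j = g $ i $ j - (if i = j then \<alpha> else 0)" for i j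
  proof -
    have "(\<Sum>k\<in>UNIV. conj_transpose g $ i $ k * g $ k $ j) = (if i = j then 1 else 0)"
      using arg_cong[OF unitaryD(1)[OF g], of "\<lambda>A. A $ i $ j"] by (simp only: matrix_mult_nth mat_1_nth)
    moreover have "(\<Sum>k\<in>UNIV. mat 1 $ i $ k * g $ k $ j) = g $ i $ j"
      by (simp only: matrix_mult_nth[symmetric] matrix_mul_lid)
    ultimately show ?thesis
      by (simp add: matrix_mult_nth map_matrix_def left_diff_distrib sum_subtractf mult.assoc sum_distrib_left[symmetric])
  qed
  then have "(mat 1 - map_matrix ((*) \<alpha>) (conj_transpose g)) ** g = (\<chi> i j. (-1) * (\<chi> i j. (if i = j then \<alpha> else 0) - g $ i $ j) $ i $ j)"
    by (simp add: Finite_Cartesian_Product.vec_eq_iff)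
  then have "det (mat 1 - map_matrix ((*) \<alpha>) (conj_transpose g)) * det g = (-1) ^ CARD('n) * (\<Prod>i<CARD('n). \<alpha> - ts ! i)"
    using det_scale[of "-1" "\<chi> i j. (if i = j then \<alpha> else 0) - g $ i $ j"] det_eigenvalues[OF ts, of \<alpha>]
    by (simp add: Determinants.det_mul[symmetric])
  also have "\<dots> = (\<Prod>i<CARD('n). (-1) * (\<alpha> - ts ! i))" unfolding prod.distrib by simp
  also have "\<dots> = (\<Prod>i<CARD('n). ts ! i - \<alpha>)" by simp
  finally have "det (mat 1 - map_matrix ((*) \<alpha>) (conj_transpose g)) * det g = (\<Prod>i<CARD('n). ts ! i - \<alpha>)" .
  moreover have "det g \<noteq> 0" using unitary_det[OF g] by auto
  ultimately have "det (mat 1 - map_matrix ((*) \<alpha>) (conj_transpose g)) = inverse (det g) * (\<Prod>i<CARD('n). ts ! i - \<alpha>)"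
    by (simp add: field_simps)
  also have "inverse (det g) = (\<Prod>i<CARD('n). inverse (ts ! i))"
    unfolding det_eq_prod_eigenvalues[OF ts] prod_inversef[symmetric] by (simp add: comp_def)
  finally show ?thesis by (simp add: prod.distrib)
qed

definition moment_poly :: "complex multiset \<Rightarrow> complex multiset \<Rightarrow> complex poly"
  where "moment_poly A B = (\<Prod>a\<in>#A. [:- a, 1:]) * (\<Prod>b\<in>#B. [:1, - b:])"

lemma prod_mset_prod_swap: "(\<Prod>a\<in>#A. \<Prod>i\<in>S. f a i) = (\<Prod>i\<in>S. \<Prod>a\<in>#A. f a i)"
  by (induction A) (auto simp: prod.distrib)

lemma poly_prod_mset: "poly (\<Prod>a\<in>#A. p a) x = (\<Prod>a\<in>#A. poly (p a) x)"
  by (induction A) auto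

lemma coeff_int_sum:
  assumes "degree q \<le> D"
  shows "(\<Sum>b\<le>D. if int b = x then coeff q b else 0) = coeff_int q x"
proof (cases "0 \<le> x \<and> nat x \<le> D")
  case True
  then have "(\<Sum>b\<le>D. if int b = x then coeff q b else 0) = (\<Sum>b\<le>D. if b = nat x then coeff q (nat x) else 0)"
    by (intro sum.cong) auto
  then show ?thesis using True by (simp add: coeff_int_def)
next
  case False
  then have "(\<Sum>b\<le>D. if int b = x then coeff q b else 0) = 0" by (intro sum.neutral) auto
  moreover have "coeff_int q x = 0" using False assms by (auto simp: coeff_int_def intro!: coeff_eq_0)
  ultimately show ?thesis by simp
qed

theorem twisted_moment_eq_moment_det:
  fixes M :: "(complex^'n^'n) measure"
  assumes haar: "normalized_haar_measure M"
  shows "twisted_moment M A B l = moment_det CARD('n) (size A) l (moment_poly A B)"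
proof -
  let ?n = "CARD('n)" and ?m = "size A" and ?q = "moment_poly A B"
  let ?D = "degree ?q" and ?\<gamma> = "\<lambda>k. stair CARD('n) k + l k"
  let ?P = "PiE {..<?n} (\<lambda>_. {..?D})"
  have "\<forall>\<beta>. \<exists>F \<phi>. radial (F :: complex^'n^'n \<Rightarrow> complex) \<phi> \<and>
     (\<forall>t. (\<forall>i<?n. t i \<noteq> 0) \<longrightarrow> \<phi> t * vand ?n t = alt ?n \<beta> t)"
    using radial_schur_exists by blast
  then obtain F :: "(nat \<Rightarrow> int) \<Rightarrow> complex^'n^'n \<Rightarrow> complex" and \<phi> where
    F: "\<And>\<beta>. radial (F \<beta>) (\<phi> \<beta>)" and \<phi>: "\<And>\<beta> t. \<forall>i<?n. t i \<noteq> 0 \<Longrightarrow> \<phi> \<beta> t * vand ?n t = alt ?n \<beta> t"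
    by metis
  have \<phi>g: "\<phi> \<beta> t * vand ?n t = alt ?n \<beta> t" if "generic_tuple ?n t" for \<beta> t
    using \<phi> that by (simp add: generic_tuple_def)
  define c where "c f = (\<Prod>k<?n. coeff ?q (f k))" for f
  define \<beta> where "\<beta> f k = ?\<gamma> k - int ?m + int (f k)" for f k
  define L where "L t = (\<Prod>j<?n. inverse (t j) ^ ?m * poly ?q (t j)) * \<phi> ?\<gamma> t" for t
  define R where "R t = (\<Sum>f\<in>?P. c f * \<phi> (\<beta> f) t)" for t
  have radR: "radial (\<lambda>g. \<Sum>f\<in>?P. c f * F (\<beta> f) g) R"
    unfolding R_def[abs_def] by (intro radial_sum radial_mult radial_const F)
  \<comment> \<open>At the eigenvalues of a given \<open>g\<close> the Vandermonde product may
    vanish. It is cancelled at generic tuples, and continuity of both sides gives the rest.\<close>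
  have LR: "L t = R t" if t: "\<forall>i<?n. t i \<noteq> 0" for t
  proof (rule tuple_ext[of L t R ?n])
    show "(L \<longlongrightarrow> L t) (at t)"
      unfolding L_def[abs_def] using t
      by (intro tendsto_intros tendsto_coordinate radial_tendsto[OF F] tendsto_prod) auto
    show "(R \<longlongrightarrow> R t) (at t)" by (rule radial_tendsto[OF radR t])
    fix s assume s: "generic_tuple ?n s"
    then have nz: "\<forall>i<?n. s i \<noteq> 0" by (simp add: generic_tuple_def)
    have "L s * vand ?n s = (\<Prod>j<?n. s j powi (- int ?m) * poly ?q (s j)) * alt ?n ?\<gamma> s"
      unfolding L_def by (simp add: mult.assoc \<phi>g[OF s] power_int_minus power_inverse)
    also have "\<dots> = (\<Sum>f\<in>?P. c f * alt ?n (\<beta> f) s)"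
      unfolding alt_mult_symmetric[OF nz order_refl] c_def \<beta>_def ..
    also have "\<dots> = R s * vand ?n s" by (simp add: R_def sum_distrib_right mult.assoc \<phi>g[OF s])
    finally show "L s = R s" using vand_nonzero[of s ?n] s by (simp add: generic_tuple_def)
  qed
  have "twisted_moment M A B l = (LINT g|M. (\<Sum>f\<in>?P. c f * F (\<beta> f) g))"
    unfolding twisted_moment_def
  proof (rule Bochner_Integration.integral_cong [OF refl])
    fix g assume "g \<in> space M"
    then have g: "g \<in> unitary_group" by (simp add: haar_space[OF haar])
    \<comment> \<open>The enumeration of the eigenvalues that \<open>gen_schur_mset\<close> itself
      selects.\<close>
    define ts where "ts = (SOME xs. mset xs = eigenvalues_mset g)"
    have ts: "mset ts = eigenvalues_mset g" unfolding ts_def by (rule someI_ex) (rule ex_mset)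
    have nz: "\<forall>i<?n. ts ! i \<noteq> 0" using unitary_eigenvalues_nonzero[OF ts g] by blast
    have "size (eigenvalues_mset g) = ?n" using length_eigenvalues[OF ts] ts by (metis size_mset)
    then have "gen_schur_mset l (eigenvalues_mset g) = gen_schur ?n l ((!) ts)"
      by (simp add: gen_schur_mset_def ts_def)
    also have "\<dots> = \<phi> ?\<gamma> ((!) ts)"
      by (rule gen_schur_eq_radial[OF F _ nz]) (simp add: \<phi>g alternant_eq_alt)
    finally have 1: "gen_schur_mset l (eigenvalues_mset g) = \<phi> ?\<gamma> ((!) ts)" .
    have "(\<Prod>\<alpha>\<in>#A. det (mat 1 - map_matrix ((*) \<alpha>) (conj_transpose g))) * (\<Prod>\<beta>\<in>#B. det (mat 1 - map_matrix ((*) \<beta>) g)) =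
      (\<Prod>i<?n. (\<Prod>\<alpha>\<in>#A. inverse (ts ! i) * (ts ! i - \<alpha>)) * (\<Prod>\<beta>\<in>#B. 1 - \<beta> * ts ! i))"
      unfolding det_one_minus_conj_transpose[OF ts g] det_one_minus[OF ts] prod_mset_prod_swap
      by (rule prod.distrib[symmetric])
    also have "\<dots> = (\<Prod>i<?n. inverse (ts ! i) ^ ?m * poly ?q (ts ! i))"
      by (intro prod.cong refl) (simp add: moment_poly_def poly_prod_mset prod_mset.distrib mult_ac)
    finally have "(\<Prod>\<alpha>\<in>#A. det (mat 1 - map_matrix ((*) \<alpha>) (conj_transpose g))) * (\<Prod>\<beta>\<in>#B. det (mat 1 - map_matrix ((*) \<beta>) g)) *
       gen_schur_mset l (eigenvalues_mset g) = L ((!) ts)" by (simp add: 1 L_def)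
    also have "\<dots> = R ((!) ts)" by (rule LR[OF nz])
    also have "\<dots> = (\<Sum>f\<in>?P. c f * F (\<beta> f) g)" by (rule radial_eval[OF radR g ts, symmetric])
    finally show "(\<Prod>\<alpha>\<in>#A. det (mat 1 - map_matrix ((*) \<alpha>) (conj_transpose g))) * (\<Prod>\<beta>\<in>#B. det (mat 1 - map_matrix ((*) \<beta>) g)) *
       gen_schur_mset l (eigenvalues_mset g) = \<dots>" .
  qed
  also have "\<dots> = (\<Sum>f\<in>?P. c f * (LINT g|M. F (\<beta> f) g))"
    by (subst Bochner_Integration.integral_sum)
      (auto intro!: haar_integrable[OF haar] continuous_intros radial_continuous[OF F])
  also have "\<dots> = (\<Sum>f\<in>?P. c f * (\<Sum>\<sigma> | \<sigma> permutes {..<?n}. if \<forall>k<?n. \<beta> f k = stair ?n (\<sigma> k) then of_int (sign \<sigma>) else 0))"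
    by (intro sum.cong refl) (simp add: haar_integral_schur[OF haar F \<phi>g])
  also have "\<dots> = (\<Sum>\<sigma> | \<sigma> permutes {..<?n}. \<Sum>f\<in>?P. c f * (if \<forall>k<?n. \<beta> f k = stair ?n (\<sigma> k) then of_int (sign \<sigma>) else 0))"
    unfolding sum_distrib_left by (rule sum.swap)
  also have "\<dots> = (\<Sum>\<sigma> | \<sigma> permutes {..<?n}. of_int (sign \<sigma>) * (\<Prod>k<?n. coeff_int ?q (int ?m - l k + int k - int (\<sigma> k))))"
  proof (rule sum.cong [OF refl])
    fix \<sigma> assume "\<sigma> \<in> {\<sigma>. \<sigma> permutes {..<?n}}"
    \<comment> \<open>For fixed \<open>\<sigma>\<close> the condition prescribes every
      \<open>f k\<close> separately, as \<open>m - l k + k - \<sigma> k\<close>. The sum over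
      \<open>f\<close> therefore factors into single coefficients, and the value 0 of
      \<open>coeff_int\<close> at negative indices covers the prescriptions that no \<open>f\<close>
      meets.\<close>
    have "(\<Sum>f\<in>?P. c f * (if \<forall>k<?n. \<beta> f k = stair ?n (\<sigma> k) then of_int (sign \<sigma>) else 0)) =
      of_int (sign \<sigma>) * (\<Sum>f\<in>?P. \<Prod>k<?n. if int (f k) = int ?m - l k + int k - int (\<sigma> k) then coeff ?q (f k) else 0)"
      unfolding sum_distrib_left
    proof (rule sum.cong [OF refl])
      fix f
      have e: "\<beta> f k = stair ?n (\<sigma> k) \<longleftrightarrow> int (f k) = int ?m - l k + int k - int (\<sigma> k)" for k
        by (auto simp: \<beta>_def stair_def)
      show "c f * (if \<forall>k<?n. \<beta> f k = stair ?n (\<sigma> k) then of_int (sign \<sigma>) else 0) =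
        of_int (sign \<sigma>) * (\<Prod>k<?n. if int (f k) = int ?m - l k + int k - int (\<sigma> k) then coeff ?q (f k) else 0)"
      proof (cases "\<forall>k<?n. \<beta> f k = stair ?n (\<sigma> k)")
        case True
        then show ?thesis unfolding e c_def by (simp add: mult.commute)
      next
        case False
        then have "(\<Prod>k<?n. if int (f k) = int ?m - l k + int k - int (\<sigma> k) then coeff ?q (f k) else 0) = 0"
          unfolding e by auto
        then show ?thesis using False by auto
      qed
    qed
    also have "(\<Sum>f\<in>?P. \<Prod>k<?n. if int (f k) = int ?m - l k + int k - int (\<sigma> k) then coeff ?q (f k) else 0) =
      (\<Prod>k<?n. \<Sum>b\<le>?D. if int b = int ?m - l k + int k - int (\<sigma> k) then coeff ?q b else 0)"
      by (rule prod_sum_PiE[symmetric]) auto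
    finally show "(\<Sum>f\<in>?P. c f * (if \<forall>k<?n. \<beta> f k = stair ?n (\<sigma> k) then of_int (sign \<sigma>) else 0)) =
       of_int (sign \<sigma>) * (\<Prod>k<?n. coeff_int ?q (int ?m - l k + int k - int (\<sigma> k)))"
      by (simp add: coeff_int_sum)
  qed
  finally show ?thesis unfolding moment_det_def det_mat_leibniz .
qed

section \<open>Analytic continuation\<close>

lemma entire_const: "entire_function (\<lambda>_. c)"
  unfolding entire_function_def by (auto intro!: exI[of _ "\<lambda>_. 0"])

lemma entire_coordinate: "entire_function (\<lambda>z :: complex^'d. z $ i)"
proof -
  have "((\<lambda>z :: complex^'d. z $ i) has_derivative (\<lambda>v. v $ i)) (at z)" for z
    by (rule bounded_linear.has_derivative[OF bounded_linear_vec_nth has_derivative_ident])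
  then show ?thesis unfolding entire_function_def by (intro allI exI[of _ "\<lambda>v. v $ i"]) simp
qed

lemma entire_add:
  assumes "entire_function f" "entire_function g"
  shows "entire_function (\<lambda>z. f z + g z)"
  unfolding entire_function_def
proof
  fix z
  obtain L L' where "(f has_derivative L) (at z)" "\<forall>c v. L (c *s v) = c * L v"
    "(g has_derivative L') (at z)" "\<forall>c v. L' (c *s v) = c * L' v"
    using assms unfolding entire_function_def by meson
  then show "\<exists>L. ((\<lambda>z. f z + g z) has_derivative L) (at z) \<and> (\<forall>c v. L (c *s v) = c * L v)"
    by (intro exI[of _ "\<lambda>v. L v + L' v"] conjI allI has_derivative_add) (simp_all add: algebra_simps)
qed

lemma entire_mult:
  assumes "entire_function f" "entire_function g"
  shows "entire_function (\<lambda>z. f z * g z)"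
  unfolding entire_function_def
proof
  fix z
  obtain L L' where "(f has_derivative L) (at z)" "\<forall>c v. L (c *s v) = c * L v"
    "(g has_derivative L') (at z)" "\<forall>c v. L' (c *s v) = c * L' v"
    using assms unfolding entire_function_def by meson
  then show "\<exists>L. ((\<lambda>z. f z * g z) has_derivative L) (at z) \<and> (\<forall>c v. L (c *s v) = c * L v)"
    by (intro exI[of _ "\<lambda>v. f z * L' v + L v * g z"] conjI allI has_derivative_mult) (simp_all add: algebra_simps)
qed

lemma entire_sum: "(\<And>a. a \<in> S \<Longrightarrow> entire_function (f a)) \<Longrightarrow> entire_function (\<lambda>z. \<Sum>a\<in>S. f a z)"
  by (induction S rule: infinite_finite_induct) (auto intro: entire_const entire_add)

lemma entire_prod: "(\<And>a. a \<in> S \<Longrightarrow> entire_function (f a)) \<Longrightarrow> entire_function (\<lambda>z. \<Prod>a\<in>S. f a z)"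
  by (induction S rule: infinite_finite_induct) (auto intro: entire_const entire_mult)

lemma entire_coeff_linear_prod:
  assumes "\<And>i. entire_function (a i)" "\<And>i. entire_function (b i)"
  shows "entire_function (\<lambda>z. coeff (\<Prod>i\<in>S. [:a i z, b i z:]) k)"
proof (induction S arbitrary: k rule: infinite_finite_induct)
  case (insert x S)
  have c: "coeff ([:a x z, b x z:] * p) k = a x z * coeff p k + (if k = 0 then 0 else b x z * coeff p (k - 1))" for z p
    by (cases k) auto
  have "entire_function (\<lambda>z. a x z * coeff (\<Prod>i\<in>S. [:a i z, b i z:]) k +
     (if k = 0 then 0 else b x z * coeff (\<Prod>i\<in>S. [:a i z, b i z:]) (k - 1)))"
    by (cases "k = 0") (auto intro!: entire_add entire_mult assms insert.IH entire_const)
  then show ?case unfolding prod.insert[OF insert.hyps] c .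
qed (auto intro: entire_const)

lemma entire_continuous:
  assumes "entire_function F" shows "isCont F z"
  using assms unfolding entire_function_def by (meson has_derivative_continuous)

lemma finite_real_roots:
  assumes "(p :: complex poly) \<noteq> 0" shows "finite {\<epsilon> :: real. poly p (of_real \<epsilon>) = 0}"
proof -
  have "finite (complex_of_real -` {x. poly p x = 0})"
    by (rule finite_vimageI[OF poly_roots_finite[OF assms]]) (simp add: inj_of_real)
  then show ?thesis by (simp add: vimage_def)
qed

text \<open>A line through \<open>z\<close> on which the coordinates move with distinct positive
  speeds. Each violation of genericity is a nonzero polynomial equation of degree at most 2 in
  \<epsilon>; coincidences with inverses are the equations that a product of two coordinates,
  possibly the same one, equals 1.\<close>

lemma generic_points_approach:
  fixes z :: "complex^'d"
  assumes IJ: "I \<inter> J = {}"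
  obtains p :: "real \<Rightarrow> complex^'d" where "(p \<longlongrightarrow> z) (at_right 0)"
    "eventually (\<lambda>\<epsilon>. p \<epsilon> \<in> generic_points I J) (at_right 0)"
proof -
  obtain f :: "'d \<Rightarrow> nat" where f: "inj f"
    using finite_imp_inj_to_nat_seg[of "UNIV :: 'd set"] by auto
  define e :: "'d \<Rightarrow> complex" where "e i = of_nat (Suc (f i))" for i
  have e0: "e i \<noteq> 0" for i unfolding e_def by (simp del: of_nat_Suc)
  have einj: "e i \<noteq> e j" if "i \<noteq> j" for i j using f that by (auto simp: e_def inj_def)
  define p where "p \<epsilon> = (\<chi> i. z $ i + of_real \<epsilon> * e i)" for \<epsilon> :: real
  have pn: "p \<epsilon> $ i = z $ i + of_real \<epsilon> * e i" for \<epsilon> i by (simp add: p_def)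
  have "(p \<longlongrightarrow> p 0) (at_right 0)"
    unfolding p_def by (intro tendsto_intros)
  then have "(p \<longlongrightarrow> z) (at_right 0)" by (simp add: p_def)
  moreover have "eventually (\<lambda>\<epsilon>. p \<epsilon> \<in> generic_points I J) (at_right 0)"
  proof -
    have 1: "finite {\<epsilon>. p \<epsilon> $ i = 0}" for i
      using finite_real_roots[of "[:z $ i, e i:]"] e0 by (simp add: pn)
    have 2: "finite {\<epsilon>. p \<epsilon> $ i = p \<epsilon> $ j}" if "i \<noteq> j" for i j
    proof -
      have "finite {\<epsilon> :: real. poly [:z $ i - z $ j, e i - e j:] (of_real \<epsilon>) = 0}"
        by (rule finite_real_roots) (use einj[OF that] in simp)
      then show ?thesis by (rule rev_finite_subset) (auto simp: pn algebra_simps)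
    qed
    have 3: "finite {\<epsilon>. p \<epsilon> $ i * p \<epsilon> $ j = 1}" for i j
    proof -
      have "finite {\<epsilon> :: real. poly [:z $ i * z $ j - 1, z $ i * e j + z $ j * e i, e i * e j:] (of_real \<epsilon>) = 0}"
        by (rule finite_real_roots) (use e0 in simp)
      then show ?thesis by (rule rev_finite_subset) (auto simp: pn algebra_simps)
    qed
    have "finite ((\<Union>i. {\<epsilon>. p \<epsilon> $ i = 0}) \<union> (\<Union>i. \<Union>j\<in>- {i}. {\<epsilon>. p \<epsilon> $ i = p \<epsilon> $ j}) \<union> (\<Union>i. \<Union>j. {\<epsilon>. p \<epsilon> $ i * p \<epsilon> $ j = 1}))"
      using 1 2 3 by auto
    from eventually_at_right_not_in_finite[OF this] show ?thesis
    proof eventually_elim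
      case (elim \<epsilon>)
      then have g: "\<And>i. p \<epsilon> $ i \<noteq> 0" "\<And>i j. i \<noteq> j \<Longrightarrow> p \<epsilon> $ i \<noteq> p \<epsilon> $ j" "\<And>i j. p \<epsilon> $ i * p \<epsilon> $ j \<noteq> 1"
        by auto
      have inv: "p \<epsilon> $ i \<noteq> inverse (p \<epsilon> $ j)" for i j
        using g(1)[of j] g(3)[of i j] by auto
      have "inj (($) (p \<epsilon>))" using g(2) by (auto simp: inj_def)
      moreover have "($) (p \<epsilon>) ` I \<inter> ($) (p \<epsilon>) ` J = {}"
      proof -
        have "p \<epsilon> $ i \<noteq> p \<epsilon> $ j" if "i \<in> I" "j \<in> J" for i j using g(2)[of i j] IJ that by auto
        then show ?thesis by auto
      qed
      moreover have "($) (p \<epsilon>) ` S \<inter> inverse ` ($) (p \<epsilon>) ` T = {}" for S T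
        using inv by (auto simp: disjoint_iff)
      moreover have "inverse ` S \<inter> inverse ` T = {}" if "S \<inter> T = {}" for S T :: "complex set"
        using that by auto
      moreover have "0 \<notin> ($) (p \<epsilon>) ` S" for S using g(1) by (auto simp: image_iff dest: sym)
      ultimately show ?case
        unfolding generic_points_def admissible_pair_def by (simp add: inj_on_subset[OF _ subset_UNIV])
    qed
  qed
  ultimately show thesis by (rule that)
qed

text \<open>Generic points are dense, so continuity is enough to identify two entire
  functions.\<close>

lemma entire_eq_on_generic_points:
  fixes F G :: "complex^'d \<Rightarrow> complex"
  assumes "I \<inter> J = {}" "entire_function F" "entire_function G"
    and eq: "\<And>z. z \<in> generic_points I J \<Longrightarrow> F z = G z"
  shows "F = G"
proof
  fix z
  obtain p :: "real \<Rightarrow> complex^'d" where p: "(p \<longlongrightarrow> z) (at_right 0)"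
    "eventually (\<lambda>\<epsilon>. p \<epsilon> \<in> generic_points I J) (at_right 0)"
    by (rule generic_points_approach[OF assms(1)]) (rule that)
  have "((\<lambda>\<epsilon>. F (p \<epsilon>)) \<longlongrightarrow> F z) (at_right 0)"
    by (rule isCont_tendsto_compose[OF entire_continuous[OF assms(2)] p(1)])
  moreover have "((\<lambda>\<epsilon>. G (p \<epsilon>)) \<longlongrightarrow> G z) (at_right 0)"
    by (rule isCont_tendsto_compose[OF entire_continuous[OF assms(3)] p(1)])
  then have "((\<lambda>\<epsilon>. F (p \<epsilon>)) \<longlongrightarrow> G z) (at_right 0)"
    by (rule Lim_transform_eventually) (use p(2) in \<open>eventually_elim, simp add: eq\<close>)
  ultimately show "F z = G z" by (rule tendsto_unique[rotated]) simp
qed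

lemma entire_moment_det:
  "entire_function (\<lambda>z :: complex^'d. moment_det n m l (moment_poly (coords_mset I z) (coords_mset J z)))"
proof -
  have q: "moment_poly (coords_mset I z) (coords_mset J z) = (\<Prod>i\<in>I. [:- z $ i, 1:]) * (\<Prod>j\<in>J. [:1, - z $ j:])" for z :: "complex^'d"
    by (simp add: moment_poly_def coords_mset_def multiset.map_comp comp_def prod_unfold_prod_mset)
  have neg: "entire_function (\<lambda>z :: complex^'d. - z $ i)" for i
    using entire_mult[OF entire_const[of "-1"] entire_coordinate[of i]] by simp
  have "entire_function (\<lambda>z :: complex^'d. coeff_int ((\<Prod>i\<in>I. [:- z $ i, 1:]) * (\<Prod>j\<in>J. [:1, - z $ j:])) k)" for k
  proof (cases "k < 0")
    case False
    then show ?thesis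
      unfolding coeff_int_def coeff_mult if_not_P[OF False]
      by (intro entire_sum entire_mult entire_coeff_linear_prod entire_const neg)
  qed (simp add: coeff_int_def entire_const)
  then show ?thesis
    unfolding moment_det_def det_mat_leibniz q
    by (intro entire_sum entire_mult entire_prod entire_const)
qed

theorem theorem1p3:
  fixes M :: "(complex^'n^'n) measure"
    and l :: "nat \<Rightarrow> int"
    and I J :: "'d::finite set"
  assumes "normalized_haar_measure M"
    and "dominant_weight CARD('n) l"
    and "I \<inter> J = {}"
  shows
    "(\<forall>A B. admissible_pair A B \<longrightarrow>
        twisted_moment M (mset_set A) (mset_set B) l = recipe_sum CARD('n) l A B)
     \<and>
     (\<exists>!F. entire_continuation (generic_points I J)
        (\<lambda>z. recipe_sum CARD('n) l (($) z ` I) (($) z ` J)) F)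
     \<and>
     (\<forall>F. entire_continuation (generic_points I J)
        (\<lambda>z. recipe_sum CARD('n) l (($) z ` I) (($) z ` J)) F \<longrightarrow>
        (\<forall>z. twisted_moment M (coords_mset I z) (coords_mset J z) l = F z))"
proof -
  have sets: "twisted_moment M (mset_set A) (mset_set B) l = recipe_sum CARD('n) l A B" if "admissible_pair A B" for A B
    unfolding twisted_moment_eq_moment_det[OF assms(1)] recipe_sum_eq_moment_det[OF that assms(2)] moment_poly_def prod_mset_mset_set
    by simp
  \<comment> \<open>The moment is defined for arbitrary multisets and serves as the continuation; it
    is entire because it equals the coefficient determinant.\<close>
  define F0 where "F0 z = twisted_moment M (coords_mset I z) (coords_mset J z) l" for z :: "complex^'d"
  let ?ec = "entire_continuation (generic_points I J) (\<lambda>z. recipe_sum CARD('n) l (($) z ` I) (($) z ` J))"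
  have "F0 z = recipe_sum CARD('n) l (($) z ` I) (($) z ` J)" if "z \<in> generic_points I J" for z
    using that sets unfolding F0_def generic_points_def coords_mset_def by (simp add: image_mset_mset_set)
  moreover have "entire_function F0"
    unfolding F0_def twisted_moment_eq_moment_det[OF assms(1)]
    using entire_moment_det[of "CARD('n)" "card I" l I J] by (simp add: coords_mset_def)
  ultimately have F0: "?ec F0" by (simp add: entire_continuation_def)
  have uniq: "F = F0" if "?ec F" for F
    using that F0 by (intro entire_eq_on_generic_points[OF assms(3)]) (auto simp: entire_continuation_def)
  from sets F0 uniq show ?thesis unfolding F0_def by blast
qed

end
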